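(* Let $V$ be a finite-dimensional real normed space with $\dim V\ge2$, and let $\gamma:[0,T]\to V$ be a continuous bounded-variation path with $\gamma_0=0$, $v=\gamma_T\ne0$, and $R(\log S(\gamma))=\infty$. Fix $\ell\in V^*$ with $\ell(v)=1$, put $W=\ker\ell$, and write $\gamma_t=x_tv+X_t$ with $x_t=\ell(\gamma_t)$ and $X_t\in W$. Let $\Lambda\subset2\pi\mathbb Q$ be finite and symmetric ($\Lambda=-\Lambda$), and put $h_\Lambda=S(B^\Lambda(\gamma))$. Choose $m\ge1$ such that $$m\omega\in2\pi\mathbb Z\qquad(\omega\in\Lambda).$$ Then $$h_\Lambda\,T_\Lambda(h_\Lambda)\cdots T_\Lambda^{m-1}(h_\Lambda)=1.$$ Equivalently, the decorated transverse path $B^\Lambda(\gamma^{*m})$ associated with the $m$-fold concatenation power $\gamma^{*m}$ of $\gamma$ has trivial signature.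
   Context: Signature: for a continuous bounded-variation path $\eta:[0,T]\to E$ in a finite-dimensional real vector space, $S(\eta)=\sum_{n\ge0}S_n(\eta)\in\prod_{n\ge0}E^{\otimes n}$, $S_0=1$, $S_n(\eta)=\int_{0<t_1<\cdots<t_n<T}d\eta_{t_1}\otimes\cdots\otimes d\eta_{t_n}$; the product is the tensor concatenation product. Radius: $V_{\mathbb C}=V\otimes_{\mathbb R}\mathbb C$ carries the norm $\|z\|=\sup\{|\lambda_{\mathbb C}(z)|:\lambda\in V^*,\|\lambda\|\le1\}$, $\|\cdot\|_{\pi,n}$ is the projective tensor norm on $V_{\mathbb C}^{\otimes n}$; for $l=\log S(\gamma)=\sum_{n\ge1}l_n$ (formal logarithm), $R(l)=(\limsup_n\|l_n\|_{\pi,n}^{1/n})^{-1}$ with $0^{-1}=\infty$. Decorated paths: give $W$ an auxiliary Euclidean norm, with complexification $W_{\mathbb C}$. Let $E_\Lambda=\{(z_\omega)_{\omega\in\Lambda}\in\prod_{\omega\in\Lambda}W_{\mathbb C}: z_{-\omega}=\overline{z_\omega}\}$, a finite-dimensional real Hilbert space with the direct-sum norm. For a continuous bounded-variation path $\beta$ in $V$ starting at $0$, written $\beta_t=x_tv+X_t$ with $x_t=\ell(\beta_t)$ and $X_t\in W$, set $B^\Lambda_t(\beta)=\big(\int_0^te^{i\omega x_s}\,dX_s\big)_{\omega\in\Lambda}\in E_\Lambda$ (Riemann–Stieltjes). $T_\Lambda:E_\Lambda\to E_\Lambda$ is the orthogonal map $(T_\Lambda z)_\omega=e^{i\omega}z_\omega$;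 the same symbol denotes the induced graded automorphism of tensor series over $E_\Lambda$. $\gamma^{*m}$ is the translated concatenation of $m$ copies of $\gamma$, parametrised on $[0,mT]$. *)

theory Defs
  imports "HOL-Analysis.Analysis" "HOL-Library.Function_Algebras"
begin

section \<open>Pointwise real vector space structure on functions\<close>

(* Needed so that the space of decorations, whose vectors are families indexed by frequencies,
   is a real vector space. *)
instantiation "fun" :: (type, real_vector) real_vector
begin
definition scaleR_fun_def: "r *\<^sub>R f = (\<lambda>x. r *\<^sub>R f x)"
instance
  by standard (simp_all add: scaleR_fun_def fun_eq_iff scaleR_add_right scaleR_add_left)
end


section \<open>Riemann--Stieltjes integration and bounded variation\<close>

(* The mesh of the tagged division p is controlled by the constant gauge "ball x d"; the
   summation over (x, K) uses f(x) (g(max K) - g(min K)).  The parameter prd is the bilinear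
   pairing of the values of f with the values of g. *)
definition has_rs_integral ::
  "('a \<Rightarrow> 'b::real_normed_vector \<Rightarrow> 'c::real_normed_vector) \<Rightarrow>
   (real \<Rightarrow> 'a) \<Rightarrow> (real \<Rightarrow> 'b) \<Rightarrow> real \<Rightarrow> real \<Rightarrow> 'c \<Rightarrow> bool"
  where
  "has_rs_integral prd f g a b I \<longleftrightarrow>
     (\<forall>e>0. \<exists>d>0. \<forall>p. p tagged_division_of {a..b} \<and> (\<lambda>x. ball x d) fine p \<longrightarrow>
        norm ((\<Sum>(x, K)\<in>p. prd (f x) (g (Sup K) - g (Inf K))) - I) < e)"

definition rs_integral ::
  "('a \<Rightarrow> 'b::real_normed_vector \<Rightarrow> 'c::real_normed_vector) \<Rightarrow>
   (real \<Rightarrow> 'a) \<Rightarrow> (real \<Rightarrow> 'b) \<Rightarrow> real \<Rightarrow> real \<Rightarrow> 'c"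
  where "rs_integral prd f g a b = (THE I. has_rs_integral prd f g a b I)"

definition bounded_variation_on :: "real \<Rightarrow> real \<Rightarrow> (real \<Rightarrow> 'a::real_normed_vector) \<Rightarrow> bool" where
  "bounded_variation_on a b f \<longleftrightarrow>
     (\<exists>B. \<forall>D. D division_of {a..b} \<longrightarrow> (\<Sum>K\<in>D. norm (f (Sup K) - f (Inf K))) \<le> B)"


section \<open>Tensor series\<close>

(* Linear functionals.  For a finite-dimensional normed space this is also the topological dual. *)
typedef (overloaded) 'e covector = "{f :: 'e::real_vector \<Rightarrow> real. linear f}"
  morphisms cov Abs_covector
proof -
  have "linear (\<lambda>_::'e. 0::real)" by (rule linearI) simp_all
  then show ?thesis by blast
qed

(* A tensor of degree n over a finite-dimensional space E is identified with the multilinear form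
   it defines on n linear functionals, where z1 (x) ... (x) zn is the form
   (f1, ..., fn) |-> f1(z1) ... fn(zn).  A tensor series t is encoded by the values
   t [f1, ..., fn] of its degree n components, for all n.
   If E is a subspace of a larger space A, functionals on E are the restrictions of functionals
   on A, so that tensor series over E are, injectively, among those over A. *)
type_synonym ('e, 'k) tseries = "'e covector list \<Rightarrow> 'k"

definition tone :: "('e::real_vector, 'k::comm_ring_1) tseries" where
  "tone fs = (if fs = [] then 1 else 0)"

(* (s (x) t)(f1, ..., fn) = sum over k of s(f1, ..., fk) t(fk+1, ..., fn):
   the tensor concatenation product *)
definition tmul :: "('e::real_vector, 'k::comm_ring_1) tseries \<Rightarrow> ('e, 'k) tseries \<Rightarrow> ('e, 'k) tseries"
  where "tmul s t fs = (\<Sum>k\<le>length fs. s (take k fs) * t (drop k fs))"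

primrec tpow :: "('e::real_vector, 'k::comm_ring_1) tseries \<Rightarrow> nat \<Rightarrow> ('e, 'k) tseries" where
  "tpow t 0 = tone"
| "tpow t (Suc k) = tmul t (tpow t k)"

definition tprod_list :: "('e::real_vector, 'k::comm_ring_1) tseries list \<Rightarrow> ('e, 'k) tseries" where
  "tprod_list ts = foldr tmul ts tone"

(* Formal logarithm of a series g with constant term 1: since g - 1 has no constant term, only
   the powers k \<le> n contribute in degree n. *)
definition tlog :: "('e::real_vector, real) tseries \<Rightarrow> ('e, real) tseries" where
  "tlog g fs = (\<Sum>k=1..length fs. (- 1) ^ (k + 1) / real k * tpow (\<lambda>us. g us - tone us) k fs)"

definition pullback :: "('e::real_vector \<Rightarrow> 'e) \<Rightarrow> 'e covector \<Rightarrow> 'e covector" where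
  "pullback A f = Abs_covector (cov f \<circ> A)"

(* The graded algebra endomorphism induced by a linear map A:
   <A z1 (x) ... (x) A zn, (f1, ..., fn)> = <z1 (x) ... (x) zn, (f1 o A, ..., fn o A)> *)
definition tmap :: "('e::real_vector \<Rightarrow> 'e) \<Rightarrow> ('e, 'k) tseries \<Rightarrow> ('e, 'k) tseries" where
  "tmap A t = (\<lambda>fs. t (map (pullback A) fs))"


section \<open>Signature\<close>

(* iter_int eta [fn, ..., f1] t is the integral of d(f1 eta)_{t1} ... d(fn eta)_{tn} over
   0 < t1 < ... < tn < t; the functionals are listed in reverse order, the head belonging to the
   outermost (last) integration. *)
primrec iter_int :: "(real \<Rightarrow> 'e::real_vector) \<Rightarrow> 'e covector list \<Rightarrow> real \<Rightarrow> real" where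
  "iter_int \<eta> [] t = 1"
| "iter_int \<eta> (f # fs) t = rs_integral (*) (iter_int \<eta> fs) (\<lambda>s. cov f (\<eta> s)) 0 t"

(* signature of the path eta on [0, T] *)
definition path_sig :: "real \<Rightarrow> (real \<Rightarrow> 'e::real_vector) \<Rightarrow> ('e, real) tseries" where
  "path_sig T \<eta> fs = iter_int \<eta> (rev fs) T"


section \<open>Complexification, projective norms and the radius of the logarithm\<close>

(* the pair (x, y) stands for x + i y *)
type_synonym 'v cplx = "'v \<times> 'v"

definition ccov :: "'v::real_vector covector \<Rightarrow> 'v cplx \<Rightarrow> complex" where
  "ccov f z = Complex (cov f (fst z)) (cov f (snd z))"

definition cscale :: "complex \<Rightarrow> 'v::real_vector cplx \<Rightarrow> 'v cplx" where
  "cscale c z = (Re c *\<^sub>R fst z - Im c *\<^sub>R snd z, Re c *\<^sub>R snd z + Im c *\<^sub>R fst z)"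

definition cconj :: "'v::real_vector cplx \<Rightarrow> 'v cplx" where
  "cconj z = (fst z, - snd z)"

definition cplx_norm :: "'v::real_normed_vector cplx \<Rightarrow> real" where
  "cplx_norm z = (SUP f\<in>{f. onorm (cov f) \<le> 1}. cmod (ccov f z))"

(* Complex tensors over the complexification are determined by their values on real functionals
   (extended complex linearly), hence are encoded by complex-valued series. *)
definition elem_tensor :: "'v::real_vector cplx list \<Rightarrow> ('v, complex) tseries" where
  "elem_tensor zs fs = (\<Prod>(f, z)\<leftarrow>zip fs zs. ccov f z)"

(* Projective norm of the degree n component of t.  For n \<ge> 1 scalar coefficients are absorbed
   in the elementary tensors. *)
definition proj_norm :: "nat \<Rightarrow> ('v::real_normed_vector, complex) tseries \<Rightarrow> real" where
  "proj_norm n t = Inf {(\<Sum>zs\<leftarrow>zss. \<Prod>z\<leftarrow>zs. cplx_norm z) | zss.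
      (\<forall>zs\<in>set zss. length zs = n) \<and>
      (\<forall>fs. length fs = n \<longrightarrow> t fs = (\<Sum>zs\<leftarrow>zss. elem_tensor zs fs))}"

(* in ereal, inverse 0 = \<infinity> *)
definition tradius :: "('v::real_normed_vector, real) tseries \<Rightarrow> ereal" where
  "tradius l = inverse (limsup (\<lambda>n. ereal (root n (proj_norm n (\<lambda>fs. complex_of_real (l fs))))))"


section \<open>Decorated paths\<close>

(* The space E_\<Lambda> over the subspace W.  Families (z_\<omega>) over \<Lambda> are extended by 0 to all real
   frequencies, which makes E_\<Lambda> a subspace of the functions real \<Rightarrow> 'v cplx. *)
definition deco_space :: "real set \<Rightarrow> 'v::real_vector set \<Rightarrow> (real \<Rightarrow> 'v cplx) set" where
  "deco_space \<Lambda> W = {z. (\<forall>\<omega>. \<omega> \<notin> \<Lambda> \<longrightarrow> z \<omega> = 0) \<and>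
     (\<forall>\<omega>\<in>\<Lambda>. z \<omega> \<in> W \<times> W \<and> z (- \<omega>) = cconj (z \<omega>))}"

definition deco_rot :: "real set \<Rightarrow> (real \<Rightarrow> 'v::real_vector cplx) \<Rightarrow> real \<Rightarrow> 'v cplx" where
  "deco_rot \<Lambda> z = (\<lambda>\<omega>. if \<omega> \<in> \<Lambda> then cscale (cis \<omega>) (z \<omega>) else 0)"

(* B^\<Lambda>_t(\<beta>), with x_s = l(\<beta>_s) and X_s = \<beta>_s - x_s v; the increments of X in the real space are
   multiplied by complex scalars into the complexification. *)
definition deco_path ::
  "real set \<Rightarrow> ('v \<Rightarrow> real) \<Rightarrow> 'v \<Rightarrow> (real \<Rightarrow> 'v) \<Rightarrow> real \<Rightarrow> real \<Rightarrow> 'v::real_normed_vector cplx" where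
  "deco_path \<Lambda> l v \<beta> t = (\<lambda>\<omega>. if \<omega> \<in> \<Lambda>
     then rs_integral (\<lambda>c w. cscale c (w, 0)) (\<lambda>s. cis (\<omega> * l (\<beta> s))) (\<lambda>s. \<beta> s - l (\<beta> s) *\<^sub>R v) 0 t
     else 0)"

lemma subspace_deco_space:
  assumes "subspace W" "uminus ` \<Lambda> = \<Lambda>"
  shows "subspace (deco_space \<Lambda> W)"
  using assms unfolding subspace_def deco_space_def
  by (auto simp: cconj_def scaleR_fun_def zero_prod_def mem_Times_iff prod_eq_iff)

lemma linear_deco_rot: "linear (deco_rot \<Lambda>)"
  by (rule linearI)
     (auto simp: deco_rot_def cscale_def scaleR_fun_def fun_eq_iff prod_eq_iff algebra_simps)

lemma deco_rot_in_deco_space: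
  assumes "subspace W" "uminus ` \<Lambda> = \<Lambda>" "z \<in> deco_space \<Lambda> W"
  shows "deco_rot \<Lambda> z \<in> deco_space \<Lambda> W"
proof -
  have neg: "- \<omega> \<in> \<Lambda>" if "\<omega> \<in> \<Lambda>" for \<omega>
    using assms(2) that by blast
  have "fst (z \<omega>) \<in> W" "snd (z \<omega>) \<in> W" "z (- \<omega>) = cconj (z \<omega>)" if "\<omega> \<in> \<Lambda>" for \<omega>
    using assms(3) that by (auto simp: deco_space_def mem_Times_iff)
  then show ?thesis
    using assms(1) neg
    by (auto simp: deco_space_def deco_rot_def cscale_def cconj_def
        subspace_add subspace_diff subspace_scale)
qed


section \<open>Translated concatenation powers\<close>

(* \<gamma> on [0, S] followed by the translate of \<eta> that starts at the endpoint of \<gamma> *)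
definition path_concat :: "real \<Rightarrow> (real \<Rightarrow> 'v::real_vector) \<Rightarrow> (real \<Rightarrow> 'v) \<Rightarrow> real \<Rightarrow> 'v" where
  "path_concat S \<gamma> \<eta> t = (if t \<le> S then \<gamma> t else \<gamma> S + (\<eta> (t - S) - \<eta> 0))"

(* for \<gamma> on [0, T] starting at 0; the m-th power is parametrised on [0, m T] *)
primrec path_pow :: "real \<Rightarrow> (real \<Rightarrow> 'v::real_vector) \<Rightarrow> nat \<Rightarrow> real \<Rightarrow> 'v" where
  "path_pow T \<gamma> 0 = (\<lambda>_. 0)"
| "path_pow T \<gamma> (Suc m) = path_concat (real m * T) (path_pow T \<gamma> m) \<gamma>"

end

theory Submission
  imports Defs "HOL-Complex_Analysis.Complex_Analysis" "Jordan_Normal_Form.Schur_Decomposition"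
begin

text \<open>
  Let \<open>A\<close> be a linear map from \<open>V\<close> to skew-Hermitian \<open>N \<times> N\<close> matrices and let \<open>F(z)\<close> be the
  development of \<open>\<gamma>\<close> under \<open>z A\<close>.  Since the logarithm \<open>l\<close> of the signature has infinite radius,
  \<open>F = exp L\<close> for the entire matrix function \<open>L(z) = \<Sum> z^n A(l_n)\<close>.  The bound
  \<open>norm (F(z)) \<le> const * exp (C |z|)\<close> controls the real parts of the eigenvalues of \<open>L(z)\<close>, and hence
  \<open>tr (exp (t L(z)))\<close> for every \<open>t > 0\<close>; Cauchy's estimate on \<open>|z| = 1/t\<close> as \<open>t\<close> tends to \<open>0\<close> forces
  \<open>tr (L(z)^k) = z^k tr (A(v)^k)\<close>.  So \<open>tr (F(1)^m) = tr (exp (m A(v)))\<close>, which equals \<open>N\<close> if \<open>A(v)\<close> is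
  diagonal with eigenvalues in \<open>(2 \<pi> i / m) \<int>\<close>.  But \<open>F(1)^m\<close> is unitary, so it is the identity.

  Take \<open>A(y) = l(y) diag (i \<theta>_0, ..., i \<theta>_n) + \<epsilon> \<Sum>_j \<alpha>_j(y) (E_{j-1,j} - E_{j,j-1})\<close> with functionals \<open>\<alpha>_j\<close>
  vanishing on \<open>v\<close>.  In the rotating frame the entry \<open>(0, n)\<close> of the development of \<open>\<gamma>^{*m}\<close> has, in order
  \<open>\<epsilon>^n\<close>, the iterated integral of \<open>exp (i (\<theta>_{j-1} - \<theta>_j) x) d\<alpha>_j\<close> as coefficient; therefore that integral
  vanishes.  These integrals span the coefficients of the signature of the decorated path of \<open>\<gamma>^{*m}\<close>, and
  Chen's identity turns its triviality into the product formula.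
\<close>

section \<open>Differentials along a control function\<close>

text \<open>\<open>L\<close> is entire of unknown growth and not normal, so a norm bound for
  \<open>exp L\<close> says nothing about the norm of \<open>exp (t L)\<close> with
  \<open>0 < t < 1\<close>. Eigenvalues do scale: \<open>Re \<mu> \<le> ln M + C |z|\<close> becomes
  \<open>t Re \<mu> \<le> t ln M + C\<close> on \<open>|z| = 1/t\<close>. Hence only traces are
  controlled, and unitarity is what recovers a matrix from its trace. It forces \<open>A\<close> to
  be skew-Hermitian, so the couplings \<open>E_{j-1,j}\<close> that build the integral come with
  backward partners \<open>E_{j,j-1}\<close>, which would mix in other words. The parameter
  \<epsilon> separates them: the direct walk from \<open>0\<close> to \<open>n\<close> costs
  \<open>\<epsilon>^n\<close>, every walk with a step back costs more. Since the
  \<open>\<alpha>_j\<close> vanish on \<open>v\<close>, the matrix \<open>A(v)\<close> does not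
  involve \<epsilon>, so the development of \<open>\<gamma>^{*m}\<close> is the identity for all
  \<epsilon> simultaneously and its leading coefficient can be extracted. The phases are free up to
  resonance, so every word of frequencies from \<Lambda> occurs, with \<open>\<theta>\<close> as its
  partial sums up to sign. A real functional of the decorated path is a complex combination of
  integrals with frequencies \<open>\<omega>\<close> and \<open>- \<omega>\<close>, both resonant,
  so words in these letters suffice.\<close>

lemma sum_increments_le:
  fixes x :: "nat \<Rightarrow> real" and V :: "real \<Rightarrow> real"
  assumes "\<And>i. i < n \<Longrightarrow> norm (F i :: 'a::real_normed_vector) \<le> k * (V (x (Suc i)) - V (x i))"
  shows "norm (\<Sum>i<n. F i) \<le> k * (V (x n) - V (x 0))"
proof -
  have "norm (\<Sum>i<n. F i) \<le> (\<Sum>i<n. k * (V (x (Suc i)) - V (x i)))"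
    by (rule order_trans[OF norm_sum sum_mono]) (use assms in auto)
  also have "\<dots> = k * (V (x n) - V (x 0))"
    using sum_lessThan_telescope[of "\<lambda>i. V (x i)" n] by (simp add: sum_distrib_left[symmetric])
  finally show ?thesis .
qed

text \<open>\<open>V\<close> plays the role of the accumulated variation: one monotone function
  dominates the increments of all paths in play, so that errors of different integrals can be added.
  It may jump, hence continuity is carried by the paths and not deduced from
  \<open>V\<close>.\<close>

locale control =
  fixes V :: "real \<Rightarrow> real" and T :: real
  assumes T_nonneg: "0 \<le> T"
    and V_mono: "mono_on {0..T} V"
begin

lemma V_le: "0 \<le> c \<Longrightarrow> c \<le> c' \<Longrightarrow> c' \<le> T \<Longrightarrow> V c \<le> V c'"
  using V_mono by (auto simp: mono_on_def)

text \<open>\<open>negl \<Phi>\<close> says \<open>\<Phi> = o(dV)\<close>, so \<open>dint J f g\<close> below reads \<open>dJ = f dg\<close>; increments that agree up to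
  \<open>o(dV)\<close> have equal sums, which gives a calculus of Riemann--Stieltjes integrals without partitions.\<close>

definition negl :: "(real \<Rightarrow> real \<Rightarrow> 'a::real_normed_vector) \<Rightarrow> bool" where
  "negl \<Phi> \<longleftrightarrow> (\<forall>e>0. \<exists>d>0. \<forall>c c'. 0 \<le> c \<and> c \<le> c' \<and> c' \<le> T \<and> c' - c < d \<longrightarrow>
     norm (\<Phi> c c') \<le> e * (V c' - V c))"

lemma neglD:
  assumes "negl \<Phi>" "e > 0"
  obtains d where "d > 0"
    "\<And>c c'. 0 \<le> c \<Longrightarrow> c \<le> c' \<Longrightarrow> c' \<le> T \<Longrightarrow> c' - c < d \<Longrightarrow> norm (\<Phi> c c') \<le> e * (V c' - V c)"
proof -
  from assms obtain d where "d > 0" "\<forall>c c'. 0 \<le> c \<and> c \<le> c' \<and> c' \<le> T \<and> c' - c < d \<longrightarrow>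
     norm (\<Phi> c c') \<le> e * (V c' - V c)"
    unfolding negl_def by auto
  then show thesis by (intro that[of d]) auto
qed

lemma neglI:
  assumes "\<And>e. e > 0 \<Longrightarrow> \<exists>d>0. \<forall>c c'. 0 \<le> c \<and> c \<le> c' \<and> c' \<le> T \<and> c' - c < d \<longrightarrow>
     norm (\<Phi> c c') \<le> e * (V c' - V c)"
  shows "negl \<Phi>"
  using assms unfolding negl_def by blast

lemma negl_bounded_by:
  assumes "negl \<Phi>" "\<And>c c'. 0 \<le> c \<Longrightarrow> c \<le> c' \<Longrightarrow> c' \<le> T \<Longrightarrow> norm (\<Psi> c c') \<le> K * norm (\<Phi> c c')"
  shows "negl \<Psi>"
proof (rule neglI)
  fix e :: real assume "e > 0"
  define e' where "e' = e / (\<bar>K\<bar> + 1)"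
  have "e' > 0" using \<open>e > 0\<close> by (auto simp: e'_def)
  obtain d where d: "d > 0"
    "\<And>c c'. 0 \<le> c \<Longrightarrow> c \<le> c' \<Longrightarrow> c' \<le> T \<Longrightarrow> c' - c < d \<Longrightarrow> norm (\<Phi> c c') \<le> e' * (V c' - V c)"
    using neglD[OF assms(1) \<open>e' > 0\<close>] by blast
  have "norm (\<Psi> c c') \<le> e * (V c' - V c)" if "0 \<le> c" "c \<le> c'" "c' \<le> T" "c' - c < d" for c c'
  proof -
    have "norm (\<Psi> c c') \<le> K * norm (\<Phi> c c')" using assms(2) that by blast
    also have "\<dots> \<le> (\<bar>K\<bar> + 1) * (e' * (V c' - V c))"
      using d(2)[of c c'] that by (intro mult_mono) auto
    also have "\<dots> = e * (V c' - V c)" by (simp add: e'_def)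
    finally show ?thesis .
  qed
  then show "\<exists>d>0. \<forall>c c'. 0 \<le> c \<and> c \<le> c' \<and> c' \<le> T \<and> c' - c < d \<longrightarrow> norm (\<Psi> c c') \<le> e * (V c' - V c)"
    using d(1) by blast
qed

lemma negl_cong:
  assumes "negl \<Phi>" "\<And>c c'. 0 \<le> c \<Longrightarrow> c \<le> c' \<Longrightarrow> c' \<le> T \<Longrightarrow> \<Psi> c c' = \<Phi> c c'"
  shows "negl \<Psi>"
  by (rule negl_bounded_by[OF assms(1), of _ 1]) (use assms(2) in auto)

lemma negl_0: "negl (\<lambda>c c'. 0)"
  by (rule neglI) (auto intro!: exI[of _ 1] mult_nonneg_nonneg V_le)

lemma negl_add:
  assumes "negl \<Phi>" "negl \<Psi>"
  shows "negl (\<lambda>c c'. \<Phi> c c' + \<Psi> c c')"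
proof (rule neglI)
  fix e :: real assume "e > 0"
  then have "e / 2 > 0" by simp
  obtain d where d: "d > 0"
    "\<And>c c'. 0 \<le> c \<Longrightarrow> c \<le> c' \<Longrightarrow> c' \<le> T \<Longrightarrow> c' - c < d \<Longrightarrow> norm (\<Phi> c c') \<le> e / 2 * (V c' - V c)"
    using neglD[OF assms(1) \<open>e / 2 > 0\<close>] by blast
  obtain d' where d': "d' > 0"
    "\<And>c c'. 0 \<le> c \<Longrightarrow> c \<le> c' \<Longrightarrow> c' \<le> T \<Longrightarrow> c' - c < d' \<Longrightarrow> norm (\<Psi> c c') \<le> e / 2 * (V c' - V c)"
    using neglD[OF assms(2) \<open>e / 2 > 0\<close>] by blast
  have "norm (\<Phi> c c' + \<Psi> c c') \<le> e * (V c' - V c)"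
    if "0 \<le> c" "c \<le> c'" "c' \<le> T" "c' - c < min d d'" for c c'
    using d(2)[of c c'] d'(2)[of c c'] that norm_triangle_ineq[of "\<Phi> c c'" "\<Psi> c c'"] by (simp add: algebra_simps)
  then show "\<exists>d>0. \<forall>c c'. 0 \<le> c \<and> c \<le> c' \<and> c' \<le> T \<and> c' - c < d \<longrightarrow> norm (\<Phi> c c' + \<Psi> c c') \<le> e * (V c' - V c)"
    using d(1) d'(1) by (intro exI[of _ "min d d'"]) auto
qed

lemma negl_minus: "negl \<Phi> \<Longrightarrow> negl (\<lambda>c c'. - \<Phi> c c')"
  by (erule negl_bounded_by[where K = 1]) auto

lemma negl_diff: "negl \<Phi> \<Longrightarrow> negl \<Psi> \<Longrightarrow> negl (\<lambda>c c'. \<Phi> c c' - \<Psi> c c')"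
  using negl_add[of \<Phi> "\<lambda>c c'. - \<Psi> c c'"] negl_minus[of \<Psi>] by simp

lemma negl_sum:
  assumes "\<And>i. i \<in> I \<Longrightarrow> negl (\<Phi> i)"
  shows "negl (\<lambda>c c'. \<Sum>i\<in>I. \<Phi> i c c')"
  using assms by (induction I rule: infinite_finite_induct) (auto intro: negl_0 negl_add)

lemma negl_mult:
  fixes \<Phi> :: "real \<Rightarrow> real \<Rightarrow> 'a::real_normed_algebra"
  assumes "negl \<Phi>" "\<And>c. 0 \<le> c \<Longrightarrow> c \<le> T \<Longrightarrow> norm (h c) \<le> K"
  shows "negl (\<lambda>c c'. h c * \<Phi> c c')"
  by (rule negl_bounded_by[OF assms(1), of _ K])
     (auto intro!: order_trans[OF norm_mult_ineq] mult_right_mono assms(2))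

lemma negl_mult_continuous:
  fixes \<Phi> :: "real \<Rightarrow> real \<Rightarrow> 'a::real_normed_algebra"
  assumes "negl \<Phi>" "continuous_on {0..T} h"
  shows "negl (\<lambda>c c'. h c * \<Phi> c c')"
proof -
  have "bounded (h ` {0..T})"
    using assms(2) by (intro compact_imp_bounded compact_continuous_image) auto
  then obtain K where "\<And>c. c \<in> {0..T} \<Longrightarrow> norm (h c) \<le> K"
    unfolding bounded_iff by blast
  then show ?thesis by (intro negl_mult[OF assms(1), of h K]) auto
qed

lemma negl_cmult:
  fixes \<Phi> :: "real \<Rightarrow> real \<Rightarrow> 'a::real_normed_algebra"
  assumes "negl \<Phi>"
  shows "negl (\<lambda>c c'. k * \<Phi> c c')"
  by (rule negl_mult_continuous[OF assms]) auto

section \<open>From local to global increments\<close>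

text \<open>Both sides telescope, so an estimate on short intervals extends to any interval through
  an equidistant subdivision into steps shorter than \<open>d\<close>.\<close>

lemma local_increment_bound:
  fixes J :: "real \<Rightarrow> 'a::real_normed_vector" and H :: "real \<Rightarrow> real"
  assumes "d > 0" and loc: "\<And>c c'. a \<le> c \<Longrightarrow> c \<le> c' \<Longrightarrow> c' \<le> b \<Longrightarrow> c' - c < d \<Longrightarrow> norm (J c' - J c) \<le> H c' - H c"
    and "a \<le> b"
  shows "norm (J b - J a) \<le> H b - H a"
proof -
  obtain n :: nat where n: "(b - a) / d < real n" using reals_Archimedean2 by blast
  have n0: "real n > 0"
    using n assms by (meson divide_nonneg_pos diff_ge_0_iff_ge le_less_trans)
  define x where "x i = a + (b - a) * real i / real n" for i
  have "norm (J (x (Suc i)) - J (x i)) \<le> 1 * (H (x (Suc i)) - H (x i))" if "i < n" for i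
  proof -
    have d1: "x (Suc i) - x i = (b - a) / real n"
      by (simp add: x_def add_divide_distrib[symmetric] diff_divide_distrib[symmetric] algebra_simps)
    have "(b - a) / real n < d" using n n0 assms(1) by (simp add: field_simps)
    moreover have "a \<le> x i" unfolding x_def using assms(3) n0 by simp
    moreover have "x (Suc i) \<le> b"
    proof -
      have "(b - a) * real (Suc i) / real n \<le> (b - a) * 1"
        unfolding times_divide_eq_right[symmetric] using that n0 assms(3) by (intro mult_left_mono) auto
      then show ?thesis by (simp add: x_def)
    qed
    moreover have "x i \<le> x (Suc i)" using d1 assms(3) n0 by (smt (verit) divide_nonneg_pos)
    ultimately show ?thesis using loc[of "x i" "x (Suc i)"] d1 by simp
  qed
  then have "norm (\<Sum>i<n. J (x (Suc i)) - J (x i)) \<le> 1 * (H (x n) - H (x 0))"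
    by (rule sum_increments_le)
  moreover have "x n = b" "x 0 = a" using n0 by (auto simp: x_def)
  ultimately show ?thesis using sum_lessThan_telescope[of "\<lambda>i. J (x i)" n] by simp
qed

text \<open>The \<open>o(dV)\<close> part sums to at most \<open>e' * (V b - V a)\<close> for every
  \<open>e' > 0\<close> and disappears in the total. What is left is the bound by \<open>H\<close>,
  which serves as a primitive of the estimate for the main term.\<close>

lemma negl_increment_bound:
  fixes J :: "real \<Rightarrow> 'a::real_normed_vector" and H :: "real \<Rightarrow> real"
  assumes "negl \<Phi>" 
    and "\<And>c c'. 0 \<le> c \<Longrightarrow> c \<le> c' \<Longrightarrow> c' \<le> T \<Longrightarrow> norm (J c' - J c - \<Phi> c c') \<le> H c' - H c"
    and "0 \<le> a" "a \<le> b" "b \<le> T"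
  shows "norm (J b - J a) \<le> H b - H a"
proof (rule field_le_epsilon)
  fix e :: real assume "e > 0"
  \<comment> \<open>The added 1 keeps the quotient meaningful when \<open>V\<close> takes the same
    value at both ends.\<close>
  define e' where "e' = e / (V b - V a + 1)"
  have Vab: "V b - V a \<ge> 0" using V_le assms by auto
  then have "e' > 0" using \<open>e > 0\<close> by (auto simp: e'_def)
  obtain d where d: "d > 0"
    "\<And>c c'. 0 \<le> c \<Longrightarrow> c \<le> c' \<Longrightarrow> c' \<le> T \<Longrightarrow> c' - c < d \<Longrightarrow> norm (\<Phi> c c') \<le> e' * (V c' - V c)"
    using neglD[OF assms(1) \<open>e' > 0\<close>] by blast
  have "norm (J b - J a) \<le> (H b + e' * V b) - (H a + e' * V a)"
  proof (rule local_increment_bound[where d = d])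
    fix c c' assume c: "a \<le> c" "c \<le> c'" "c' \<le> b" "c' - c < d"
    have "norm (J c' - J c) \<le> norm (J c' - J c - \<Phi> c c') + norm (\<Phi> c c')"
      by (metis add.commute diff_add_cancel norm_triangle_ineq)
    also have "\<dots> \<le> (H c' - H c) + e' * (V c' - V c)"
      using c assms by (intro add_mono d(2) assms(2)) auto
    finally show "norm (J c' - J c) \<le> H c' + e' * V c' - (H c + e' * V c)" by (simp add: algebra_simps)
  qed (use d assms in auto)
  also have "\<dots> = H b - H a + e' * (V b - V a)" by (simp add: algebra_simps)
  also have "e' * (V b - V a) \<le> e"
    using Vab \<open>e > 0\<close> by (simp add: e'_def field_simps)
  finally show "norm (J b - J a) \<le> H b - H a + e" by simp
qed

text \<open>The counterpart of a vanishing derivative: it yields uniqueness of integrals in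
  \<open>dint_unique\<close> and the conservation law in \<open>row_norm\<close>.\<close>

lemma negl_increments_imp_const:
  assumes "negl (\<lambda>c c'. J c' - J c)" "0 \<le> t" "t \<le> T"
  shows "J t = J 0"
  using negl_increment_bound[OF assms(1), of J "\<lambda>_. 0" 0 t] assms by simp

section \<open>Paths that are Lipschitz along the control\<close>

text \<open>Continuity is a separate clause because \<open>V\<close> may jump, in which case the
  Lipschitz bound does not imply it.\<close>

definition vlip :: "(real \<Rightarrow> 'a::real_normed_vector) \<Rightarrow> bool" where
  "vlip g \<longleftrightarrow> continuous_on {0..T} g \<and>
     (\<exists>k\<ge>0. \<forall>c c'. 0 \<le> c \<and> c \<le> c' \<and> c' \<le> T \<longrightarrow> norm (g c' - g c) \<le> k * (V c' - V c))"

lemma vlipI: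
  assumes "continuous_on {0..T} g"
    "\<And>c c'. 0 \<le> c \<Longrightarrow> c \<le> c' \<Longrightarrow> c' \<le> T \<Longrightarrow> norm (g c' - g c) \<le> k * (V c' - V c)"
  shows "vlip g"
  unfolding vlip_def
proof (intro conjI exI[of _ "\<bar>k\<bar>"] allI impI)
  fix c c' assume "0 \<le> c \<and> c \<le> c' \<and> c' \<le> T"
  then show "norm (g c' - g c) \<le> \<bar>k\<bar> * (V c' - V c)"
    using assms(2)[of c c'] V_le[of c c'] mult_right_mono[OF abs_ge_self[of k], of "V c' - V c"] by auto
qed (use assms in auto)

lemma vlipE:
  assumes "vlip g"
  obtains k where "k \<ge> 0"
    "\<And>c c'. 0 \<le> c \<Longrightarrow> c \<le> c' \<Longrightarrow> c' \<le> T \<Longrightarrow> norm (g c' - g c) \<le> k * (V c' - V c)"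
proof -
  from assms obtain k where "k \<ge> 0" "\<forall>c c'. 0 \<le> c \<and> c \<le> c' \<and> c' \<le> T \<longrightarrow> norm (g c' - g c) \<le> k * (V c' - V c)"
    unfolding vlip_def by auto
  then show thesis by (intro that[of k]) auto
qed

lemma vlip_continuous: "vlip g \<Longrightarrow> continuous_on {0..T} g"
  by (simp add: vlip_def)

lemma vlip_const: "vlip (\<lambda>_. k)"
  by (rule vlipI[where k = 0]) auto

lemma vlip_bounded_linear:
  assumes "vlip g" "bounded_linear h"
  shows "vlip (\<lambda>t. h (g t))"
proof -
  obtain k where k: "k \<ge> 0"
    "\<And>c c'. 0 \<le> c \<Longrightarrow> c \<le> c' \<Longrightarrow> c' \<le> T \<Longrightarrow> norm (g c' - g c) \<le> k * (V c' - V c)"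
    using vlipE[OF assms(1)] by blast
  obtain K where K: "K > 0" "\<And>x. norm (h x) \<le> norm x * K"
    using bounded_linear.pos_bounded[OF assms(2)] by blast
  show ?thesis
  proof (rule vlipI[where k = "k * K"])
    show "continuous_on {0..T} (\<lambda>t. h (g t))"
      by (rule bounded_linear.continuous_on[OF assms(2) vlip_continuous[OF assms(1)]])
    fix c c' assume c: "0 \<le> c" "c \<le> c'" "c' \<le> T"
    have "norm (h (g c') - h (g c)) = norm (h (g c' - g c))"
      by (simp add: linear_diff[OF bounded_linear.linear[OF assms(2)]])
    also have "\<dots> \<le> norm (g c' - g c) * K" by (rule K(2))
    also have "\<dots> \<le> k * (V c' - V c) * K" using k(2)[OF c] K(1) by (intro mult_right_mono) auto
    finally show "norm (h (g c') - h (g c)) \<le> k * K * (V c' - V c)" by (simp add: algebra_simps)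
  qed
qed

lemma vlip_add:
  assumes "vlip f" "vlip g"
  shows "vlip (\<lambda>t. f t + g t)"
proof -
  obtain k where k: "k \<ge> 0"
    "\<And>c c'. 0 \<le> c \<Longrightarrow> c \<le> c' \<Longrightarrow> c' \<le> T \<Longrightarrow> norm (f c' - f c) \<le> k * (V c' - V c)"
    using vlipE[OF assms(1)] by blast
  obtain k' where k': "k' \<ge> 0"
    "\<And>c c'. 0 \<le> c \<Longrightarrow> c \<le> c' \<Longrightarrow> c' \<le> T \<Longrightarrow> norm (g c' - g c) \<le> k' * (V c' - V c)"
    using vlipE[OF assms(2)] by blast
  show ?thesis
  proof (rule vlipI[where k = "k + k'"])
    fix c c' assume c: "0 \<le> c" "c \<le> c'" "c' \<le> T"
    have "norm (f c' + g c' - (f c + g c)) \<le> norm (f c' - f c) + norm (g c' - g c)"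
      by (metis add_diff_add norm_triangle_ineq)
    then show "norm (f c' + g c' - (f c + g c)) \<le> (k + k') * (V c' - V c)"
      using k(2)[OF c] k'(2)[OF c] by (simp add: algebra_simps)
  qed (intro continuous_intros vlip_continuous assms)
qed

lemma vlip_sum: "(\<And>i. i \<in> I \<Longrightarrow> vlip (f i)) \<Longrightarrow> vlip (\<lambda>t. \<Sum>i\<in>I. f i t)"
  by (induction I rule: infinite_finite_induct) (auto intro: vlip_const vlip_add)

lemma vlip_cmult: "vlip f \<Longrightarrow> vlip (\<lambda>t. k * f t :: 'a::real_normed_algebra)"
  by (erule vlip_bounded_linear[OF _ bounded_linear_mult_right])

lemma uniformly_small_increments:
  assumes "continuous_on {0..T} f" "e > 0"
  obtains d where "d > 0"
    "\<And>s t. 0 \<le> s \<Longrightarrow> s \<le> T \<Longrightarrow> 0 \<le> t \<Longrightarrow> t \<le> T \<Longrightarrow> \<bar>t - s\<bar> < d \<Longrightarrow> norm (f t - f s) < e"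
proof -
  have "uniformly_continuous_on {0..T} f"
    using assms(1) by (intro compact_uniformly_continuous) auto
  then obtain d where d: "d > 0" "\<forall>x\<in>{0..T}. \<forall>x'\<in>{0..T}. dist x' x < d \<longrightarrow> dist (f x') (f x) < e"
    unfolding uniformly_continuous_on_def using assms(2) by blast
  show thesis
    using d by (intro that[of d]) (auto simp: dist_norm)
qed

text \<open>One increment is \<open>O(dV)\<close> and the other is uniformly small on short
  intervals, so the product is \<open>o(dV)\<close>: there is no quadratic covariation.\<close>

lemma negl_small_mult:
  fixes f g :: "real \<Rightarrow> 'a::real_normed_algebra"
  assumes "continuous_on {0..T} f" "vlip g"
  shows "negl (\<lambda>c c'. (f c' - f c) * (g c' - g c))"
proof (rule neglI)
  obtain k where k: "k \<ge> 0"
    "\<And>c c'. 0 \<le> c \<Longrightarrow> c \<le> c' \<Longrightarrow> c' \<le> T \<Longrightarrow> norm (g c' - g c) \<le> k * (V c' - V c)"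
    using vlipE[OF assms(2)] by blast
  fix e :: real assume "e > 0"
  then have "e / (k + 1) > 0" using k by auto
  then obtain d where d: "d > 0"
    "\<And>s t. 0 \<le> s \<Longrightarrow> s \<le> T \<Longrightarrow> 0 \<le> t \<Longrightarrow> t \<le> T \<Longrightarrow> \<bar>t - s\<bar> < d \<Longrightarrow> norm (f t - f s) < e / (k + 1)"
    using uniformly_small_increments[OF assms(1)] by blast
  have "norm ((f c' - f c) * (g c' - g c)) \<le> e * (V c' - V c)"
    if c: "0 \<le> c" "c \<le> c'" "c' \<le> T" "c' - c < d" for c c'
  proof -
    have "norm ((f c' - f c) * (g c' - g c)) \<le> norm (f c' - f c) * norm (g c' - g c)"
      by (rule norm_mult_ineq)
    also have "\<dots> \<le> e / (k + 1) * (k * (V c' - V c))"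
      using d(2)[of c c'] k c \<open>e > 0\<close> by (intro mult_mono) (auto intro: less_imp_le)
    also have "\<dots> \<le> e / (k + 1) * ((k + 1) * (V c' - V c))"
      using k(1) \<open>e > 0\<close> V_le[of c c'] c by (intro mult_left_mono mult_right_mono) auto
    finally show ?thesis using k(1) by simp
  qed
  then show "\<exists>d>0. \<forall>c c'. 0 \<le> c \<and> c \<le> c' \<and> c' \<le> T \<and> c' - c < d \<longrightarrow>
      norm ((f c' - f c) * (g c' - g c)) \<le> e * (V c' - V c)"
    using d(1) by blast
qed

section \<open>Calculus of Stieltjes differentials\<close>

definition dint :: "(real \<Rightarrow> 'a::real_normed_algebra) \<Rightarrow> (real \<Rightarrow> 'a) \<Rightarrow> (real \<Rightarrow> 'a) \<Rightarrow> bool" where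
  "dint J f g \<longleftrightarrow> negl (\<lambda>c c'. J c' - J c - f c * (g c' - g c))"

lemma dint_unique:
  assumes "dint J f g" "dint J' f g" "J 0 = J' 0" "0 \<le> t" "t \<le> T"
  shows "J t = J' t"
proof -
  have "negl (\<lambda>c c'. (J c' - J' c') - (J c - J' c))"
    using negl_diff[OF assms(1,2)[unfolded dint_def]] by (rule negl_cong) simp
  then show ?thesis using negl_increments_imp_const[of "\<lambda>c. J c - J' c" t] assms by simp
qed

lemma dint_cong:
  assumes "dint J f g" "\<And>t. 0 \<le> t \<Longrightarrow> t \<le> T \<Longrightarrow> J' t = J t"  "\<And>t. 0 \<le> t \<Longrightarrow> t \<le> T \<Longrightarrow> f' t = f t"
    "\<And>t. 0 \<le> t \<Longrightarrow> t \<le> T \<Longrightarrow> g' t = g t + k"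
  shows "dint J' f' g'"
  using assms(1) unfolding dint_def by (rule negl_cong) (use assms in auto)

lemma dint_sum_left:
  assumes "\<And>i. i \<in> I \<Longrightarrow> dint (J i) (f i) g"
  shows "dint (\<lambda>t. \<Sum>i\<in>I. J i t) (\<lambda>t. \<Sum>i\<in>I. f i t) g"
proof -
  have "negl (\<lambda>c c'. \<Sum>i\<in>I. J i c' - J i c - f i c * (g c' - g c))"
    using assms unfolding dint_def by (rule negl_sum)
  then show ?thesis unfolding dint_def
    by (rule negl_cong) (simp add: sum_subtractf sum_distrib_right)
qed

lemma dint_cmult_left:
  fixes J :: "real \<Rightarrow> 'a::real_normed_algebra"
  assumes "dint J f g"
  shows "dint (\<lambda>t. k * J t) (\<lambda>t. k * f t) g"
  using negl_cmult[OF assms[unfolded dint_def], of k] unfolding dint_def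
  by (rule negl_cong) (simp add: algebra_simps)

lemma dint_sum_right:
  assumes "\<And>i. i \<in> I \<Longrightarrow> dint (J i) f (g i)"
  shows "dint (\<lambda>t. \<Sum>i\<in>I. J i t) f (\<lambda>t. \<Sum>i\<in>I. g i t)"
proof -
  have "negl (\<lambda>c c'. \<Sum>i\<in>I. J i c' - J i c - f c * (g i c' - g i c))"
    using assms unfolding dint_def by (rule negl_sum)
  then show ?thesis unfolding dint_def
    by (rule negl_cong) (simp add: sum_subtractf sum_distrib_left right_diff_distrib)
qed

lemma dint_cmult_right:
  fixes J :: "real \<Rightarrow> 'a::{real_normed_algebra, comm_ring}"
  assumes "dint J f g"
  shows "dint (\<lambda>t. k * J t) f (\<lambda>t. k * g t)"
  using negl_cmult[OF assms[unfolded dint_def], of k] unfolding dint_def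
  by (rule negl_cong) (simp add: algebra_simps)

lemma dint_of_real:
  assumes "dint J f g"
  shows "dint (\<lambda>t. of_real (J t) :: 'a::real_normed_field) (\<lambda>t. of_real (f t)) (\<lambda>t. of_real (g t))"
  using assms unfolding dint_def
  by (rule negl_bounded_by[where K = 1]) (simp flip: of_real_diff of_real_mult)

lemma dint_increment_bound:
  fixes J :: "real \<Rightarrow> 'a::real_normed_algebra"
  assumes "dint J f g"
    and g: "\<And>c c'. 0 \<le> c \<Longrightarrow> c \<le> c' \<Longrightarrow> c' \<le> T \<Longrightarrow> norm (g c' - g c) \<le> k * (V c' - V c)"
    and f: "\<And>c. 0 \<le> c \<Longrightarrow> c \<le> T \<Longrightarrow> norm (f c) \<le> M"
    and "0 \<le> a" "a \<le> b" "b \<le> T"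
  shows "norm (J b - J a) \<le> M * k * (V b - V a)"
proof -
  have "norm (J b - J a) \<le> M * k * V b - M * k * V a"
  proof (rule negl_increment_bound[OF assms(1)[unfolded dint_def]])
    fix c c' assume c: "0 \<le> c" "c \<le> c'" "c' \<le> T"
    have "norm (f c * (g c' - g c)) \<le> norm (f c) * norm (g c' - g c)" by (rule norm_mult_ineq)
    also have "\<dots> \<le> M * (k * (V c' - V c))"
      using f[of c] g[of c c'] c order_trans[OF norm_ge_zero f[of c]] by (intro mult_mono) simp_all
    finally show "norm (J c' - J c - (J c' - J c - f c * (g c' - g c))) \<le> M * k * V c' - M * k * V c"
      by (simp add: algebra_simps)
  qed (use assms in auto)
  then show ?thesis by (simp add: algebra_simps)
qed

text \<open>An increment of \<open>J\<close> splits into the defect, small relative to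
  \<open>V\<close>, and a bounded multiple of an increment of \<open>g\<close>. As \<open>V\<close>
  may jump, the first part is made small by its factor and the second by the continuity of
  \<open>g\<close>.\<close>

lemma dint_continuous:
  fixes J :: "real \<Rightarrow> 'a::real_normed_algebra"
  assumes "dint J f g" "continuous_on {0..T} f" "continuous_on {0..T} g"
  shows "continuous_on {0..T} J"
  unfolding continuous_on_iff
proof (intro ballI allI impI)
  fix x e :: real assume x: "x \<in> {0..T}" and "e > 0"
  have "bounded (f ` {0..T})"
    using assms(2) by (intro compact_imp_bounded compact_continuous_image) auto
  then obtain K where K: "K > 0" "\<And>c. c \<in> {0..T} \<Longrightarrow> norm (f c) \<le> K"
    unfolding bounded_pos by auto
  define W where "W = V T - V 0 + 1"
  have W: "W > 0" using V_le[of 0 T] T_nonneg by (simp add: W_def)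
  have "e / (2 * W) > 0" using W \<open>e > 0\<close> by simp
  then obtain d1 where d1: "d1 > 0"
    "\<And>c c'. 0 \<le> c \<Longrightarrow> c \<le> c' \<Longrightarrow> c' \<le> T \<Longrightarrow> c' - c < d1 \<Longrightarrow>
        norm (J c' - J c - f c * (g c' - g c)) \<le> e / (2 * W) * (V c' - V c)"
    using neglD[OF assms(1)[unfolded dint_def]] by blast
  have "e / (2 * K) > 0" using K \<open>e > 0\<close> by simp
  then obtain d2 where d2: "d2 > 0"
    "\<And>s t. 0 \<le> s \<Longrightarrow> s \<le> T \<Longrightarrow> 0 \<le> t \<Longrightarrow> t \<le> T \<Longrightarrow> \<bar>t - s\<bar> < d2 \<Longrightarrow> norm (g t - g s) < e / (2 * K)"
    using uniformly_small_increments[OF assms(3)] by metis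
  have *: "norm (J c' - J c) < e" if c: "0 \<le> c" "c \<le> c'" "c' \<le> T" "c' - c < min d1 d2" for c c'
  proof -
    have "norm (J c' - J c) \<le> norm (J c' - J c - f c * (g c' - g c)) + norm (f c * (g c' - g c))"
      by (metis add.commute diff_add_cancel norm_triangle_ineq)
    also have "\<dots> \<le> e / (2 * W) * (V c' - V c) + K * norm (g c' - g c)"
      using c K by (intro add_mono d1(2) order_trans[OF norm_mult_ineq] mult_right_mono) auto
    also have "\<dots> < e / (2 * W) * W + K * (e / (2 * K))"
    proof (rule add_le_less_mono)
      have "V c' - V c \<le> W" using V_le[of 0 c] V_le[of c' T] c by (simp add: W_def)
      then show "e / (2 * W) * (V c' - V c) \<le> e / (2 * W) * W"
        using \<open>e / (2 * W) > 0\<close> by (intro mult_left_mono) auto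
      show "K * norm (g c' - g c) < K * (e / (2 * K))"
        using d2(2)[of c c'] c K(1) by (intro mult_strict_left_mono) auto
    qed
    also have "\<dots> = e" using W K by simp
    finally show ?thesis .
  qed
  have "dist (J x') (J x) < e" if "x' \<in> {0..T}" "dist x' x < min d1 d2" for x'
  proof (cases "x \<le> x'")
    case True
    then show ?thesis using *[of x x'] that x by (auto simp: dist_norm)
  next
    case False
    then show ?thesis using *[of x' x] that x by (auto simp: dist_norm norm_minus_commute)
  qed
  then show "\<exists>d>0. \<forall>x'\<in>{0..T}. dist x' x < d \<longrightarrow> dist (J x') (J x) < e"
    using d1(1) d2(1) by (intro exI[of _ "min d1 d2"]) auto
qed

lemma dint_vlip:
  fixes J :: "real \<Rightarrow> 'a::real_normed_algebra"
  assumes "dint J f g" "continuous_on {0..T} f" "vlip g"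
  shows "vlip J"
proof -
  obtain k where k: "k \<ge> 0"
    "\<And>c c'. 0 \<le> c \<Longrightarrow> c \<le> c' \<Longrightarrow> c' \<le> T \<Longrightarrow> norm (g c' - g c) \<le> k * (V c' - V c)"
    using vlipE[OF assms(3)] by blast
  have "bounded (f ` {0..T})"
    using assms(2) by (intro compact_imp_bounded compact_continuous_image) auto
  then obtain M where M: "\<And>c. c \<in> {0..T} \<Longrightarrow> norm (f c) \<le> M"
    unfolding bounded_iff by blast
  show ?thesis
  proof (rule vlipI[where k = "M * k"])
    show "continuous_on {0..T} J"
      by (rule dint_continuous[OF assms(1,2) vlip_continuous[OF assms(3)]])
    fix c c' assume c: "0 \<le> c" "c \<le> c'" "c' \<le> T"
    show "norm (J c' - J c) \<le> M * k * (V c' - V c)"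
      by (rule dint_increment_bound[OF assms(1) k(2) _ c]) (auto intro: M)
  qed
qed

end

section \<open>Existence of the integral and its identification with limits over tagged
  divisions\<close>

context control
begin

text \<open>The double difference of the stopped integrator is its increment over the part of the
  \<open>i\<close>-th cell inside \<open>[c, c']\<close>. Cells that do not meet this interval
  contribute 0, which is why smallness of \<open>a i\<close> is asked only for the others.\<close>

lemma step_sum_bound:
  fixes g :: "real \<Rightarrow> 'a::real_normed_algebra" and x :: "nat \<Rightarrow> real"
  assumes g: "\<And>c c'. 0 \<le> c \<Longrightarrow> c \<le> c' \<Longrightarrow> c' \<le> T \<Longrightarrow> norm (g c' - g c) \<le> k * (V c' - V c)"
    and x: "\<And>i. i < n \<Longrightarrow> x i \<le> x (Suc i)" "\<And>i. i \<le> n \<Longrightarrow> 0 \<le> x i \<and> x i \<le> T" "x 0 = 0" "x n = T"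
    and k: "0 \<le> k" and e: "0 \<le> e"
    and c: "0 \<le> c" "c \<le> c'" "c' \<le> T"
    and a: "\<And>i. i < n \<Longrightarrow> c \<le> x (Suc i) \<Longrightarrow> x i \<le> c' \<Longrightarrow> norm (a i) \<le> e"
  shows "norm (\<Sum>i<n. a i * ((g (min c' (x (Suc i))) - g (min c' (x i))) - (g (min c (x (Suc i))) - g (min c (x i)))))
          \<le> e * k * (V c' - V c)"
proof -
  \<comment> \<open>Clamping to \<open>[c, c']\<close> turns the difference of two stopped values
    into an ordinary increment of \<open>g\<close>.\<close>
  define cl where "cl t = max c (min c' t)" for t
  have cl: "c \<le> cl t" "cl t \<le> c'" for t using c by (auto simp: cl_def)
  have *: "g (min c' t) - g (min c t) = g (cl t) - g c" for t
    using c by (auto simp: cl_def min_def max_def)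
  have "norm (a i * ((g (min c' (x (Suc i))) - g (min c' (x i))) - (g (min c (x (Suc i))) - g (min c (x i)))))
         \<le> e * k * (V (cl (x (Suc i))) - V (cl (x i)))" if i: "i < n" for i
  proof -
    have "(g (min c' (x (Suc i))) - g (min c' (x i))) - (g (min c (x (Suc i))) - g (min c (x i)))
       = (g (min c' (x (Suc i))) - g (min c (x (Suc i)))) - (g (min c' (x i)) - g (min c (x i)))" by simp
    also have "\<dots> = g (cl (x (Suc i))) - g (cl (x i))" by (simp add: *)
    finally have eq: "(g (min c' (x (Suc i))) - g (min c' (x i))) - (g (min c (x (Suc i))) - g (min c (x i)))
       = g (cl (x (Suc i))) - g (cl (x i))" .
    have cle: "0 \<le> cl (x i)" "cl (x i) \<le> cl (x (Suc i))" "cl (x (Suc i)) \<le> T"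
      using cl[of "x i"] cl[of "x (Suc i)"] x(1)[OF i] c by (auto simp: cl_def)
    have gb: "norm (g (cl (x (Suc i))) - g (cl (x i))) \<le> k * (V (cl (x (Suc i))) - V (cl (x i)))"
      by (rule g) (use cle in auto)
    consider "x (Suc i) < c" | "c' < x i" | "c \<le> x (Suc i)" "x i \<le> c'" by linarith
    then show ?thesis
    proof cases
      case 1
      then have "cl (x (Suc i)) = c" "cl (x i) = c" using x(1)[OF i] c by (auto simp: cl_def)
      then show ?thesis unfolding eq by simp
    next
      case 2
      then have "cl (x (Suc i)) = c'" "cl (x i) = c'" using x(1)[OF i] c by (auto simp: cl_def)
      then show ?thesis unfolding eq by simp
    next
      case 3
      have "norm (a i * (g (cl (x (Suc i))) - g (cl (x i)))) \<le> norm (a i) * norm (g (cl (x (Suc i))) - g (cl (x i)))"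
        by (rule norm_mult_ineq)
      also have "\<dots> \<le> e * (k * (V (cl (x (Suc i))) - V (cl (x i))))"
        by (rule mult_mono[OF a[OF i 3] gb e norm_ge_zero])
      finally show ?thesis unfolding eq by (simp add: mult.assoc)
    qed
  qed
  then have "norm (\<Sum>i<n. a i * ((g (min c' (x (Suc i))) - g (min c' (x i))) - (g (min c (x (Suc i))) - g (min c (x i)))))
      \<le> e * k * (V (cl (x n)) - V (cl (x 0)))"
    by (rule sum_increments_le[where x = "\<lambda>i. cl (x i)"])
  also have "cl (x n) = c'" using c x by (simp add: cl_def)
  also have "cl (x 0) = c" using c x by (simp add: cl_def)
  finally show ?thesis .
qed

text \<open>Left-point sums along dyadic partitions are Cauchy by the uniform continuity of
  \<open>f\<close>, and completeness supplies the limit.\<close>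

lemma dint_exists:
  fixes f g :: "real \<Rightarrow> 'a::{real_normed_algebra, banach}"
  assumes f: "continuous_on {0..T} f" and "vlip g"
  obtains J where "J 0 = 0" "dint J f g"
proof -
  obtain k where k: "k \<ge> 0"
    and g: "\<And>c c'. 0 \<le> c \<Longrightarrow> c \<le> c' \<Longrightarrow> c' \<le> T \<Longrightarrow> norm (g c' - g c) \<le> k * (V c' - V c)"
    using vlipE[OF assms(2)] by blast
  define x where "x n i = T * real i / 2 ^ n" for n i :: nat
  have x0: "x n 0 = 0" and xn: "x n (2 ^ n) = T" for n by (simp_all add: x_def)
  have xmono: "x n i \<le> x n j" if "i \<le> j" for n i j
    using T_nonneg that by (auto simp: x_def intro!: divide_right_mono mult_left_mono)
  have xrange: "0 \<le> x n i \<and> x n i \<le> T" if "i \<le> 2 ^ n" for n i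
    using xmono[of 0 i n] xmono[OF that, of n] by (simp add: x0 xn)
  have xstep: "x n (Suc i) = x n i + T / 2 ^ n" for n i
    by (simp add: x_def field_simps)
  \<comment> \<open>Stopping the integrator at \<open>t\<close> lets one partition of
    \<open>[0, T]\<close> serve for all \<open>t\<close>, so that increments in \<open>t\<close> are
    again sums over the same cells.\<close>
  define S where "S n t = (\<Sum>i<2^n. f (x n i) * (g (min t (x n (Suc i))) - g (min t (x n i))))" for n t
  have S_inc: "S n c' - S n c = (\<Sum>i<2^n. f (x n i) *
      ((g (min c' (x n (Suc i))) - g (min c' (x n i))) - (g (min c (x n (Suc i))) - g (min c (x n i)))))" for n c c'
    by (simp add: S_def sum_subtractf right_diff_distrib)
  \<comment> \<open>The same sum written on a finer grid, with \<open>f\<close> frozen at the coarse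
    node to the left; \<open>i div 2^k\<close> is the index of that node.\<close>
  have refine: "S n t = (\<Sum>i<2^(n+k). f (x n (i div 2^k)) * (g (min t (x (n+k) (Suc i))) - g (min t (x (n+k) i))))" for n k t
  proof -
    have "(\<Sum>i<2^(n+k). f (x n (i div 2^k)) * (g (min t (x (n+k) (Suc i))) - g (min t (x (n+k) i))))
       = (\<Sum>i<2^n * 2^k. f (x n (i div 2^k)) * (g (min t (x (n+k) (Suc i))) - g (min t (x (n+k) i))))"
      by (simp add: power_add)
    also have "\<dots> = (\<Sum>j<2^n. \<Sum>i=j*2^k..<j*2^k+2^k. f (x n (i div 2^k)) * (g (min t (x (n+k) (Suc i))) - g (min t (x (n+k) i))))"
      by (rule sum.nat_group[symmetric])
    also have "\<dots> = (\<Sum>j<2^n. \<Sum>i=j*2^k..<j*2^k+2^k. f (x n j) * (g (min t (x (n+k) (Suc i))) - g (min t (x (n+k) i))))"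
    proof (intro sum.cong refl)
      fix j i :: nat assume "i \<in> {j * 2 ^ k..<j * 2 ^ k + 2 ^ k}"
      then have "i div 2 ^ k = j" by (intro div_nat_eqI) (auto simp: algebra_simps)
      then show "f (x n (i div 2^k)) * (g (min t (x (n+k) (Suc i))) - g (min t (x (n+k) i)))
        = f (x n j) * (g (min t (x (n+k) (Suc i))) - g (min t (x (n+k) i)))" by simp
    qed
    also have "\<dots> = (\<Sum>j<2^n. f (x n j) * (g (min t (x (n+k) (j*2^k+2^k))) - g (min t (x (n+k) (j*2^k)))))"
      using sum_Suc_diff'[of _ _ "\<lambda>i. g (min t (x (n+k) i))"]
      by (simp add: sum_distrib_left[symmetric])
    also have "\<dots> = S n t"
    proof -
      have "x (n+k) (j * 2^k) = x n j" for j by (simp add: x_def power_add)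
      moreover have "x (n+k) (j * 2^k + 2^k) = x n (Suc j)" for j
        by (simp add: x_def power_add field_simps)
      ultimately show ?thesis by (simp add: S_def)
    qed
    finally show ?thesis by simp
  qed
  have small: "\<exists>N. \<forall>n\<ge>N. T / 2 ^ n < d" if "d > 0" for d
  proof -
    have "(\<lambda>n. T * (1/2) ^ n) \<longlonglongrightarrow> T * 0" by (intro tendsto_intros) auto
    then have "\<forall>\<^sub>F n in sequentially. T * (1/2) ^ n < d" using that by (simp add: order_tendsto_iff)
    moreover have "T * (1/2) ^ n = T / 2 ^ n" for n by (simp add: power_one_over)
    ultimately show ?thesis unfolding eventually_sequentially by auto
  qed
  have cauchy: "Cauchy (\<lambda>n. S n t)" if t: "0 \<le> t" "t \<le> T" for t
  proof (rule metric_CauchyI)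
    fix e :: real assume "e > 0"
    define e' where "e' = e / (k * (V t - V 0) + 1)"
    have Vt: "V t - V 0 \<ge> 0" using V_le[of 0 t] t by simp
    then have "e' > 0" using \<open>e > 0\<close> k by (auto simp: e'_def intro!: divide_pos_pos add_nonneg_pos)
    have e'e: "e' * k * (V t - V 0) < e"
    proof -
      have "e' * (k * (V t - V 0)) < e' * (k * (V t - V 0) + 1)" using \<open>e' > 0\<close> by simp
      also have "\<dots> = e" using k Vt by (simp add: e'_def add_nonneg_eq_0_iff)
      finally show ?thesis by (simp add: mult.assoc)
    qed
    obtain d where d: "d > 0"
      "\<And>s t. 0 \<le> s \<Longrightarrow> s \<le> T \<Longrightarrow> 0 \<le> t \<Longrightarrow> t \<le> T \<Longrightarrow> \<bar>t - s\<bar> < d \<Longrightarrow> norm (f t - f s) < e'"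
      using uniformly_small_increments[OF f \<open>e' > 0\<close>] by metis
    obtain N where N: "\<And>n. n \<ge> N \<Longrightarrow> T / 2 ^ n < d" using small[OF d(1)] by blast
    have S0: "S n 0 = 0" for n
      using xmono[of 0 _ n] by (simp add: S_def x0 min_absorb1)
    have *: "dist (S n t) (S (n+m) t) < e" if "n \<ge> N" for n m
    proof -
      have "S (n+m) t - S n t = (\<Sum>i<2^(n+m). (f (x (n+m) i) - f (x n (i div 2^m))) *
        ((g (min t (x (n+m) (Suc i))) - g (min t (x (n+m) i))) - (g (min 0 (x (n+m) (Suc i))) - g (min 0 (x (n+m) i)))))"
        unfolding refine[of n t m] S_def[of "n+m" t] sum_subtractf[symmetric]
        using xmono[of 0 _ "n+m"] by (simp add: x0 min_absorb1 left_diff_distrib)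
      also have "norm \<dots> \<le> e' * k * (V t - V 0)"
      proof (rule step_sum_bound[OF g])
        fix i :: nat assume i: "i < 2 ^ (n + m)"
        define j where "j = i div 2 ^ m"
        have jn: "j < 2 ^ n" using i by (simp add: j_def less_mult_imp_div_less power_add)
        have j1: "j * 2 ^ m \<le> i" by (simp add: j_def)
        have j2: "i \<le> Suc j * 2 ^ m"
        proof -
          have "i = j * 2 ^ m + i mod 2 ^ m" unfolding j_def by (rule div_mult_mod_eq[symmetric])
          also have "i mod 2 ^ m \<le> 2 ^ m" by (intro less_imp_le mod_less_divisor) simp
          finally show ?thesis by simp
        qed
        have "x n j \<le> x (n+m) i"
          using xmono[OF j1, of "n+m"] by (simp add: x_def power_add)
        moreover have "x (n+m) i \<le> x n (Suc j)"
          using xmono[OF j2, of "n+m"] by (simp add: x_def power_add field_simps)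
        ultimately have "\<bar>x (n+m) i - x n j\<bar> < d"
          using N[OF that] xstep[of n j] by simp
        then show "norm (f (x (n+m) i) - f (x n (i div 2^m))) \<le> e'"
          using d(2)[of "x n j" "x (n+m) i"] xrange[of j n] xrange[of i "n+m"] jn i by (simp add: j_def)
      qed (use xmono xrange x0 xn k \<open>e' > 0\<close> t in auto)
      finally show ?thesis using e'e by (simp add: dist_norm norm_minus_commute)
    qed
    show "\<exists>M. \<forall>m\<ge>M. \<forall>n\<ge>M. dist (S m t) (S n t) < e"
    proof (intro exI allI impI)
      fix m n assume "m \<ge> N" "n \<ge> N"
      then show "dist (S m t) (S n t) < e"
        using *[of m "n - m"] *[of n "m - n"] by (cases "m \<le> n") (auto simp: dist_commute)
    qed
  qed
  define J where "J t = lim (\<lambda>n. S n t)" for t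
  have J: "(\<lambda>n. S n t) \<longlonglongrightarrow> J t" if "0 \<le> t" "t \<le> T" for t
    using cauchy[OF that] by (simp add: J_def Cauchy_convergent_iff convergent_LIMSEQ_iff)
  have "J 0 = 0"
  proof -
    have "S n 0 = 0" for n
      using xmono[of 0 _ n] by (simp add: S_def x0 min_absorb1)
    then show ?thesis using J[of 0] T_nonneg LIMSEQ_unique by (auto simp: tendsto_const_iff)
  qed
  moreover have "dint J f g"
    unfolding dint_def
  proof (rule neglI)
    fix e :: real assume "e > 0"
    then have "e / (k + 1) > 0" using k by auto
    then obtain d where d: "d > 0"
      "\<And>s t. 0 \<le> s \<Longrightarrow> s \<le> T \<Longrightarrow> 0 \<le> t \<Longrightarrow> t \<le> T \<Longrightarrow> \<bar>t - s\<bar> < d \<Longrightarrow> norm (f t - f s) < e / (k + 1)"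
      using uniformly_small_increments[OF f] by metis
    \<comment> \<open>Half of \<open>d\<close> is reserved for the mesh and half for
      \<open>c' - c\<close>: the left node of a cell meeting \<open>[c, c']\<close>, which may lie
      to the left of \<open>c\<close>, is then within \<open>d\<close> of \<open>c\<close>.\<close>
    obtain N where N: "\<And>n. n \<ge> N \<Longrightarrow> T / 2 ^ n < d / 2" using small[of "d / 2"] d(1) by auto
    have "norm (J c' - J c - f c * (g c' - g c)) \<le> e * (V c' - V c)"
      if c: "0 \<le> c" "c \<le> c'" "c' \<le> T" "c' - c < d / 2" for c c'
    proof (rule LIMSEQ_le_const2)
      show "(\<lambda>n. norm (S n c' - S n c - f c * (g c' - g c))) \<longlonglongrightarrow> norm (J c' - J c - f c * (g c' - g c))"
        using c by (intro tendsto_intros J) auto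
      have "norm (S n c' - S n c - f c * (g c' - g c)) \<le> e * (V c' - V c)" if n: "n \<ge> N" for n
      proof -
        have "(\<Sum>i<2^n. (g (min c' (x n (Suc i))) - g (min c' (x n i))) - (g (min c (x n (Suc i))) - g (min c (x n i)))) = g c' - g c"
          unfolding sum_subtractf[of "\<lambda>i. g (min c' (x n (Suc i))) - g (min c' (x n i))"]
          using sum_lessThan_telescope[of "\<lambda>i. g (min c' (x n i))" "2^n"]
            sum_lessThan_telescope[of "\<lambda>i. g (min c (x n i))" "2^n"] c
          by (simp add: x0 xn min_absorb1 min_absorb2)
        then have "S n c' - S n c - f c * (g c' - g c) = (\<Sum>i<2^n. (f (x n i) - f c) *
            ((g (min c' (x n (Suc i))) - g (min c' (x n i))) - (g (min c (x n (Suc i))) - g (min c (x n i)))))"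
          unfolding S_inc
          by (simp only: left_diff_distrib sum_subtractf[of "\<lambda>i. f (x n i) * _ i"] sum_distrib_left[symmetric])
        also have "norm \<dots> \<le> e / (k + 1) * k * (V c' - V c)"
        proof (rule step_sum_bound[OF g])
          fix i :: nat assume i: "i < 2 ^ n" "c \<le> x n (Suc i)" "x n i \<le> c'"
          have "\<bar>x n i - c\<bar> < d"
            using i xstep[of n i] N[OF n] c d(1) by linarith
          then show "norm (f (x n i) - f c) \<le> e / (k + 1)"
            using d(2)[of c "x n i"] c xrange[of i n] i by simp
        qed (use xmono xrange x0 xn k \<open>e > 0\<close> c in auto)
        also have "\<dots> \<le> e / (k + 1) * (k + 1) * (V c' - V c)"
          using k \<open>e > 0\<close> V_le[of c c'] c by (intro mult_right_mono mult_left_mono) auto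
        finally show ?thesis using k by simp
      qed
      then show "\<exists>N. \<forall>n\<ge>N. norm (S n c' - S n c - f c * (g c' - g c)) \<le> e * (V c' - V c)" by blast
    qed
    then show "\<exists>d>0. \<forall>c c'. 0 \<le> c \<and> c \<le> c' \<and> c' \<le> T \<and> c' - c < d \<longrightarrow>
      norm (J c' - J c - f c * (g c' - g c)) \<le> e * (V c' - V c)"
      using d(1) by (intro exI[of _ "d / 2"]) auto
  qed
  ultimately show thesis by (rule that)
qed

text \<open>The product rule \<open>d(f g) = f dg + g df\<close>; the defect is exactly the product
  of the two increments.\<close>

lemma dint_product:
  fixes f g :: "real \<Rightarrow> 'a::{real_normed_algebra, comm_ring}"
  assumes "continuous_on {0..T} f" "vlip g"
  shows "negl (\<lambda>c c'. (f c' * g c' - f c * g c) - (f c * (g c' - g c) + g c * (f c' - f c)))"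
  using negl_small_mult[OF assms] by (rule negl_cong) (simp add: algebra_simps)

text \<open>Connects the calculus with the tagged divisions of the definition. The increment of
  \<open>J\<close> is additive over the cells, so it suffices to compare cell by cell; moving the
  tag to the left end costs the oscillation of \<open>f\<close>.\<close>

lemma dint_has_rs_integral:
  fixes f g :: "real \<Rightarrow> 'a::real_normed_algebra"
  assumes "dint J f g" and f: "continuous_on {0..T} f" and "vlip g" and ab: "0 \<le> a" "a \<le> b" "b \<le> T"
  shows "has_rs_integral (*) f g a b (J b - J a)"
  unfolding has_rs_integral_def
proof (intro allI impI)
  fix e :: real assume "e > 0"
  obtain k where k: "k \<ge> 0"
    and g: "\<And>c c'. 0 \<le> c \<Longrightarrow> c \<le> c' \<Longrightarrow> c' \<le> T \<Longrightarrow> norm (g c' - g c) \<le> k * (V c' - V c)"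
    using vlipE[OF assms(3)] by blast
  define e' where "e' = e / ((k + 1) * (V b - V a + 1))"
  have Vab: "V b - V a \<ge> 0" using V_le ab by auto
  have "e' > 0" using Vab k \<open>e > 0\<close> by (simp add: e'_def)
  obtain d1 where d1: "d1 > 0"
    "\<And>c c'. 0 \<le> c \<Longrightarrow> c \<le> c' \<Longrightarrow> c' \<le> T \<Longrightarrow> c' - c < d1 \<Longrightarrow>
        norm (J c' - J c - f c * (g c' - g c)) \<le> e' * (V c' - V c)"
    using neglD[OF assms(1)[unfolded dint_def] \<open>e' > 0\<close>] by metis
  obtain d2 where d2: "d2 > 0"
      "\<And>s t. 0 \<le> s \<Longrightarrow> s \<le> T \<Longrightarrow> 0 \<le> t \<Longrightarrow> t \<le> T \<Longrightarrow> \<bar>t - s\<bar> < d2 \<Longrightarrow> norm (f t - f s) < e'"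
    using uniformly_small_increments[OF f \<open>e' > 0\<close>] by metis
  \<comment> \<open>A cell inside a ball of radius \<open>d\<close> has length below
    \<open>2 * d\<close>, which is \<open>min d1 d2\<close>.\<close>
  define d where "d = min d1 d2 / 2"
  have "d > 0" using d1(1) d2(1) by (simp add: d_def)
  have "norm ((\<Sum>(x, K)\<in>p. f x * (g (Sup K) - g (Inf K))) - (J b - J a)) < e"
    if p: "p tagged_division_of {a..b}" "(\<lambda>x. ball x d) fine p" for p
  proof -
    have tel: "(\<Sum>(x,K)\<in>p. h (Sup K) - h (Inf K)) = h b - h a" for h :: "real \<Rightarrow> 'b::real_normed_vector"
      by (rule additive_tagged_division_1[OF ab(2) p(1)])
    have "(\<Sum>(x, K)\<in>p. f x * (g (Sup K) - g (Inf K))) - (J b - J a)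
       = (\<Sum>(x, K)\<in>p. f x * (g (Sup K) - g (Inf K)) - (J (Sup K) - J (Inf K)))"
      unfolding tel[of J, symmetric] by (simp add: sum_subtractf case_prod_unfold)
    also have "norm \<dots> \<le> (\<Sum>(x, K)\<in>p. e' * (k + 1) * (V (Sup K) - V (Inf K)))"
    proof (rule order_trans[OF norm_sum sum_mono], clarify)
      fix x K assume xK: "(x, K) \<in> p"
      then obtain c c' where K: "K = {c..c'}" using tagged_division_ofD(4)[OF p(1) xK] by auto
      have xin: "x \<in> K" and Ksub: "K \<subseteq> {a..b}" using tagged_division_ofD(2,3)[OF p(1) xK] by auto
      have KB: "K \<subseteq> ball x d" using fineD[OF p(2) xK] .
      have cc: "c \<le> x" "x \<le> c'" using xin K by auto
      then have "c \<in> K" "c' \<in> K" using K by auto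
      then have "c \<in> ball x d" "c' \<in> ball x d" and ran: "0 \<le> c" "c' \<le> T" using KB Ksub ab by auto
      then have dd: "c' - c < d1" "\<bar>x - c\<bar> < d2" using cc d1(1) d2(1) by (auto simp: d_def dist_real_def)
      have "norm (f x * (g c' - g c) - (J c' - J c))
        \<le> norm ((f x - f c) * (g c' - g c)) + norm (J c' - J c - f c * (g c' - g c))"
        by (rule order_trans[OF _ norm_triangle_ineq4]) (simp add: algebra_simps)
      also have "\<dots> \<le> e' * (k * (V c' - V c)) + e' * (V c' - V c)"
      proof (rule add_mono)
        have "norm (f x - f c) \<le> e'" using d2(2)[of c x] dd ran cc by simp
        moreover have "norm (g c' - g c) \<le> k * (V c' - V c)" using g ran cc by auto
        ultimately show "norm ((f x - f c) * (g c' - g c)) \<le> e' * (k * (V c' - V c))"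
          using \<open>e' > 0\<close> by (intro order_trans[OF norm_mult_ineq] mult_mono) auto
        show "norm (J c' - J c - f c * (g c' - g c)) \<le> e' * (V c' - V c)" using d1(2) dd ran cc by auto
      qed
      finally show "norm (f x * (g (Sup K) - g (Inf K)) - (J (Sup K) - J (Inf K)))
        \<le> e' * (k + 1) * (V (Sup K) - V (Inf K))"
        using K cc by (simp add: algebra_simps)
    qed
    also have "\<dots> = e' * (k + 1) * (V b - V a)"
      using tel[of V] by (simp add: sum_distrib_left[symmetric] case_prod_unfold)
    also have "\<dots> < e' * (k + 1) * (V b - V a + 1)" using \<open>e' > 0\<close> k by simp
    also have "\<dots> = e" using k Vab by (simp add: e'_def add_nonneg_eq_0_iff)
    finally show ?thesis .
  qed
  then show "\<exists>d>0. \<forall>p. p tagged_division_of {a..b} \<and> (\<lambda>x. ball x d) fine p \<longrightarrow>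
      norm ((\<Sum>(x, K)\<in>p. f x * (g (Sup K) - g (Inf K))) - (J b - J a)) < e"
    using \<open>d > 0\<close> by blast
qed

end

text \<open>Some division is fine for both gauges, so its single Riemann sum is close to both
  candidate values.\<close>

lemma has_rs_integral_unique:
  assumes "has_rs_integral prd f g a b I" "has_rs_integral prd f g a b I'"
  shows "I = I'"
proof (rule ccontr)
  assume "I \<noteq> I'"
  define e where "e = norm (I - I') / 2"
  have "e > 0" using \<open>I \<noteq> I'\<close> by (simp add: e_def)
  obtain d where d: "d > 0" "\<forall>p. p tagged_division_of {a..b} \<and> (\<lambda>x. ball x d) fine p \<longrightarrow>
     norm ((\<Sum>(x, K)\<in>p. prd (f x) (g (Sup K) - g (Inf K))) - I) < e"
    using assms(1) \<open>e > 0\<close> unfolding has_rs_integral_def by blast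
  obtain d' where d': "d' > 0" "\<forall>p. p tagged_division_of {a..b} \<and> (\<lambda>x. ball x d') fine p \<longrightarrow>
     norm ((\<Sum>(x, K)\<in>p. prd (f x) (g (Sup K) - g (Inf K))) - I') < e"
    using assms(2) \<open>e > 0\<close> unfolding has_rs_integral_def by blast
  have "gauge (\<lambda>x::real. ball x d \<inter> ball x d')" using d(1) d'(1) by (simp add: gauge_def open_Int)
  then obtain p where p: "p tagged_division_of {a..b}" "(\<lambda>x. ball x d \<inter> ball x d') fine p"
    using fine_division_exists_real by blast
  have "(\<lambda>x. ball x d) fine p" "(\<lambda>x. ball x d') fine p"
    using p(2) by (simp_all add: fine_Int)
  then have "norm ((\<Sum>(x, K)\<in>p. prd (f x) (g (Sup K) - g (Inf K))) - I) < e"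
    "norm ((\<Sum>(x, K)\<in>p. prd (f x) (g (Sup K) - g (Inf K))) - I') < e"
    using d(2) d'(2) p(1) by blast+
  then have "norm (I - I') < 2 * e"
    using norm_triangle_ineq4[of "(\<Sum>(x, K)\<in>p. prd (f x) (g (Sup K) - g (Inf K))) - I'" "(\<Sum>(x, K)\<in>p. prd (f x) (g (Sup K) - g (Inf K))) - I"]
    by simp
  then show False by (simp add: e_def)
qed

lemma rs_integral_unique: "has_rs_integral prd f g a b I \<Longrightarrow> rs_integral prd f g a b = I"
  unfolding rs_integral_def by (blast intro: the_equality has_rs_integral_unique)


section \<open>Signatures and Chen's identity\<close>

lemma linear_cov: "linear (cov f)"
  using cov[of f] by simp

lemmas cov_simps = linear_add[OF linear_cov] linear_diff[OF linear_cov] linear_cmul[OF linear_cov]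
  linear_0[OF linear_cov] linear_neg[OF linear_cov] linear_sum[OF linear_cov]

lemma cov_pullback: "linear A \<Longrightarrow> cov (pullback A f) = cov f \<circ> A"
  unfolding pullback_def by (rule Abs_covector_inverse) (simp add: linear_compose linear_cov)

section \<open>Iterated integrals\<close>

text \<open>Convexity of the power function. It replaces the chain rule for \<open>x^n dx\<close> in
  \<open>iter_int_bound\<close>, where \<open>x\<close> is a multiple of an increment of
  \<open>V\<close> and may jump.\<close>

lemma power_tangent_le:
  fixes x y :: real
  assumes "0 \<le> x" "x \<le> y"
  shows "real (Suc n) * x ^ n * (y - x) \<le> y ^ Suc n - x ^ Suc n"
proof (induction n)
  case (Suc n)
  have "real (Suc (Suc n)) * x ^ Suc n * (y - x) = x * (real (Suc n) * x ^ n * (y - x)) + x ^ Suc n * (y - x)"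
    by (simp add: algebra_simps)
  also have "\<dots> \<le> y * (y ^ Suc n - x ^ Suc n) + x ^ Suc n * (y - x)"
    using Suc assms power_mono[OF assms(2,1), of "Suc n"] by (intro add_right_mono mult_mono) auto
  also have "\<dots> = y ^ Suc (Suc n) - x ^ Suc (Suc n)"
    by (simp add: algebra_simps)
  finally show ?case .
qed auto

text \<open>The alphabet is arbitrary and the values may be complex, because the letters of the
  decorated path are themselves complex integrals.\<close>

primrec iter_rs :: "('q \<Rightarrow> real \<Rightarrow> 'a::real_normed_field) \<Rightarrow> 'q list \<Rightarrow> real \<Rightarrow> 'a" where
  "iter_rs G [] t = 1"
| "iter_rs G (q # w) t = rs_integral (*) (iter_rs G w) (G q) 0 t"

lemma iter_int_eq_iter_rs: "iter_int \<eta> = iter_rs (\<lambda>f t. cov f (\<eta> t))"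
proof
  show "iter_int \<eta> fs = iter_rs (\<lambda>f t. cov f (\<eta> t)) fs" for fs
  proof (induction fs)
    case (Cons f fs)
    show ?case by (rule ext) (simp add: Cons)
  qed (rule ext, simp)
qed

context control
begin

text \<open>Stated through functionals because the target space need not carry a norm: the decorated
  path takes values in a function space that is used only as a \<open>real_vector\<close>.\<close>

definition tame :: "(real \<Rightarrow> 'e::real_vector) \<Rightarrow> bool" where
  "tame \<eta> \<longleftrightarrow> (\<forall>f. vlip (\<lambda>t. cov f (\<eta> t)))"

lemma vlip_cong:
  assumes "vlip g" "\<And>t. 0 \<le> t \<Longrightarrow> t \<le> T \<Longrightarrow> g' t = g t + k"
  shows "vlip g'"
proof -
  obtain K where K: "K \<ge> 0"
    and g: "\<And>c c'. 0 \<le> c \<Longrightarrow> c \<le> c' \<Longrightarrow> c' \<le> T \<Longrightarrow> norm (g c' - g c) \<le> K * (V c' - V c)"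
    using vlipE[OF assms(1)] by blast
  have "continuous_on {0..T} (\<lambda>t. g t + k)" by (intro continuous_intros vlip_continuous assms)
  then have "continuous_on {0..T} g'" using assms(2) by (subst continuous_on_cong[OF refl, of _ _ "\<lambda>t. g t + k"]) auto
  then show ?thesis
    by (rule vlipI[where k = K]) (use g assms(2) in auto)
qed

text \<open>\<open>rs_integral\<close> is given by a description operator; existence and uniqueness
  together make it a genuine primitive, for all upper limits at once.\<close>

lemma dint_rs_integral:
  fixes f g :: "real \<Rightarrow> 'a::{real_normed_field, banach}"
  assumes "continuous_on {0..T} f" "vlip g"
  shows "dint (rs_integral (*) f g 0) f g" and "rs_integral (*) f g 0 0 = 0"
    and "\<And>t. 0 \<le> t \<Longrightarrow> t \<le> T \<Longrightarrow> has_rs_integral (*) f g 0 t (rs_integral (*) f g 0 t)"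
proof -
  obtain J where J: "J 0 = 0" "dint J f g" by (rule dint_exists[OF assms]) (rule that)
  have h: "has_rs_integral (*) f g 0 t (J t)" if t: "0 \<le> t" "t \<le> T" for t
    using dint_has_rs_integral[OF J(2) assms order_refl t] J(1) by simp
  have eq: "rs_integral (*) f g 0 t = J t" if t: "0 \<le> t" "t \<le> T" for t
    by (rule rs_integral_unique[OF h[OF t]])
  show "dint (rs_integral (*) f g 0) f g"
    by (rule dint_cong[OF J(2), where k = 0]) (use eq in auto)
  show "rs_integral (*) f g 0 0 = 0" using eq[of 0] T_nonneg J(1) by simp
  show "has_rs_integral (*) f g 0 t (rs_integral (*) f g 0 t)" if t: "0 \<le> t" "t \<le> T" for t
    using h[OF t] eq[OF t] by simp
qed

lemma iter_rs_vlip_dint: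
  fixes G :: "'q \<Rightarrow> real \<Rightarrow> 'a::{real_normed_field, banach}"
  assumes G: "\<And>q. vlip (G q)"
  shows "vlip (iter_rs G w)" and "dint (iter_rs G (q # w)) (iter_rs G w) (G q)"
    and "iter_rs G (q # w) 0 = 0"
proof -
  have unfold: "iter_rs G (q # w) = rs_integral (*) (iter_rs G w) (G q) 0" for q w
    by (rule ext) simp
  have 1: "vlip (iter_rs G w)" for w
  proof (induction w)
    case Nil
    then show ?case by (simp add: vlip_const)
  next
    case (Cons q w)
    have c: "continuous_on {0..T} (iter_rs G w)" by (rule vlip_continuous[OF Cons])
    show ?case unfolding unfold by (rule dint_vlip[OF dint_rs_integral(1)[OF c G] c G])
  qed
  show "vlip (iter_rs G w)" by (rule 1)
  show "dint (iter_rs G (q # w)) (iter_rs G w) (G q)"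
    unfolding unfold by (rule dint_rs_integral(1)[OF vlip_continuous[OF 1] G])
  show "iter_rs G (q # w) 0 = 0"
    unfolding unfold by (rule dint_rs_integral(2)[OF vlip_continuous[OF 1] G])
qed

lemma iter_int_vlip_dint:
  assumes "tame \<eta>"
  shows "vlip (iter_int \<eta> fs)"
    and "dint (iter_int \<eta> (f # fs)) (iter_int \<eta> fs) (\<lambda>t. cov f (\<eta> t))"
    and "iter_int \<eta> (f # fs) 0 = 0"
  unfolding iter_int_eq_iter_rs
  by (rule iter_rs_vlip_dint; use assms in \<open>simp add: tame_def\<close>)+

lemma iter_int_unique:
  assumes "tame \<eta>"
    and "\<And>t. 0 \<le> t \<Longrightarrow> t \<le> T \<Longrightarrow> J [] t = 1"
    and "\<And>f fs. J (f # fs) 0 = 0"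
    and "\<And>f fs. dint (J (f # fs)) (J fs) (\<lambda>t. cov f (\<eta> t))"
    and "0 \<le> t" "t \<le> T"
  shows "iter_int \<eta> fs t = J fs t"
  using assms(5,6)
proof (induction fs arbitrary: t)
  case Nil
  then show ?case using assms(2) by simp
next
  case (Cons f fs)
  have "dint (iter_int \<eta> (f # fs)) (J fs) (\<lambda>t. cov f (\<eta> t))"
    by (rule dint_cong[OF iter_int_vlip_dint(2)[OF assms(1)], where k = 0]) (use Cons.IH in auto)
  then show ?case
    by (rule dint_unique[OF _ assms(4)]) (use Cons.prems assms(3) iter_int_vlip_dint(3)[OF assms(1)] in auto)
qed

lemma iter_int_cong:
  assumes "tame \<eta>" "\<And>f t. 0 \<le> t \<Longrightarrow> t \<le> T \<Longrightarrow> cov f (\<eta>' t) = cov f (\<eta> t) + k f"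
    and "0 \<le> t" "t \<le> T"
  shows "iter_int \<eta>' fs t = iter_int \<eta> fs t"
proof (rule iter_int_unique)
  show "tame \<eta>'"
    unfolding tame_def using assms(1) by (auto simp: tame_def intro: vlip_cong[OF _ assms(2)])
  show "dint (iter_int \<eta> (f # fs)) (iter_int \<eta> fs) (\<lambda>t. cov f (\<eta>' t))" for f fs
    by (rule dint_cong[OF iter_int_vlip_dint(2)[OF assms(1)] _ _ assms(2)]) auto
qed (use assms iter_int_vlip_dint(3)[OF assms(1)] in auto)

text \<open>Factorial decay: with \<open>x = k * (V t - V 0)\<close>, the bound
  \<open>x^n / n!\<close> reproduces itself with \<open>n + 1\<close> under integration against an
  integrator whose increments are at most those of \<open>x\<close>.\<close>

lemma iter_int_bound:
  assumes "tame \<eta>" "\<And>f c c'. f \<in> set fs \<Longrightarrow> 0 \<le> c \<Longrightarrow> c \<le> c' \<Longrightarrow> c' \<le> T \<Longrightarrow>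
      \<bar>cov f (\<eta> c') - cov f (\<eta> c)\<bar> \<le> k * (V c' - V c)"
    and "0 \<le> k" "0 \<le> t" "t \<le> T"
  shows "\<bar>iter_int \<eta> fs t\<bar> \<le> (k * (V t - V 0)) ^ length fs / fact (length fs)"
  using assms(2,4,5)
proof (induction fs arbitrary: t)
  case (Cons f fs)
  define n where "n = length fs"
  have g: "\<bar>cov f (\<eta> c') - cov f (\<eta> c)\<bar> \<le> k * (V c' - V c)" if "0 \<le> c" "c \<le> c'" "c' \<le> T" for c c'
    using Cons.prems(1)[of f] that by simp
  have IH: "\<bar>iter_int \<eta> fs t\<bar> \<le> (k * (V t - V 0)) ^ n / fact n" if "0 \<le> t" "t \<le> T" for t
    unfolding n_def by (rule Cons.IH) (use Cons.prems(1) that in auto)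
  have "norm (iter_int \<eta> (f # fs) t - iter_int \<eta> (f # fs) 0)
    \<le> (k * (V t - V 0)) ^ Suc n / fact (Suc n) - (k * (V 0 - V 0)) ^ Suc n / fact (Suc n)"
  proof (rule negl_increment_bound[OF iter_int_vlip_dint(2)[OF assms(1), unfolded dint_def]])
    fix c c' assume c: "0 \<le> c" "c \<le> c'" "c' \<le> T"
    define x y where "x = k * (V c - V 0)" and "y = k * (V c' - V 0)"
    have x: "0 \<le> x" "x \<le> y"
      using V_le[of 0 c] V_le[of c c'] c assms(3) by (auto simp: x_def y_def intro!: mult_left_mono)
    have "\<bar>iter_int \<eta> fs c * (cov f (\<eta> c') - cov f (\<eta> c))\<bar> \<le> x ^ n / fact n * (y - x)"
      unfolding abs_mult
    proof (rule mult_mono)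
      show "\<bar>iter_int \<eta> fs c\<bar> \<le> x ^ n / fact n" using IH[of c] c by (simp add: x_def)
      show "\<bar>cov f (\<eta> c') - cov f (\<eta> c)\<bar> \<le> y - x" using g[OF c] by (simp add: x_def y_def algebra_simps)
    qed (use x in auto)
    also have "\<dots> = real (Suc n) * x ^ n * (y - x) / fact (Suc n)"
      by (simp add: divide_simps del: of_nat_Suc)
    also have "\<dots> \<le> (y ^ Suc n - x ^ Suc n) / fact (Suc n)"
      by (intro divide_right_mono power_tangent_le x) auto
    finally show "norm (iter_int \<eta> (f # fs) c' - iter_int \<eta> (f # fs) c -
          (iter_int \<eta> (f # fs) c' - iter_int \<eta> (f # fs) c - iter_int \<eta> fs c * (cov f (\<eta> c') - cov f (\<eta> c))))
         \<le> (k * (V c' - V 0)) ^ Suc n / fact (Suc n) - (k * (V c - V 0)) ^ Suc n / fact (Suc n)"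
      by (simp add: x_def y_def diff_divide_distrib del: power_Suc fact_Suc iter_int.simps)
  qed (use Cons.prems in auto)
  then show ?case using iter_int_vlip_dint(3)[OF assms(1), of f fs] by (simp add: n_def del: iter_int.simps)
qed auto

end

section \<open>Time shift and Chen's identity\<close>

lemma control_shift:
  assumes "control V T" "0 \<le> S" "S \<le> T"
  shows "control (\<lambda>s. V (S + s)) (T - S)"
proof -
  interpret control V T by fact
  show ?thesis
    by unfold_locales (use assms V_le in \<open>auto simp: mono_on_def\<close>)
qed

lemma negl_shift:
  assumes "control V T" "0 \<le> S" "S \<le> T" "control.negl V T \<Phi>"
  shows "control.negl (\<lambda>s. V (S + s)) (T - S) (\<lambda>c c'. \<Phi> (S + c) (S + c'))"
proof -
  interpret control V T by fact
  interpret W: control "\<lambda>s. V (S + s)" "T - S" by (rule control_shift) fact+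
  show ?thesis
  proof (rule W.neglI)
    fix e :: real assume "e > 0"
    obtain d where d: "d > 0" "\<And>c c'. 0 \<le> c \<Longrightarrow> c \<le> c' \<Longrightarrow> c' \<le> T \<Longrightarrow> c' - c < d \<Longrightarrow> norm (\<Phi> c c') \<le> e * (V c' - V c)"
      using neglD[OF assms(4) \<open>e > 0\<close>] by metis
    show "\<exists>d>0. \<forall>c c'. 0 \<le> c \<and> c \<le> c' \<and> c' \<le> T - S \<and> c' - c < d \<longrightarrow>
        norm (\<Phi> (S + c) (S + c')) \<le> e * (V (S + c') - V (S + c))"
      using d assms by (intro exI[of _ d]) auto
  qed
qed

lemma vlip_shift:
  assumes "control V T" "0 \<le> S" "S \<le> T" "control.vlip V T g"
  shows "control.vlip (\<lambda>s. V (S + s)) (T - S) (\<lambda>s. g (S + s))"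
proof -
  interpret control V T by fact
  interpret W: control "\<lambda>s. V (S + s)" "T - S" by (rule control_shift) fact+
  obtain k where k: "k \<ge> 0"
    and g: "\<And>c c'. 0 \<le> c \<Longrightarrow> c \<le> c' \<Longrightarrow> c' \<le> T \<Longrightarrow> norm (g c' - g c) \<le> k * (V c' - V c)"
    using vlipE[OF assms(4)] by blast
  show ?thesis
  proof (rule W.vlipI[where k = k])
    show "continuous_on {0..T - S} (\<lambda>s. g (S + s))"
      by (rule continuous_on_compose2[OF vlip_continuous[OF assms(4)]]) (use assms in \<open>auto intro!: continuous_intros\<close>)
  qed (use g assms in auto)
qed

text \<open>As functions of \<open>s\<close>, both sides solve the same equation with the integrator
  of the outermost letter \<open>f\<close>, and they agree at \<open>s = 0\<close>. The constants
  \<open>k f\<close> let \<open>\<eta>'\<close> be any translate of the second piece, since only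
  increments enter.\<close>

lemma iter_int_chen:
  assumes "control V T" and S: "0 \<le> S" "S \<le> T" and tame: "control.tame V T \<eta>"
    and \<eta>': "\<And>f s. 0 \<le> s \<Longrightarrow> s \<le> T - S \<Longrightarrow> cov f (\<eta>' s) = cov f (\<eta> (S + s)) + k f"
    and s: "0 \<le> s" "s \<le> T - S"
  shows "iter_int \<eta> fs (S + s) = (\<Sum>j\<le>length fs. iter_int \<eta>' (take j fs) s * iter_int \<eta> (drop j fs) S)"
proof -
  interpret control V T by fact
  interpret W: control "\<lambda>s. V (S + s)" "T - S" by (rule control_shift) fact+
  have tame': "W.tame \<eta>'"
    unfolding W.tame_def
  proof
    fix f
    have "vlip (\<lambda>t. cov f (\<eta> t))" using tame by (simp add: tame_def)
    then show "W.vlip (\<lambda>t. cov f (\<eta>' t))"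
      by (rule W.vlip_cong[OF vlip_shift[OF assms(1) S], where k = "k f"]) (rule \<eta>')
  qed
  show ?thesis using s
  proof (induction fs arbitrary: s)
    case (Cons f fs)
    define R where "R s = (\<Sum>j\<le>length (f # fs). iter_int \<eta>' (take j (f # fs)) s * iter_int \<eta> (drop j (f # fs)) S)" for s
    \<comment> \<open>The term \<open>j = 0\<close> is the initial value; in every other term
      \<open>f\<close> is the outermost letter of the \<open>\<eta>'\<close> factor.\<close>
    have R: "R s = iter_int \<eta> (f # fs) S + (\<Sum>j\<le>length fs. iter_int \<eta> (drop j fs) S * iter_int \<eta>' (f # take j fs) s)" for s
      unfolding R_def length_Cons sum.atMost_Suc_shift by (simp add: mult.commute del: iter_int.simps(2))
    have 1: "W.dint (\<lambda>s. iter_int \<eta> (f # fs) (S + s)) (\<lambda>s. iter_int \<eta> fs (S + s)) (\<lambda>s. cov f (\<eta> (S + s)))"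
      using negl_shift[OF assms(1) S iter_int_vlip_dint(2)[OF tame, unfolded dint_def]] by (simp add: W.dint_def)
    have 2: "W.dint (\<lambda>s. \<Sum>j\<le>length fs. iter_int \<eta> (drop j fs) S * iter_int \<eta>' (f # take j fs) s)
       (\<lambda>s. \<Sum>j\<le>length fs. iter_int \<eta> (drop j fs) S * iter_int \<eta>' (take j fs) s) (\<lambda>s. cov f (\<eta>' s))"
      by (intro W.dint_sum_left W.dint_cmult_left W.iter_int_vlip_dint(2) tame')
    have 2: "W.dint R (\<lambda>s. iter_int \<eta> fs (S + s)) (\<lambda>s. cov f (\<eta> (S + s)))"
    proof -
      have "W.dint (\<lambda>s. R s - iter_int \<eta> (f # fs) S) (\<lambda>s. iter_int \<eta> fs (S + s)) (\<lambda>s. cov f (\<eta> (S + s)))"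
        by (rule W.dint_cong[OF 2, where k = "- k f"])
          (use Cons.IH \<eta>' in \<open>auto simp: R mult.commute simp del: iter_int.simps\<close>)
      then show ?thesis unfolding W.dint_def by simp
    qed
    have "iter_int \<eta> (f # fs) (S + s) = R s"
      by (rule W.dint_unique[OF 1 2])
        (use Cons.prems W.iter_int_vlip_dint(3)[OF tame'] in \<open>auto simp: R simp del: iter_int.simps\<close>)
    then show ?case by (simp add: R_def)
  qed simp
qed

lemma path_sig_chen:
  assumes "control V (S + R)" and "0 \<le> S" "0 \<le> R" and "control.tame V (S + R) \<eta>"
    and "\<And>f s. 0 \<le> s \<Longrightarrow> s \<le> R \<Longrightarrow> cov f (\<eta>' s) = cov f (\<eta> (S + s)) + k f"
  shows "path_sig (S + R) \<eta> = tmul (path_sig S \<eta>) (path_sig R \<eta>')"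
proof
  fix fs :: "'a covector list"
  have "path_sig (S + R) \<eta> fs = (\<Sum>j\<le>length fs. iter_int \<eta>' (take j (rev fs)) R * iter_int \<eta> (drop j (rev fs)) S)"
    unfolding path_sig_def by (subst iter_int_chen[OF assms(1) _ _ assms(4), of S \<eta>' k]) (use assms in auto)
  \<comment> \<open>\<open>iter_int\<close> reads words backwards, so a cut after \<open>j\<close>
    letters becomes a cut after \<open>length fs - j\<close> letters.\<close>
  also have "\<dots> = (\<Sum>j\<le>length fs. iter_int \<eta> (drop (length fs - j) (rev fs)) S * iter_int \<eta>' (take (length fs - j) (rev fs)) R)"
    by (rule sum.reindex_bij_witness[of _ "\<lambda>j. length fs - j" "\<lambda>j. length fs - j"]) auto
  also have "\<dots> = tmul (path_sig S \<eta>) (path_sig R \<eta>') fs"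
    unfolding tmul_def path_sig_def by (intro sum.cong refl) (simp add: drop_rev take_rev)
  finally show "path_sig (S + R) \<eta> fs = tmul (path_sig S \<eta>) (path_sig R \<eta>') fs" .
qed

section \<open>Tameness of concatenated paths\<close>

text \<open>The control is hidden, since different paths come with different controls and every
  concatenation gets a new one.\<close>

definition tame_on :: "real \<Rightarrow> (real \<Rightarrow> 'e::real_vector) \<Rightarrow> bool" where
  "tame_on T \<eta> \<longleftrightarrow> (\<exists>V. control V T \<and> control.tame V T \<eta>)"

lemma tame_on_path_concat:
  assumes "tame_on S \<gamma>" "tame_on R \<eta>"
  shows "tame_on (S + R) (path_concat S \<gamma> \<eta>)"
proof -
  obtain V1 where V1: "control V1 S" "control.tame V1 S \<gamma>" using assms(1) unfolding tame_on_def by blast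
  obtain V2 where V2: "control V2 R" "control.tame V2 R \<eta>" using assms(2) unfolding tame_on_def by blast
  interpret A: control V1 S by fact
  interpret B: control V2 R by fact
  \<comment> \<open>The second control is shifted so that it continues from the final value of the
    first.\<close>
  define V where "V t = (if t \<le> S then V1 t else V1 S + (V2 (t - S) - V2 0))" for t
  have V0: "V t = V1 S + (V2 (t - S) - V2 0)" if "S \<le> t" for t using that by (auto simp: V_def)
  interpret C: control V "S + R"
  proof
    show "0 \<le> S + R" using A.T_nonneg B.T_nonneg by simp
    show "mono_on {0..S + R} V"
    proof (rule mono_onI)
      fix r s assume rs: "r \<in> {0..S + R}" "s \<in> {0..S + R}" "r \<le> s"
      consider "s \<le> S" | "r \<le> S" "S \<le> s" | "S \<le> r" by linarith
      then show "V r \<le> V s"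
      proof cases
        case 1
        then show ?thesis using rs A.V_le[of r s] by (simp add: V_def)
      next
        case 2
        then show ?thesis using rs A.V_le[of r S] B.V_le[of 0 "s - S"] V0[of s] by (simp add: V_def)
      next
        case 3
        then show ?thesis using rs B.V_le[of "r - S" "s - S"] V0[of s] V0[of r] by simp
      qed
    qed
  qed
  have "C.tame (path_concat S \<gamma> \<eta>)"
    unfolding C.tame_def
  proof
    fix f
    have g: "cov f (path_concat S \<gamma> \<eta> t) = (if t \<le> S then cov f (\<gamma> t) else cov f (\<gamma> S) + (cov f (\<eta> (t - S)) - cov f (\<eta> 0)))" for t
      by (simp add: path_concat_def cov_simps)
    have g1: "cov f (path_concat S \<gamma> \<eta> t) = cov f (\<gamma> t)" if "t \<le> S" for t using that by (simp add: g)
    have g2: "cov f (path_concat S \<gamma> \<eta> t) = cov f (\<gamma> S) + (cov f (\<eta> (t - S)) - cov f (\<eta> 0))" if "S \<le> t" for t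
      using that by (auto simp: g)
    have l1: "A.vlip (\<lambda>t. cov f (\<gamma> t))" using V1(2) by (simp add: A.tame_def)
    have l2: "B.vlip (\<lambda>t. cov f (\<eta> t))" using V2(2) by (simp add: B.tame_def)
    obtain k1 where k1: "k1 \<ge> 0"
      "\<And>c c'. 0 \<le> c \<Longrightarrow> c \<le> c' \<Longrightarrow> c' \<le> S \<Longrightarrow> norm (cov f (\<gamma> c') - cov f (\<gamma> c)) \<le> k1 * (V1 c' - V1 c)"
      using A.vlipE[OF l1] by metis
    obtain k2 where k2: "k2 \<ge> 0"
      "\<And>c c'. 0 \<le> c \<Longrightarrow> c \<le> c' \<Longrightarrow> c' \<le> R \<Longrightarrow> norm (cov f (\<eta> c') - cov f (\<eta> c)) \<le> k2 * (V2 c' - V2 c)"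
      using B.vlipE[OF l2] by metis
    show "C.vlip (\<lambda>t. cov f (path_concat S \<gamma> \<eta> t))"
    \<comment> \<open>The sum of the constants covers intervals that straddle \<open>S\<close>,
      where both partial increments of the controls are at most the whole increment of
      \<open>V\<close>.\<close>
    proof (rule C.vlipI[where k = "k1 + k2"])
      have "continuous_on ({0..S} \<union> {S..S+R}) (\<lambda>t. if t \<le> S then cov f (\<gamma> t) else cov f (\<gamma> S) + (cov f (\<eta> (t - S)) - cov f (\<eta> 0)))"
      proof (rule continuous_on_If)
        show "continuous_on {0..S} (\<lambda>t. cov f (\<gamma> t))" by (rule A.vlip_continuous[OF l1])
        have "continuous_on {S..S+R} (\<lambda>t. cov f (\<eta> (t - S)))"
          by (rule continuous_on_compose2[OF B.vlip_continuous[OF l2]]) (auto intro!: continuous_intros)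
        then show "continuous_on {S..S+R} (\<lambda>t. cov f (\<gamma> S) + (cov f (\<eta> (t - S)) - cov f (\<eta> 0)))"
          by (intro continuous_intros)
      qed auto
      moreover have "{0..S} \<union> {S..S+R} = {0..S+R}" using A.T_nonneg B.T_nonneg by auto
      ultimately show "continuous_on {0..S + R} (\<lambda>t. cov f (path_concat S \<gamma> \<eta> t))" by (simp add: g)
    next
      fix c c' assume c: "0 \<le> c" "c \<le> c'" "c' \<le> S + R"
      have nn: "0 \<le> k1 * (V c' - V c)" "0 \<le> k2 * (V c' - V c)"
        using k1(1) k2(1) C.V_le[OF c] by auto
      consider "c' \<le> S" | "c \<le> S" "S \<le> c'" | "S \<le> c" by linarith
      then show "norm (cov f (path_concat S \<gamma> \<eta> c') - cov f (path_concat S \<gamma> \<eta> c)) \<le> (k1 + k2) * (V c' - V c)"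
      proof cases
        case 1
        then show ?thesis using k1(2)[of c c'] c nn by (simp add: g1 V_def distrib_right)
      next
        case 2
        have a: "\<bar>cov f (\<gamma> S) - cov f (\<gamma> c)\<bar> \<le> k1 * (V1 S - V1 c)" using k1(2)[of c S] c 2 by simp
        have b: "\<bar>cov f (\<eta> (c' - S)) - cov f (\<eta> 0)\<bar> \<le> k2 * (V2 (c' - S) - V2 0)" using k2(2)[of 0 "c' - S"] c 2 by simp
        have "V1 S - V1 c \<le> V c' - V c" "V2 (c' - S) - V2 0 \<le> V c' - V c"
          using 2 c B.V_le[of 0 "c' - S"] A.V_le[of c S] by (simp_all add: V0 V_def[of c])
        then have "k1 * (V1 S - V1 c) \<le> k1 * (V c' - V c)" "k2 * (V2 (c' - S) - V2 0) \<le> k2 * (V c' - V c)"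
          using k1(1) k2(1) by (simp_all add: mult_left_mono)
        then show ?thesis using a b 2 by (simp add: g1 g2 distrib_right)
      next
        case 3
        then show ?thesis using k2(2)[of "c - S" "c' - S"] c nn by (simp add: g2 V0 distrib_right)
      qed
    qed
  qed
  then show ?thesis unfolding tame_on_def using C.control_axioms by blast
qed

lemma control_const: "0 \<le> T \<Longrightarrow> control (\<lambda>_. 0) T"
  by unfold_locales (auto simp: mono_on_def)

lemma tame_on_path_pow:
  assumes "tame_on T \<gamma>"
  shows "tame_on (real m * T) (path_pow T \<gamma> m)"
proof (induction m)
  case 0
  have "control.tame (\<lambda>_. 0) 0 (\<lambda>_. 0 :: 'a)"
    by (auto simp: control.tame_def[OF control_const] cov_simps intro: control.vlip_const[OF control_const])
  then show ?case using control_const[of 0] by (auto simp: tame_on_def)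
next
  case (Suc m)
  then show ?case using tame_on_path_concat[OF Suc assms] by (simp add: algebra_simps)
qed

text \<open>All cells of a division of \<open>{0..0}\<close> are points, so every Riemann sum
  vanishes, whatever the path.\<close>

lemma path_sig_0_length: "path_sig 0 \<eta> = tone"
proof
  fix fs :: "'a covector list"
  have "iter_int \<eta> (f # fs) 0 = 0" for f fs
  proof -
    have "has_rs_integral (*) (iter_int \<eta> fs) (\<lambda>s. cov f (\<eta> s)) 0 0 0"
      unfolding has_rs_integral_def
    proof (intro allI impI exI[of _ 1] conjI)
      fix e :: real and p assume "e > 0" and "p tagged_division_of {0..0::real} \<and> (\<lambda>x. ball x 1) fine p"
      then have "snd xK = {0}" if "xK \<in> p" for xK
        using tagged_division_ofD(2,3)[of p "{0..0}" "fst xK" "snd xK"] that by auto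
      then have "(\<Sum>(x, K)\<in>p. iter_int \<eta> fs x * (cov f (\<eta> (Sup K)) - cov f (\<eta> (Inf K)))) = 0"
        unfolding case_prod_unfold by (intro sum.neutral) simp
      then show "norm ((\<Sum>(x, K)\<in>p. iter_int \<eta> fs x * (cov f (\<eta> (Sup K)) - cov f (\<eta> (Inf K)))) - 0) < e"
        using \<open>e > 0\<close> by simp
    qed auto
    then show ?thesis by (simp add: rs_integral_unique)
  qed
  then show "path_sig 0 \<eta> fs = tone fs"
    by (cases fs rule: rev_cases) (auto simp: path_sig_def tone_def simp del: iter_int.simps(2))
qed

lemma path_sig_linear_image:
  assumes "linear A"
  shows "path_sig T (\<lambda>t. A (\<eta> t)) = tmap A (path_sig T \<eta>)"
proof -
  have "iter_int (\<lambda>t. A (\<eta> t)) fs = iter_int \<eta> (map (pullback A) fs)" for fs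
  proof (induction fs)
    case (Cons f fs)
    show ?case by (rule ext) (simp add: Cons cov_pullback[OF assms] comp_def)
  qed (rule ext, simp)
  then show ?thesis by (auto simp: path_sig_def tmap_def rev_map fun_eq_iff)
qed


section \<open>Spectral rigidity of entire logarithms\<close>

text \<open>Matrices are functions on indices below \<open>N\<close> with entries in any semiring,
  so that one definition serves complex matrices and matrices of power series.\<close>

primrec mpow :: "nat \<Rightarrow> (nat \<Rightarrow> nat \<Rightarrow> 'a::semiring_1) \<Rightarrow> nat \<Rightarrow> nat \<Rightarrow> nat \<Rightarrow> 'a" where
  "mpow N A 0 i j = (if i = j then 1 else 0)"
| "mpow N A (Suc k) i j = (\<Sum>q<N. mpow N A k i q * A q j)"

lemma mpow_mat:
  assumes "i < N" "j < N"
  shows "(mat N N (\<lambda>(i, j). A i j) ^\<^sub>m k) $$ (i, j) = mpow N A k i j"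
  using assms
proof (induction k arbitrary: j)
  case (Suc k)
  let ?A = "mat N N (\<lambda>(i, j). A i j)"
  have c: "?A ^\<^sub>m k \<in> carrier_mat N N" by simp
  have "(?A ^\<^sub>m Suc k) $$ (i, j) = (\<Sum>q<N. (?A ^\<^sub>m k) $$ (i, q) * ?A $$ (q, j))"
    using Suc.prems c by (simp add: scalar_prod_def lessThan_atLeast0)
  then show ?case using Suc by simp
qed auto

lemma upper_triangular_pow:
  fixes B :: "'a::comm_ring_1 mat"
  assumes B: "B \<in> carrier_mat N N" "upper_triangular B" and "i < N" "j \<le> i"
  shows "(B ^\<^sub>m k) $$ (i, j) = (if j = i then (B $$ (i, i)) ^ k else 0)"
  using assms(3,4)
proof (induction k arbitrary: i j)
  case (Suc k)
  have c: "B ^\<^sub>m k \<in> carrier_mat N N" using B by simp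
  have "(B ^\<^sub>m Suc k) $$ (i, j) = (\<Sum>q<N. (B ^\<^sub>m k) $$ (i, q) * B $$ (q, j))"
    using Suc.prems c B by (simp add: scalar_prod_def lessThan_atLeast0)
  also have "\<dots> = (\<Sum>q<N. if q = i then (B $$ (i, i)) ^ k * B $$ (i, j) else 0)"
  proof (rule sum.cong[OF refl])
    fix q assume q: "q \<in> {..<N}"
    consider "q < i" | "q = i" | "q > i" by linarith
    then show "(B ^\<^sub>m k) $$ (i, q) * B $$ (q, j) = (if q = i then (B $$ (i, i)) ^ k * B $$ (i, j) else 0)"
    proof cases
      case 1
      then show ?thesis using Suc.IH[of i q] Suc.prems by simp
    next
      case 2
      then show ?thesis using Suc.IH[of i i] Suc.prems by simp
    next
      case 3
      then have "B $$ (q, j) = 0" using B q Suc.prems unfolding upper_triangular_def by auto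
      then show ?thesis using 3 by simp
    qed
  qed
  also have "\<dots> = (B $$ (i, i)) ^ k * B $$ (i, j)" using Suc.prems by simp
  also have "\<dots> = (if j = i then (B $$ (i, i)) ^ Suc k else 0)"
    using B Suc.prems unfolding upper_triangular_def by auto
  finally show ?case .
qed (use B in auto)

lemma sum_diag_mult_commute:
  fixes A B :: "'a::comm_ring_1 mat"
  assumes "A \<in> carrier_mat N N" "B \<in> carrier_mat N N"
  shows "(\<Sum>i<N. (A * B) $$ (i, i)) = (\<Sum>i<N. (B * A) $$ (i, i))"
proof -
  have "(\<Sum>i<N. (A * B) $$ (i, i)) = (\<Sum>i<N. \<Sum>j<N. A $$ (i, j) * B $$ (j, i))"
    using assms by (simp add: scalar_prod_def lessThan_atLeast0)
  also have "\<dots> = (\<Sum>i<N. \<Sum>j<N. B $$ (i, j) * A $$ (j, i))"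
    by (subst sum.swap) (simp add: mult.commute)
  also have "\<dots> = (\<Sum>i<N. (B * A) $$ (i, i))"
    using assms by (simp add: scalar_prod_def lessThan_atLeast0)
  finally show ?thesis .
qed

text \<open>Schur triangularisation yields the same numbers in two roles: as eigenvalues with
  eigenvectors, where the growth of \<open>exp L\<close> bounds them, and as summands of the traces
  of all powers, where that bound is used.\<close>

lemma eigenvalue_list:
  fixes A :: "nat \<Rightarrow> nat \<Rightarrow> complex"
  obtains \<mu> where "\<And>k. (\<Sum>i<N. mpow N A k i i) = (\<Sum>j<N. \<mu> j ^ k)"
    "\<And>j. j < N \<Longrightarrow> \<exists>u. (\<exists>i<N. u i \<noteq> 0) \<and> (\<forall>i<N. (\<Sum>q<N. A i q * u q) = \<mu> j * u i)"
proof -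
  define Am where "Am = mat N N (\<lambda>(i, j). A i j)"
  have Am: "Am \<in> carrier_mat N N" by (simp add: Am_def)
  obtain as where as: "char_poly Am = (\<Prod>a\<leftarrow>as. [:- a, 1:])" using char_poly_factorized[OF Am] by blast
  obtain B where B: "B \<in> carrier_mat N N" "upper_triangular B" "similar_mat Am B"
    using schur_decomposition_exists[OF Am as] by blast
  obtain P Q where "similar_mat_wit Am B P Q" using B(3) unfolding similar_mat_def by blast
  note w = similar_mat_wit_pow[OF this]
  define \<mu> where "\<mu> j = B $$ (j, j)" for j
  show thesis
  proof (rule that[of \<mu>])
    fix k
    have Ak: "Am ^\<^sub>m k \<in> carrier_mat N N" using Am by simp
    note w' = similar_mat_witD2[OF Ak w]
    have "(\<Sum>i<N. mpow N A k i i) = (\<Sum>i<N. (Am ^\<^sub>m k) $$ (i, i))"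
      by (intro sum.cong refl) (simp add: Am_def mpow_mat)
    also have "\<dots> = (\<Sum>i<N. (P * (B ^\<^sub>m k * Q)) $$ (i, i))"
      by (subst w'(3)) (use w' in \<open>simp add: assoc_mult_mat[of _ N N _ N _ N]\<close>)
    also have "\<dots> = (\<Sum>i<N. ((B ^\<^sub>m k * Q) * P) $$ (i, i))"
      by (rule sum_diag_mult_commute) (use w' in auto)
    also have "\<dots> = (\<Sum>i<N. (B ^\<^sub>m k) $$ (i, i))"
      using w' right_mult_one_mat[OF w'(5)] by (simp add: assoc_mult_mat[of _ N N _ N _ N])
    also have "\<dots> = (\<Sum>j<N. \<mu> j ^ k)"
      by (intro sum.cong refl) (simp add: upper_triangular_pow[OF B(1,2)] \<mu>_def)
    finally show "(\<Sum>i<N. mpow N A k i i) = (\<Sum>j<N. \<mu> j ^ k)" .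
  next
    fix j assume j: "j < N"
    have "\<mu> j \<in> set (diag_mat B)" using j B(1) by (auto simp: diag_mat_def \<mu>_def)
    then have "poly (char_poly Am) (\<mu> j) = 0"
      unfolding char_poly_similar[OF B(3)] char_poly_upper_triangular[OF B(1,2)]
      by (auto simp: poly_prod_list prod_list_zero_iff)
    then have "eigenvalue Am (\<mu> j)" using eigenvalue_root_char_poly[OF Am] by simp
    then obtain u where u: "u \<in> carrier_vec N" "u \<noteq> 0\<^sub>v N" "Am *\<^sub>v u = \<mu> j \<cdot>\<^sub>v u"
      unfolding eigenvalue_def eigenvector_def using Am by auto
    have "\<exists>i<N. u $ i \<noteq> 0"
    proof (rule ccontr)
      assume "\<not> ?thesis"
      then have "u = 0\<^sub>v N" using u(1) by (intro eq_vecI) auto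
      then show False using u(2) by simp
    qed
    moreover have "(\<Sum>q<N. A i q * u $ q) = \<mu> j * u $ i" if "i < N" for i
    proof -
      have "(Am *\<^sub>v u) $ i = (\<Sum>q<N. A i q * u $ q)"
        using that u(1) by (simp add: Am_def scalar_prod_def lessThan_atLeast0)
      then show ?thesis using u that by simp
    qed
    ultimately show "\<exists>u. (\<exists>i<N. u i \<noteq> 0) \<and> (\<forall>i<N. (\<Sum>q<N. A i q * u q) = \<mu> j * u i)"
      by (intro exI[of _ "\<lambda>i. u $ i"]) auto
  qed
qed

section \<open>The algebra of tensor series\<close>

lemma tmul_Nil: "tmul s t [] = s [] * t []"
  by (simp add: tmul_def)

lemma tmul_Cons: "tmul s t (f # fs) = s [] * t (f # fs) + tmul (\<lambda>us. s (f # us)) t fs"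
  unfolding tmul_def length_Cons sum.atMost_Suc_shift by simp

lemma tmul_snoc: "tmul s t (fs @ [f]) = tmul s (\<lambda>us. t (us @ [f])) fs + s (fs @ [f]) * t []"
  unfolding tmul_def by simp

lemma tmul_add_left: "tmul (\<lambda>us. s us + s' us) t fs = tmul s t fs + tmul s' t fs"
  by (simp add: tmul_def sum.distrib algebra_simps)

lemma tmul_cmult_left: "tmul (\<lambda>us. c * s us) t fs = c * tmul s t fs"
  by (simp add: tmul_def sum_distrib_left algebra_simps)

lemma tmul_sum_left: "tmul (\<lambda>us. \<Sum>i\<in>I. s i us) t fs = (\<Sum>i\<in>I. tmul (s i) t fs)"
  unfolding tmul_def sum_distrib_right by (rule sum.swap)

lemma tmul_sum_right: "tmul s (\<lambda>us. \<Sum>i\<in>I. t i us) fs = (\<Sum>i\<in>I. tmul s (t i) fs)"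
  unfolding tmul_def sum_distrib_left by (rule sum.swap)

lemma tmul_cmult_right: "tmul s (\<lambda>us. c * t us) fs = c * tmul s t fs"
  by (simp add: tmul_def sum_distrib_left algebra_simps)

lemma tmul_assoc: "tmul (tmul s t) u = tmul s (tmul t u)"
proof
  fix fs show "tmul (tmul s t) u fs = tmul s (tmul t u) fs"
  proof (induction fs arbitrary: s)
    case (Cons f fs)
    show ?case
      by (simp add: tmul_Cons tmul_Nil tmul_add_left tmul_cmult_left Cons algebra_simps)
  qed (simp add: tmul_Nil mult.assoc)
qed

lemma tmul_zero_left: "tmul (\<lambda>_. 0) t fs = 0"
  by (simp add: tmul_def)

lemma tmul_tone_left: "tmul tone t = t"
proof
  fix fs
  have "(\<lambda>us. tone (f # us)) = (\<lambda>_. 0)" for f by (simp add: tone_def fun_eq_iff)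
  then show "tmul tone t fs = t fs"
    by (cases fs) (auto simp: tmul_Nil tmul_Cons tmul_zero_left tone_def)
qed

lemma tmul_tone_right: "tmul t tone = t"
proof
  fix fs
  have "(\<lambda>us. tone (us @ [f])) = (\<lambda>_. 0)" for f by (simp add: tone_def fun_eq_iff)
  then show "tmul t tone fs = t fs"
    by (cases fs rule: rev_cases) (auto simp: tmul_Nil tmul_snoc tmul_def tone_def)
qed

lemma tpow_add: "tpow t (m + n) = tmul (tpow t m) (tpow t n)"
  by (induction m) (simp_all add: tmul_tone_left tmul_assoc)

lemma tpow_Suc_right: "tpow t (Suc n) = tmul (tpow t n) t"
  using tpow_add[of t n 1] by (simp add: tmul_tone_right)

lemma tprod_list_snoc: "tprod_list (ts @ [t]) = tmul (tprod_list ts) t"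
  unfolding tprod_list_def by (induction ts) (simp_all add: tmul_tone_left tmul_tone_right tmul_assoc)

text \<open>Each factor must take at least one letter, since \<open>x\<close> has no constant
  term.\<close>

lemma tpow_eq_0:
  fixes x :: "('e::real_vector, 'k::comm_ring_1) tseries"
  assumes "x [] = 0" "length fs < k"
  shows "tpow x k fs = 0"
  using assms(2)
proof (induction k arbitrary: fs)
  case (Suc k)
  have "x (take i fs) * tpow x k (drop i fs) = 0" for i
  proof (cases "i = 0 \<or> fs = []")
    case False
    then have "length (drop i fs) < k" using Suc.prems by (cases fs) auto
    then show ?thesis using Suc.IH by simp
  qed (use assms(1) in auto)
  then show ?case by (simp add: tmul_def)
qed simp

section \<open>Power series evaluated at tensor series\<close>

text \<open>The value \<open>p(x)\<close> of a one-variable power series at a tensor series without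
  constant term; cutting at the word length is exact by \<open>tpow_eq_0\<close>.\<close>

definition tsubst :: "'k::comm_ring_1 fps \<Rightarrow> ('e::real_vector, 'k) tseries \<Rightarrow> ('e, 'k) tseries" where
  "tsubst p x fs = (\<Sum>j\<le>length fs. fps_nth p j * tpow x j fs)"

lemma tsubst_upto:
  fixes x :: "('e::real_vector, 'k::comm_ring_1) tseries"
  assumes "x [] = 0" "length fs \<le> n"
  shows "tsubst p x fs = (\<Sum>j\<le>n. fps_nth p j * tpow x j fs)"
  unfolding tsubst_def
  by (rule sum.mono_neutral_left) (use assms tpow_eq_0[of x, OF assms(1)] in auto)

text \<open>Substitution is an algebra homomorphism, so identities between one-variable series carry
  over to tensor series. Pairs \<open>(i, j)\<close> with \<open>i + j > n\<close> vanish by degree,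
  which turns the square of indices into the Cauchy triangle.\<close>

lemma tsubst_mult:
  fixes x :: "('e::real_vector, 'k::comm_ring_1) tseries"
  assumes x: "x [] = 0"
  shows "tsubst (p * q) x = tmul (tsubst p x) (tsubst q x)"
proof
  fix fs :: "'e covector list"
  define n where "n = length fs"
  define h where "h i j = fps_nth p i * fps_nth q j * tpow x (i + j) fs" for i j
  have "tmul (tsubst p x) (tsubst q x) fs
      = tmul (\<lambda>us. \<Sum>i\<le>n. fps_nth p i * tpow x i us) (\<lambda>us. \<Sum>j\<le>n. fps_nth q j * tpow x j us) fs"
    unfolding tmul_def
    by (intro sum.cong refl arg_cong2[where f = "(*)"] tsubst_upto[of x, OF x]) (auto simp: n_def)
  also have "\<dots> = (\<Sum>i\<le>n. \<Sum>j\<le>n. h i j)"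
    unfolding tmul_sum_left tmul_sum_right tmul_cmult_left tmul_cmult_right
    by (simp add: h_def tpow_add mult.assoc)
  also have "\<dots> = (\<Sum>(i,j)\<in>{..n}\<times>{..n}. h i j)" by (simp add: sum.cartesian_product)
  also have "\<dots> = (\<Sum>(i,j)\<in>{(i,j). i + j \<le> n}. h i j)"
  proof (rule sum.mono_neutral_right)
    have "h i j = 0" if "\<not> i + j \<le> n" for i j
      using tpow_eq_0[of x fs "i + j", OF x] that by (simp add: h_def n_def)
    then show "\<forall>ij\<in>{..n} \<times> {..n} - {(i, j). i + j \<le> n}. (case ij of (i, j) \<Rightarrow> h i j) = 0"
      by auto
  qed auto
  also have "\<dots> = (\<Sum>k\<le>n. \<Sum>i\<le>k. h i (k - i))" by (rule sum.triangle_reindex_eq)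
  also have "\<dots> = (\<Sum>k\<le>n. fps_nth (p * q) k * tpow x k fs)"
    by (intro sum.cong refl) (simp add: h_def fps_mult_nth sum_distrib_right atLeast0AtMost)
  also have "\<dots> = tsubst (p * q) x fs" by (simp add: tsubst_def n_def)
  finally show "tsubst (p * q) x fs = tmul (tsubst p x) (tsubst q x) fs" by simp
qed

lemma tsubst_1: "tsubst 1 (x :: ('e::real_vector, 'k::comm_ring_1) tseries) = tone"
proof
  fix fs :: "'e covector list"
  have "tsubst 1 x fs = (\<Sum>j\<le>length fs. if j = 0 then tpow x 0 fs else 0)"
    unfolding tsubst_def by (intro sum.cong refl) simp
  then show "tsubst 1 x fs = tone fs" by simp
qed

lemma tsubst_power:
  fixes x :: "('e::real_vector, 'k::comm_ring_1) tseries"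
  assumes "x [] = 0"
  shows "tsubst (p ^ k) x = tpow (tsubst p x) k"
  by (induction k) (simp_all add: tsubst_1 tsubst_mult[of x, OF assms])

lemma tsubst_1_plus_X:
  fixes x :: "('e::real_vector, 'k::comm_ring_1) tseries"
  assumes "x [] = 0"
  shows "tsubst (1 + fps_X) x fs = tone fs + x fs"
proof -
  have "tsubst (1 + fps_X) x fs = (\<Sum>j\<le>Suc (length fs). fps_nth (1 + fps_X) j * tpow x j fs)"
    by (rule tsubst_upto[of x, OF assms]) simp
  also have "\<dots> = (\<Sum>j\<in>{0,1}. fps_nth (1 + fps_X) j * tpow x j fs)"
    by (rule sum.mono_neutral_right) auto
  also have "\<dots> = tone fs + x fs" by (simp add: tmul_tone_right)
  finally show ?thesis .
qed

lemma fps_exp_compose_ln: "fps_exp (of_nat m :: 'a::field_char_0) oo fps_ln 1 = (1 + fps_X) ^ m"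
proof -
  have "(fps_exp 1 - 1) oo fps_ln 1 = (fps_X :: 'a fps)"
    unfolding fps_ln_fps_exp_inv[OF one_neq_zero] by (rule fps_inv_fps_exp_compose(2)) simp
  then have "fps_exp 1 oo fps_ln 1 = (1 + fps_X :: 'a fps)"
    by (simp add: fps_compose_sub_distrib algebra_simps)
  then have "(1 + fps_X) ^ m = (fps_exp 1 ^ m oo fps_ln 1 :: 'a fps)"
    by (simp add: fps_compose_power[symmetric])
  then show ?thesis by (simp add: fps_exp_power_mult)
qed

lemma fps_power_nth_below:
  fixes p :: "'a::idom fps"
  assumes "fps_nth p 0 = 0" "j < k"
  shows "fps_nth (p ^ k) j = 0"
  using startsby_zero_power_prefix[OF assms(1)] assms(2) by blast

text \<open>The identity \<open>g^m = exp (m log g)\<close>, obtained by substituting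
  \<open>x = g - 1\<close> into \<open>(1 + X)^m = exp (m ln (1 + X))\<close>. The sum stops at the
  word length because the \<open>k\<close>-th power of \<open>ln (1 + X)\<close> starts in degree
  \<open>k\<close>.\<close>

lemma tpow_eq_exp_tlog:
  fixes g :: "('e::real_vector, real) tseries"
  assumes "g [] = 1"
  shows "tpow g m fs = (\<Sum>k\<le>length fs. real m ^ k / fact k * tpow (tlog g) k fs)"
proof -
  define x where "x = (\<lambda>us. g us - tone us)"
  have x: "x [] = 0" using assms by (simp add: x_def tone_def)
  have log: "tlog g = tsubst (fps_ln 1) x"
  proof
    fix us :: "'e covector list"
    show "tlog g us = tsubst (fps_ln 1) x us"
      unfolding tlog_def tsubst_def x_def[symmetric]
      by (rule sum.mono_neutral_cong_left) (auto simp: fps_ln_nth not_le less_eq_Suc_le[symmetric] uminus_power_if)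
  qed
  have g: "g = tsubst (1 + fps_X) x"
    by (rule ext) (simp add: tsubst_1_plus_X[of x, OF x], simp add: x_def)
  define n where "n = length fs"
  have "tpow g m fs = tsubst (fps_exp (of_nat m) oo fps_ln 1) x fs"
    by (subst g) (simp add: tsubst_power[of x, OF x] fps_exp_compose_ln)
  also have "tsubst (fps_exp (of_nat m) oo fps_ln 1) x fs = (\<Sum>j\<le>n. (\<Sum>k\<le>n. real m ^ k / fact k * fps_nth (fps_ln 1 ^ k) j) * tpow x j fs)"
    unfolding tsubst_def n_def[symmetric] fps_compose_nth
  proof (rule sum.cong[OF refl], rule arg_cong2[where f = "(*)", OF _ refl])
    fix j assume "j \<in> {..n}"
    then show "(\<Sum>k=0..j. fps_nth (fps_exp (of_nat m)) k * fps_nth (fps_ln 1 ^ k) j)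
      = (\<Sum>k\<le>n. real m ^ k / fact k * fps_nth (fps_ln 1 ^ k) j)"
      by (intro sum.mono_neutral_cong_left) (auto simp: fps_power_nth_below)
  qed
  also have "\<dots> = (\<Sum>k\<le>n. real m ^ k / fact k * tsubst (fps_ln 1 ^ k) x fs)"
    unfolding tsubst_def n_def[symmetric] sum_distrib_left sum_distrib_right
    by (subst sum.swap) (simp add: mult.assoc)
  finally show ?thesis by (simp add: tsubst_power[of x, OF x] log n_def)
qed

section \<open>Entire matrix exponentials and rigidity of traces\<close>

text \<open>Once the coefficients below \<open>k\<close> are gone, division by \<open>t^k\<close>
  leaves \<open>c k + O(t)\<close>, which is at most \<open>B t\<close> because
  \<open>k < n\<close>; letting \<open>t\<close> tend to 0 gives \<open>c k = 0\<close>.\<close>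

lemma small_polynomial_coeffs:
  fixes c :: "nat \<Rightarrow> complex"
  assumes "\<And>t::real. 0 < t \<Longrightarrow> t \<le> 1 \<Longrightarrow> norm (\<Sum>k\<le>n. c k * of_real t ^ k) \<le> B * t ^ n"
    and "k < n"
  shows "c k = 0"
  using assms(2)
proof (induction k rule: less_induct)
  case (less k)
  have B: "0 \<le> B" using order_trans[OF norm_ge_zero assms(1)[of 1]] by simp
  define q where "q t = (\<Sum>j\<in>{Suc k..n}. c j * of_real t ^ (j - Suc k))" for t :: real
  have eq: "(\<Sum>j\<le>n. c j * of_real t ^ j) = of_real t ^ k * (c k + of_real t * q t)" for t
  proof -
    have "(\<Sum>j\<le>n. c j * of_real t ^ j) = (\<Sum>j\<in>{k..n}. c j * of_real t ^ j)"
      using less by (intro sum.mono_neutral_right) auto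
    also have "\<dots> = c k * of_real t ^ k + (\<Sum>j\<in>{Suc k..n}. c j * of_real t ^ j)"
      using less.prems by (simp add: sum.atLeast_Suc_atMost)
    also have "(\<Sum>j\<in>{Suc k..n}. c j * of_real t ^ j) = of_real t ^ Suc k * q t"
      unfolding q_def sum_distrib_left
    proof (intro sum.cong refl)
      fix j assume "j \<in> {Suc k..n}"
      then have "(of_real t ^ j :: complex) = of_real t ^ Suc k * of_real t ^ (j - Suc k)"
        using power_add[of "of_real t :: complex" "Suc k" "j - Suc k"] by simp
      then show "c j * of_real t ^ j = of_real t ^ Suc k * (c j * of_real t ^ (j - Suc k))" by simp
    qed
    finally show ?thesis by (simp add: algebra_simps)
  qed
  have bound: "norm (c k + of_real t * q t) \<le> B * t" if t: "0 < t" "t \<le> 1" for t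
  proof -
    have "t ^ k * norm (c k + of_real t * q t) \<le> B * t ^ n"
      using assms(1)[OF t] t by (simp add: eq norm_mult norm_power)
    also have "\<dots> \<le> B * t ^ Suc k"
      using less.prems t B by (intro mult_left_mono power_decreasing) auto
    also have "\<dots> = t ^ k * (B * t)" by simp
    finally show ?thesis using t by (simp add: mult_le_cancel_left)
  qed
  have "((\<lambda>t. norm (c k + of_real t * q t)) \<longlongrightarrow> norm (c k + of_real 0 * q 0)) (at_right 0)"
    unfolding q_def by (intro tendsto_intros)
  moreover have "((\<lambda>t. B * t) \<longlongrightarrow> B * 0) (at_right 0)" by (intro tendsto_intros)
  moreover have "\<forall>\<^sub>F t in at_right 0. norm (c k + of_real t * q t) \<le> B * t"
    using bound by (auto simp: eventually_at_right_field intro!: exI[of _ 1])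
  ultimately have "norm (c k + of_real 0 * q 0) \<le> B * 0"
    by (intro tendsto_le[of "at_right 0"]) auto
  then show ?case by simp
qed

lemma eval_fps_of_nonneg_sums:
  fixes B :: "real fps"
  assumes "fps_conv_radius B = \<infinity>"
  shows "(\<lambda>n. fps_nth B n * r ^ n) sums eval_fps B r"
  using sums_eval_fps[of r B] assms by simp

text \<open>In the applications \<open>P k\<close> is an entry or the trace of \<open>L^k\<close>,
  and \<open>Q\<close> is the same entry or the trace of \<open>exp (t L)\<close>. The majorants
  \<open>B^k\<close> make the double series absolutely summable, with total at most
  \<open>D exp (|t| B(|z|))\<close>, so the order of summation is free; \<open>low\<close> makes
  each coefficient of \<open>Q\<close> a finite sum.\<close>

lemma exponential_series_exchange:
  fixes P :: "nat \<Rightarrow> complex fps" and B :: "real fps" and t z :: complex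
  assumes B: "fps_conv_radius B = \<infinity>" "\<And>n. 0 \<le> fps_nth B n"
    and P: "\<And>k n. norm (fps_nth (P k) n) \<le> D * fps_nth (B ^ k) n"
    and low: "\<And>k n. n < k \<Longrightarrow> fps_nth (P k) n = 0"
  defines "Q \<equiv> Abs_fps (\<lambda>n. \<Sum>k\<le>n. t ^ k / fact k * fps_nth (P k) n)"
  shows "fps_conv_radius Q = \<infinity>"
    and "(\<lambda>k. t ^ k / fact k * eval_fps (P k) z) sums eval_fps Q z"
proof -
  have Bk: "fps_conv_radius (B ^ k) = \<infinity>" for k
    using fps_conv_radius_power[of B k] B(1) by simp
  have Bk0: "0 \<le> fps_nth (B ^ k) n" for k n
  proof (induction k arbitrary: n)
    case (Suc k)
    then show ?case using B(2) by (simp add: fps_mult_nth sum_nonneg)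
  qed simp
  have D: "0 \<le> D" using order_trans[OF norm_ge_zero P[of 0 0]] by simp
  define f where "f z = (\<lambda>(k, n). t ^ k / fact k * fps_nth (P k) n * z ^ n)" for z :: complex
  have abs: "(\<lambda>kn. norm (f z kn)) summable_on UNIV \<times> UNIV" for z
  proof -
    define r where "r = norm z"
    define g where "g = (\<lambda>(k, n). norm t ^ k / fact k * D * (fps_nth (B ^ k) n * r ^ n))"
    have g0: "0 \<le> g kn" for kn
      using Bk0 D by (auto simp: g_def r_def split: prod.splits intro!: mult_nonneg_nonneg)
    have "g summable_on (SIGMA k:UNIV. UNIV)"
    proof (rule summable_on_SigmaI)
      fix k :: nat
      have s: "(\<lambda>n. g (k, n)) sums (norm t ^ k / fact k * D * eval_fps (B ^ k) r)"
        unfolding g_def prod.case by (intro sums_mult eval_fps_of_nonneg_sums Bk)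
      have "summable (\<lambda>n. norm (g (k, n)))" using sums_summable[OF s] g0 by simp
      then show "((\<lambda>n. g (k, n)) has_sum (norm t ^ k / fact k * D * eval_fps (B ^ k) r)) UNIV"
        using s by (rule norm_summable_imp_has_sum)
    next
      have pow: "eval_fps (B ^ k) r = eval_fps B r ^ k" for k
        using eval_fps_power[of r B k] B(1) by simp
      have s: "(\<lambda>k. norm t ^ k / fact k * D * eval_fps (B ^ k) r) sums (exp (norm t * eval_fps B r) * D)"
      proof -
        have "(\<lambda>k. (norm t * eval_fps B r) ^ k /\<^sub>R fact k * D) sums (exp (norm t * eval_fps B r) * D)"
          by (intro sums_mult2 exp_converges)
        then show ?thesis by (simp add: pow power_mult_distrib scaleR_conv_of_real field_simps)
      qed
      have nn: "0 \<le> eval_fps (B ^ k) r" for k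
        using sums_le[OF _ sums_zero eval_fps_of_nonneg_sums[OF Bk, of k r]] Bk0 by (simp add: r_def)
      have "summable (\<lambda>k. norm (norm t ^ k / fact k * D * eval_fps (B ^ k) r))"
        using sums_summable[OF s] nn D by simp
      then show "(\<lambda>k. norm t ^ k / fact k * D * eval_fps (B ^ k) r) summable_on UNIV"
        by (rule has_sum_imp_summable[OF norm_summable_imp_has_sum[OF _ s]])
    qed (use g0 in auto)
    then have "g summable_on UNIV \<times> UNIV" by simp
    then show ?thesis
    proof (rule Infinite_Sum.abs_summable_on_comparison_test')
      fix kn :: "nat \<times> nat"
      obtain k n where kn: "kn = (k, n)" by (cases kn)
      have "norm (f z kn) = norm t ^ k / fact k * norm (fps_nth (P k) n) * r ^ n"
        by (simp add: f_def kn norm_mult norm_divide norm_power r_def)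
      also have "\<dots> \<le> norm t ^ k / fact k * (D * fps_nth (B ^ k) n) * r ^ n"
        using P[of k n] by (intro mult_right_mono mult_left_mono) (auto simp: r_def)
      finally show "norm (f z kn) \<le> g kn" by (simp add: g_def kn mult_ac)
    qed
  qed
  have sm: "f z summable_on UNIV \<times> UNIV" for z using abs[of z] by (rule abs_summable_summable)
  have inner_n: "((\<lambda>k. f z (k, n)) has_sum (fps_nth Q n * z ^ n)) UNIV" for n z
  proof -
    have "((\<lambda>k. f z (k, n)) has_sum (\<Sum>k\<le>n. f z (k, n))) {..n}" by (rule has_sum_finite) simp
    moreover have "(\<Sum>k\<le>n. f z (k, n)) = fps_nth Q n * z ^ n"
      by (simp add: Q_def f_def sum_distrib_right)
    moreover have "((\<lambda>k. f z (k, n)) has_sum fps_nth Q n * z ^ n) {..n} \<longleftrightarrow> ((\<lambda>k. f z (k, n)) has_sum fps_nth Q n * z ^ n) UNIV"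
      by (rule has_sum_cong_neutral) (auto simp: f_def low)
    ultimately show ?thesis by simp
  qed
  have Pk: "fps_conv_radius (P k) = \<infinity>" for k
    unfolding fps_conv_radius_def
  proof (rule conv_radius_inftyI'')
    fix z :: complex
    have "summable (\<lambda>n. D * (fps_nth (B ^ k) n * norm z ^ n))"
      by (intro summable_mult sums_summable[OF eval_fps_of_nonneg_sums] Bk)
    then show "summable (\<lambda>n. fps_nth (P k) n * z ^ n)"
      by (rule summable_comparison_test'[where N = 0])
        (use P in \<open>auto simp: norm_mult norm_power mult.assoc[symmetric] intro!: mult_right_mono\<close>)
  qed
  have inner_k: "((\<lambda>n. f z (k, n)) has_sum (t ^ k / fact k * eval_fps (P k) z)) UNIV" for k z
  proof -
    have s: "(\<lambda>n. f z (k, n)) sums (t ^ k / fact k * eval_fps (P k) z)"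
      unfolding f_def prod.case mult.assoc by (intro sums_mult sums_eval_fps) (simp add: Pk)
    have "(\<lambda>n. f z (k, n)) summable_on UNIV"
      using summable_on_SigmaD1[of "\<lambda>k n. f z (k, n)" UNIV "\<lambda>_. UNIV" k] sm[of z] by simp
    then have h: "((\<lambda>n. f z (k, n)) has_sum infsum (\<lambda>n. f z (k, n)) UNIV) UNIV" by (rule has_sum_infsum)
    show ?thesis using sums_unique2[OF s has_sum_imp_sums[OF h]] h by simp
  qed
  have swap: "((\<lambda>n. fps_nth Q n * z ^ n) has_sum infsum (f z) (UNIV \<times> UNIV)) UNIV" for z
  proof -
    have "((\<lambda>(n, k). f z (k, n)) has_sum infsum (f z) (UNIV \<times> UNIV)) (UNIV \<times> UNIV)"
      using has_sum_infsum[OF sm[of z]] by (subst (asm) has_sum_swap)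
    then show ?thesis
      by (rule has_sum_SigmaD) (use inner_n in auto)
  qed
  have swap': "((\<lambda>k. t ^ k / fact k * eval_fps (P k) z) has_sum infsum (f z) (UNIV \<times> UNIV)) UNIV" for z
    by (rule has_sum_SigmaD[OF has_sum_infsum[OF sm[of z]]]) (use inner_k in auto)
  show cQ: "fps_conv_radius Q = \<infinity>"
    unfolding fps_conv_radius_def
    by (rule conv_radius_inftyI'', rule sums_summable[OF has_sum_imp_sums[OF swap]])
  have "eval_fps Q z = infsum (f z) (UNIV \<times> UNIV)"
    using sums_unique2[OF sums_eval_fps[of z Q] has_sum_imp_sums[OF swap]] cQ by simp
  then show "(\<lambda>k. t ^ k / fact k * eval_fps (P k) z) sums eval_fps Q z"
    using has_sum_imp_sums[OF swap'] by simp
qed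

lemma entire_fps_sum:
  fixes f :: "'i \<Rightarrow> complex fps"
  assumes "\<And>q. q \<in> I \<Longrightarrow> fps_conv_radius (f q) = \<infinity>"
  shows "fps_conv_radius (\<Sum>q\<in>I. f q) = \<infinity>"
    and "eval_fps (\<Sum>q\<in>I. f q) z = (\<Sum>q\<in>I. eval_fps (f q) z)"
proof -
  have "fps_conv_radius (\<Sum>q\<in>I. f q) = \<infinity> \<and> eval_fps (\<Sum>q\<in>I. f q) z = (\<Sum>q\<in>I. eval_fps (f q) z)"
    using assms
  proof (induction I rule: infinite_finite_induct)
    case (insert q I)
    then have *: "fps_conv_radius (f q) = \<infinity>" "fps_conv_radius (sum f I) = \<infinity>" by auto
    then show ?case
      using fps_conv_radius_add[of "f q" "sum f I"] insert by (simp add: eval_fps_add)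
  qed auto
  then show "fps_conv_radius (\<Sum>q\<in>I. f q) = \<infinity>"
    "eval_fps (\<Sum>q\<in>I. f q) z = (\<Sum>q\<in>I. eval_fps (f q) z)" by auto
qed

lemma entire_fps_mult:
  fixes f g :: "complex fps"
  assumes "fps_conv_radius f = \<infinity>" "fps_conv_radius g = \<infinity>"
  shows "fps_conv_radius (f * g) = \<infinity>" "eval_fps (f * g) z = eval_fps f z * eval_fps g z"
  using fps_conv_radius_mult[of f g] assms by (auto simp: eval_fps_mult)

lemma entire_mpow:
  fixes L :: "nat \<Rightarrow> nat \<Rightarrow> complex fps"
  assumes rad: "\<And>i j. i < N \<Longrightarrow> j < N \<Longrightarrow> fps_conv_radius (L i j) = \<infinity>"
    and "i < N" "j < N"
  shows "fps_conv_radius (mpow N L k i j) = \<infinity>"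
    and "eval_fps (mpow N L k i j) z = mpow N (\<lambda>i j. eval_fps (L i j) z) k i j"
proof -
  have "fps_conv_radius (mpow N L k i j) = \<infinity> \<and> eval_fps (mpow N L k i j) z = mpow N (\<lambda>i j. eval_fps (L i j) z) k i j"
    using assms(3)
  proof (induction k arbitrary: j)
    case (Suc k)
    have *: "fps_conv_radius (mpow N L k i q * L q j) = \<infinity>" if "q \<in> {..<N}" for q
      using Suc that by (intro entire_fps_mult(1) rad) auto
    show ?case
      using entire_fps_sum(1)[OF *, of "{..<N}" "\<lambda>q. q"] entire_fps_sum(2)[OF *, of "{..<N}" "\<lambda>q. q" z] Suc rad by (simp add: entire_fps_mult)
  qed auto
  then show "fps_conv_radius (mpow N L k i j) = \<infinity>"
    "eval_fps (mpow N L k i j) z = mpow N (\<lambda>i j. eval_fps (L i j) z) k i j" by auto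
qed

lemma mpow_nth_below:
  fixes L :: "nat \<Rightarrow> nat \<Rightarrow> complex fps"
  assumes L0: "\<And>i j. i < N \<Longrightarrow> j < N \<Longrightarrow> fps_nth (L i j) 0 = 0"
    and "i < N" "j < N" "n < k"
  shows "fps_nth (mpow N L k i j) n = 0"
  using assms(3,4)
proof (induction k arbitrary: j n)
  case (Suc k)
  have "fps_nth (mpow N L k i q) m * fps_nth (L q j) (n - m) = 0" if "q < N" "m \<le> n" for q m
    using Suc.IH[of q m] L0[of q j] that Suc.prems by (cases "m = n") auto
  then show ?case unfolding mpow.simps fps_sum_nth fps_mult_nth by (intro sum.neutral ballI) auto
qed simp

text \<open>Every factor has vanishing constant term, so degree \<open>k\<close> in a product of
  \<open>k\<close> factors can only come from the linear coefficients.\<close>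

lemma mpow_nth_diag:
  fixes L :: "nat \<Rightarrow> nat \<Rightarrow> complex fps"
  assumes L0: "\<And>i j. i < N \<Longrightarrow> j < N \<Longrightarrow> fps_nth (L i j) 0 = 0"
    and "i < N" "j < N"
  shows "fps_nth (mpow N L k i j) k = mpow N (\<lambda>i j. fps_nth (L i j) 1) k i j"
  using assms(3)
proof (induction k arbitrary: j)
  case (Suc k)
  have "fps_nth (mpow N L k i q * L q j) (Suc k) = fps_nth (mpow N L k i q) k * fps_nth (L q j) 1"
    if "q < N" for q
  proof -
    have "fps_nth (mpow N L k i q * L q j) (Suc k)
      = (\<Sum>m\<in>{0..Suc k}. if m = k then fps_nth (mpow N L k i q) k * fps_nth (L q j) 1 else 0)"
      unfolding fps_mult_nth
    proof (intro sum.cong refl)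
      fix m assume "m \<in> {0..Suc k}"
      then consider "m < k" | "m = k" | "m = Suc k" by fastforce
      then show "fps_nth (mpow N L k i q) m * fps_nth (L q j) (Suc k - m)
         = (if m = k then fps_nth (mpow N L k i q) k * fps_nth (L q j) 1 else 0)"
        by cases (use mpow_nth_below[of N L i q m k, OF L0 assms(2) that] L0[OF that Suc.prems] in auto)
    qed
    then show ?thesis by simp
  qed
  then show ?case using Suc by (simp add: fps_sum_nth)
qed simp

text \<open>\<open>B\<close> sums the absolute values of all entries. It dominates every column sum,
  so its powers majorise the matrix powers, and it is entire because there are finitely many
  entries.\<close>

lemma mpow_majorant:
  fixes L :: "nat \<Rightarrow> nat \<Rightarrow> complex fps"
  assumes rad: "\<And>i j. i < N \<Longrightarrow> j < N \<Longrightarrow> fps_conv_radius (L i j) = \<infinity>"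
  obtains B :: "real fps" where "fps_conv_radius B = \<infinity>" "\<And>n. 0 \<le> fps_nth B n"
    "\<And>k n i j. i < N \<Longrightarrow> j < N \<Longrightarrow> norm (fps_nth (mpow N L k i j) n) \<le> fps_nth (B ^ k) n"
proof -
  define B where "B = Abs_fps (\<lambda>n. \<Sum>i<N. \<Sum>j<N. norm (fps_nth (L i j) n))"
  have B0: "0 \<le> fps_nth B n" for n by (simp add: B_def sum_nonneg)
  have Bk0: "0 \<le> fps_nth (B ^ k) n" for k n
  proof (induction k arbitrary: n)
    case (Suc k)
    then show ?case using B0 by (simp add: fps_mult_nth sum_nonneg)
  qed simp
  have col: "(\<Sum>q<N. norm (fps_nth (L q j) n)) \<le> fps_nth B n" if "j < N" for j n
    unfolding B_def fps_nth_Abs_fps using that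
    by (intro sum_mono member_le_sum[where f = "\<lambda>j. norm (fps_nth (L _ j) n)"]) auto
  have bound: "norm (fps_nth (mpow N L k i j) n) \<le> fps_nth (B ^ k) n" if "i < N" "j < N" for i j k n
    using that(2)
  proof (induction k arbitrary: j n)
    case 0
    then show ?case by auto
  next
    case (Suc k)
    have "norm (fps_nth (mpow N L (Suc k) i j) n) = norm (\<Sum>q<N. \<Sum>m=0..n. fps_nth (mpow N L k i q) m * fps_nth (L q j) (n - m))"
      by (simp add: fps_sum_nth fps_mult_nth)
    also have "\<dots> \<le> (\<Sum>q<N. \<Sum>m=0..n. fps_nth (B ^ k) m * norm (fps_nth (L q j) (n - m)))"
      using Suc.IH Bk0
      by (intro order_trans[OF norm_sum sum_mono] order_trans[OF norm_mult_ineq mult_mono]) auto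
    also have "\<dots> = (\<Sum>m=0..n. fps_nth (B ^ k) m * (\<Sum>q<N. norm (fps_nth (L q j) (n - m))))"
      by (subst sum.swap) (simp add: sum_distrib_left)
    also have "\<dots> \<le> (\<Sum>m=0..n. fps_nth (B ^ k) m * fps_nth B (n - m))"
      using col[OF Suc.prems] Bk0 by (intro sum_mono mult_left_mono) auto
    also have "\<dots> = fps_nth (B ^ Suc k) n"
      unfolding power_Suc2 fps_mult_nth ..
    finally show ?case .
  qed
  have "fps_conv_radius B = \<infinity>"
    unfolding fps_conv_radius_def
  proof (rule conv_radius_inftyI'')
    fix z :: real
    have "summable (\<lambda>n. \<Sum>i<N. \<Sum>j<N. norm (fps_nth (L i j) n) * z ^ n)"
    proof (intro summable_sum)
      fix i j assume "i \<in> {..<N}" "j \<in> {..<N}"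
      then have "summable (\<lambda>n. norm (fps_nth (L i j) n * of_real z ^ n))"
        using rad by (intro norm_summable_fps) auto
      then show "summable (\<lambda>n. norm (fps_nth (L i j) n) * z ^ n)"
        by (intro summable_norm_cancel[of "\<lambda>n. norm (fps_nth (L i j) n) * z ^ n"])
           (simp add: norm_mult norm_power abs_mult power_abs)
    qed
    then show "summable (\<lambda>n. fps_nth B n * z ^ n)" by (simp add: B_def sum_distrib_right)
  qed
  then show thesis using B0 bound by (rule that)
qed

lemma mpow_eigenvector:
  fixes A :: "nat \<Rightarrow> nat \<Rightarrow> complex"
  assumes "\<And>i. i < N \<Longrightarrow> (\<Sum>q<N. A i q * u q) = \<mu> * u i" "i < N"
  shows "(\<Sum>q<N. mpow N A k i q * u q) = \<mu> ^ k * u i"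
proof (induction k)
  case 0
  have "(\<Sum>q<N. mpow N A 0 i q * u q) = (\<Sum>q<N. if q = i then u i else 0)" by (intro sum.cong) auto
  then show ?case using assms(2) by simp
next
  case (Suc k)
  have "(\<Sum>q<N. mpow N A (Suc k) i q * u q) = (\<Sum>p<N. mpow N A k i p * (\<Sum>q<N. A p q * u q))"
    by (simp add: sum_distrib_left sum_distrib_right mult.assoc) (rule sum.swap)
  also have "\<dots> = (\<Sum>p<N. \<mu> * (mpow N A k i p * u p))"
    by (intro sum.cong refl) (simp only: lessThan_iff assms(1) mult.left_commute)
  finally show ?case by (simp add: sum_distrib_left[symmetric] Suc)
qed

lemma exponential_coeffs_bound:
  fixes F :: "complex fps"
  assumes F: "\<And>n. norm (fps_nth F n) \<le> K * C ^ n / fact n" and rad: "fps_conv_radius F = \<infinity>"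
  shows "norm (eval_fps F z) \<le> K * exp (C * norm z)"
proof -
  have s: "(\<lambda>n. K * ((C * norm z) ^ n /\<^sub>R fact n)) sums (K * exp (C * norm z))"
    by (intro sums_mult exp_converges)
  have le: "norm (fps_nth F n * z ^ n) \<le> K * ((C * norm z) ^ n /\<^sub>R fact n)" for n
    using mult_right_mono[OF F[of n], of "norm z ^ n"]
    by (simp add: norm_mult norm_power power_mult_distrib divide_inverse mult_ac)
  have "norm (eval_fps F z) \<le> (\<Sum>n. K * ((C * norm z) ^ n /\<^sub>R fact n))"
    unfolding eval_fps_def by (rule norm_suminf_le[OF le sums_summable[OF s]])
  then show ?thesis using sums_unique[OF s] by simp
qed

text \<open>An eigenvector of \<open>L(z)\<close> for \<open>\<mu>\<close> is one of
  \<open>exp (L(z))\<close> for \<open>exp \<mu>\<close>, and the entries of \<open>exp L\<close>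
  are controlled by the assumed decay of their coefficients. In this way a bound on the exponential
  becomes a bound on the spectrum of \<open>L(z)\<close>.\<close>

lemma exp_eigenvalue_bound:
  fixes L :: "nat \<Rightarrow> nat \<Rightarrow> complex fps"
  assumes rad: "\<And>i j. i < N \<Longrightarrow> j < N \<Longrightarrow> fps_conv_radius (L i j) = \<infinity>"
    and L0: "\<And>i j. i < N \<Longrightarrow> j < N \<Longrightarrow> fps_nth (L i j) 0 = 0"
    and F: "\<And>n i j. i < N \<Longrightarrow> j < N \<Longrightarrow>
        norm (\<Sum>k\<le>n. 1 / fact k * fps_nth (mpow N L k i j) n) \<le> K * C ^ n / fact n"
    and u: "\<exists>i<N. u i \<noteq> 0" "\<And>i. i < N \<Longrightarrow> (\<Sum>q<N. eval_fps (L i q) z * u q) = \<mu> * u i"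
  shows "norm (exp \<mu>) \<le> real N * (K * exp (C * norm z))"
proof -
  define A where "A i j = eval_fps (L i j) z" for i j
  obtain B :: "real fps" where B: "fps_conv_radius B = \<infinity>" "\<And>n. 0 \<le> fps_nth B n"
    "\<And>k n i j. i < N \<Longrightarrow> j < N \<Longrightarrow> norm (fps_nth (mpow N L k i j) n) \<le> fps_nth (B ^ k) n"
    using mpow_majorant[of N L] rad by metis
  define F where "F i j = Abs_fps (\<lambda>n. \<Sum>k\<le>n. 1 ^ k / fact k * fps_nth (mpow N L k i j) n)" for i j
  have Fs: "fps_conv_radius (F i j) = \<infinity>" "(\<lambda>k. 1 ^ k / fact k * eval_fps (mpow N L k i j) z) sums eval_fps (F i j) z"
    if "i < N" "j < N" for i j
    unfolding F_def
    by (rule exponential_series_exchange[of B _ 1]; use B that mpow_nth_below[OF L0 that] in simp)+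
  have Fb: "norm (eval_fps (F i j) z) \<le> K * exp (C * norm z)" if "i < N" "j < N" for i j
    by (rule exponential_coeffs_bound[OF _ Fs(1)[OF that]]) (use F[OF that] in \<open>simp add: F_def\<close>)
  have eig: "(\<Sum>q<N. eval_fps (F i q) z * u q) = exp \<mu> * u i" if i: "i < N" for i
  proof -
    have s1: "(\<lambda>k. \<Sum>q<N. 1 ^ k / fact k * eval_fps (mpow N L k i q) z * u q) sums (\<Sum>q<N. eval_fps (F i q) z * u q)"
      by (intro sums_sum sums_mult2 Fs) (use i in auto)
    have "(\<Sum>q<N. 1 ^ k / fact k * eval_fps (mpow N L k i q) z * u q) = \<mu> ^ k /\<^sub>R fact k * u i" for k
    proof -
      have "(\<Sum>q<N. 1 ^ k / fact k * eval_fps (mpow N L k i q) z * u q) = 1 / fact k * (\<Sum>q<N. mpow N A k i q * u q)"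
        unfolding sum_distrib_left
        by (intro sum.cong refl) (use entire_mpow(2)[OF rad i, where k = k and z = z] in \<open>simp add: A_def[abs_def]\<close>)
      also have "(\<Sum>q<N. mpow N A k i q * u q) = \<mu> ^ k * u i"
        by (rule mpow_eigenvector) (use u i in \<open>auto simp: A_def\<close>)
      finally show ?thesis by (simp add: scaleR_conv_of_real divide_inverse mult_ac)
    qed
    then have "(\<lambda>k. \<mu> ^ k /\<^sub>R fact k * u i) sums (\<Sum>q<N. eval_fps (F i q) z * u q)" using s1 by simp
    moreover have "(\<lambda>k. \<mu> ^ k /\<^sub>R fact k * u i) sums (exp \<mu> * u i)"
      by (intro sums_mult2 exp_converges)
    ultimately show ?thesis by (rule sums_unique2)
  qed
  \<comment> \<open>At a component of largest modulus the eigenvalue equation can be divided by that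
    component.\<close>
  obtain i where i: "i < N" "\<And>q. q < N \<Longrightarrow> norm (u q) \<le> norm (u i)"
  proof -
    have "Max ((\<lambda>i. norm (u i)) ` {..<N}) \<in> (\<lambda>i. norm (u i)) ` {..<N}"
      using u(1) by (intro Max_in) auto
    then obtain i where "i < N" "norm (u i) = Max ((\<lambda>i. norm (u i)) ` {..<N})" by auto
    then show thesis by (intro that[of i]) auto
  qed
  have ui: "norm (u i) > 0" using u(1) i(2) by (metis norm_le_zero_iff not_le order.trans)
  have "norm (exp \<mu>) * norm (u i) = norm (\<Sum>q<N. eval_fps (F i q) z * u q)"
    using eig[OF i(1)] by (simp add: norm_mult)
  also have "\<dots> \<le> (\<Sum>q<N. K * exp (C * norm z) * norm (u i))"
  proof (rule order_trans[OF norm_sum sum_mono])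
    fix q assume q: "q \<in> {..<N}"
    have "0 \<le> K * exp (C * norm z)" using order_trans[OF norm_ge_zero Fb[OF i(1) i(1)]] .
    then show "norm (eval_fps (F i q) z * u q) \<le> K * exp (C * norm z) * norm (u i)"
      unfolding norm_mult by (intro mult_mono Fb i) (use q in auto)
  qed
  also have "\<dots> = real N * (K * exp (C * norm z)) * norm (u i)" by simp
  finally show ?thesis using ui by (rule mult_right_le_imp_le)
qed

text \<open>If \<open>exp L\<close> has exponential type then so has \<open>exp (t L)\<close>, with type proportional to \<open>t\<close>, as far as
  eigenvalues are concerned.  Cauchy's estimate on the circle of radius \<open>1/t\<close> bounds the \<open>n\<close>-th
  coefficient of \<open>tr (exp (t L))\<close>, a polynomial in \<open>t\<close> of degree at most \<open>n\<close>, by \<open>O(t^n)\<close>;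
  hence only its leading term can be nonzero.\<close>

theorem trace_power_rigidity:
  fixes L :: "nat \<Rightarrow> nat \<Rightarrow> complex fps"
  assumes rad: "\<And>i j. i < N \<Longrightarrow> j < N \<Longrightarrow> fps_conv_radius (L i j) = \<infinity>"
    and L0: "\<And>i j. i < N \<Longrightarrow> j < N \<Longrightarrow> fps_nth (L i j) 0 = 0"
    and F: "\<And>n i j. i < N \<Longrightarrow> j < N \<Longrightarrow>
        norm (\<Sum>k\<le>n. 1 / fact k * fps_nth (mpow N L k i j) n) \<le> K * C ^ n / fact n"
    and K: "0 \<le> K" and kn: "k < n"
  shows "fps_nth (\<Sum>i<N. mpow N L k i i) n = 0"
proof -
  define P where "P k = (\<Sum>i<N. mpow N L k i i)" for k
  obtain B :: "real fps" where B: "fps_conv_radius B = \<infinity>" "\<And>n. 0 \<le> fps_nth B n"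
    "\<And>k n i j. i < N \<Longrightarrow> j < N \<Longrightarrow> norm (fps_nth (mpow N L k i j) n) \<le> fps_nth (B ^ k) n"
    using mpow_majorant[of N L] rad by metis
  have Pb: "norm (fps_nth (P k) n) \<le> real N * fps_nth (B ^ k) n" for k n
  proof -
    have "norm (fps_nth (P k) n) \<le> (\<Sum>i<N. fps_nth (B ^ k) n)"
      unfolding P_def fps_sum_nth by (rule order_trans[OF norm_sum sum_mono]) (use B(3) in auto)
    then show ?thesis by simp
  qed
  have Plow: "fps_nth (P k) n = 0" if "n < k" for k n
    unfolding P_def fps_sum_nth using mpow_nth_below[OF L0] that by (intro sum.neutral) auto
  \<comment> \<open>At least 1, so that \<open>ln M\<close> is nonnegative and
    \<open>t * ln M\<close> is at most \<open>ln M\<close> for \<open>t \<le> 1\<close>.\<close>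
  define M where "M = max 1 (real N * K)"
  define c where "c k = 1 / fact k * fps_nth (P k) n" for k
  have "c k = 0"
  proof (rule small_polynomial_coeffs[OF _ kn])
    fix t :: real assume t: "0 < t" "t \<le> 1"
    \<comment> \<open>The power series of \<open>tr (exp (t L(z)))\<close> in \<open>z\<close>; its
      coefficient of degree \<open>n\<close> is the polynomial in \<open>t\<close> with coefficients
      \<open>c k\<close>.\<close>
    define Q where "Q = Abs_fps (\<lambda>n. \<Sum>k\<le>n. of_real t ^ k / fact k * fps_nth (P k) n)"
    have Q: "fps_conv_radius Q = \<infinity>"
      unfolding Q_def by (rule exponential_series_exchange(1)[OF B(1,2) Pb Plow])
    have Qs: "(\<lambda>k. of_real t ^ k / fact k * eval_fps (P k) z) sums eval_fps Q z" for z
      unfolding Q_def by (rule exponential_series_exchange(2)[OF B(1,2) Pb Plow])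
    have bound: "norm (eval_fps Q z) \<le> real N * (M * exp C)" if z: "norm z = 1 / t" for z
    proof -
      obtain \<mu> where \<mu>: "\<And>k. (\<Sum>i<N. mpow N (\<lambda>i j. eval_fps (L i j) z) k i i) = (\<Sum>j<N. \<mu> j ^ k)"
        "\<And>j. j < N \<Longrightarrow> \<exists>u. (\<exists>i<N. u i \<noteq> 0) \<and> (\<forall>i<N. (\<Sum>q<N. eval_fps (L i q) z * u q) = \<mu> j * u i)"
        by (rule eigenvalue_list[of N "\<lambda>i j. eval_fps (L i j) z"]) (rule that)
      have Pz: "eval_fps (P k) z = (\<Sum>j<N. \<mu> j ^ k)" for k
      proof -
        have "eval_fps (P k) z = (\<Sum>i<N. eval_fps (mpow N L k i i) z)"
          unfolding P_def by (rule entire_fps_sum(2)) (rule entire_mpow(1)[OF rad], auto)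
        also have "\<dots> = (\<Sum>i<N. mpow N (\<lambda>i j. eval_fps (L i j) z) k i i)"
          by (rule sum.cong[OF refl]) (rule entire_mpow(2)[OF rad], auto)
        finally show ?thesis by (simp only: \<mu>(1))
      qed
      have "(\<lambda>k. \<Sum>j<N. (of_real t * \<mu> j) ^ k /\<^sub>R fact k) sums (\<Sum>j<N. exp (of_real t * \<mu> j))"
        by (intro sums_sum exp_converges)
      moreover have "(\<Sum>j<N. (of_real t * \<mu> j) ^ k /\<^sub>R fact k) = of_real t ^ k / fact k * eval_fps (P k) z" for k
        unfolding Pz sum_distrib_left
        by (intro sum.cong refl) (simp add: power_mult_distrib scaleR_conv_of_real divide_inverse)
      ultimately have "eval_fps Q z = (\<Sum>j<N. exp (of_real t * \<mu> j))"
        using sums_unique2[OF Qs] by simp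
      also have "norm \<dots> \<le> (\<Sum>j<N. M * exp C)"
      proof (rule order_trans[OF norm_sum sum_mono])
        fix j assume j: "j \<in> {..<N}"
        then obtain u where u: "\<exists>i<N. u i \<noteq> 0" "\<And>i. i < N \<Longrightarrow> (\<Sum>q<N. eval_fps (L i q) z * u q) = \<mu> j * u i"
          using \<mu>(2)[of j] by auto
        have "norm (exp (\<mu> j)) \<le> real N * (K * exp (C * norm z))"
          by (rule exp_eigenvalue_bound[OF rad L0 F u])
        also have "\<dots> \<le> M * exp (C * norm z)" by (simp add: M_def mult.assoc[symmetric])
        also have "\<dots> = exp (ln M + C * norm z)" by (simp add: M_def exp_add)
        finally have "Re (\<mu> j) \<le> ln M + C * norm z" by simp
        \<comment> \<open>On the circle \<open>norm z = 1 / t\<close> the factor \<open>t\<close>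
          exactly compensates the growth \<open>C * norm z\<close>, which leaves a bound independent
          of \<open>t\<close>.\<close>
        then have "t * Re (\<mu> j) \<le> t * (ln M + C * norm z)" using t by (intro mult_left_mono) auto
        also have "\<dots> = t * ln M + C" using t z by (simp add: algebra_simps)
        also have "\<dots> \<le> ln M + C"
          using t mult_right_mono[of t 1 "ln M"] by (simp add: M_def)
        finally have "t * Re (\<mu> j) \<le> ln M + C" .
        then have "exp (t * Re (\<mu> j)) \<le> exp (ln M + C)" by simp
        also have "\<dots> = M * exp C" by (simp add: M_def exp_add)
        finally show "norm (exp (of_real t * \<mu> j)) \<le> M * exp C" by simp
      qed
      finally show ?thesis by simp
    qed
    have "norm ((deriv ^^ n) (eval_fps Q) 0) \<le> fact n * (real N * (M * exp C)) / (1 / t) ^ n"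
    proof (rule Cauchy_inequality)
      show "eval_fps Q holomorphic_on ball 0 (1 / t)" "continuous_on (cball 0 (1 / t)) (eval_fps Q)"
        by (rule holomorphic_on_eval_fps, simp add: Q) (rule continuous_on_subset[OF continuous_on_eval_fps], simp add: Q)
      show "norm (eval_fps Q x) \<le> real N * (M * exp C)" if "norm (0 - x) = 1 / t" for x
        by (rule bound) (use that in simp)
    qed (use t in simp)
    moreover have "fps_nth Q n = (deriv ^^ n) (eval_fps Q) 0 / fact n"
      by (rule fps_nth_fps_expansion[OF eval_fps_has_fps_expansion]) (simp add: Q)
    ultimately have "fact n * norm (fps_nth Q n) \<le> fact n * (real N * (M * exp C)) / (1 / t) ^ n"
      by (simp add: norm_divide)
    also have "\<dots> = fact n * (real N * (M * exp C) * t ^ n)" by (simp add: power_one_over)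
    finally have "fact n * norm (fps_nth Q n) \<le> fact n * (real N * (M * exp C) * t ^ n)" .
    then have "norm (fps_nth Q n) \<le> real N * (M * exp C) * t ^ n" by simp
    moreover have "fps_nth Q n = (\<Sum>k\<le>n. c k * of_real t ^ k)"
      by (simp add: Q_def c_def mult_ac)
    ultimately show "norm (\<Sum>k\<le>n. c k * of_real t ^ k) \<le> real N * (M * exp C) * t ^ n" by simp
  qed
  then show ?thesis by (simp add: c_def P_def)
qed


section \<open>Matrix developments of tensor series\<close>

text \<open>Encodes the linear map that sends \<open>y\<close> to the sum of the matrices
  \<open>M a\<close> with weights \<open>fe a (y)\<close>. Since tensors are multilinear forms, its
  extension to tensors only evaluates them on words in the \<open>fe a\<close>.\<close>

locale letters =
  fixes N d :: nat and fe :: "nat \<Rightarrow> 'e::real_vector covector" and M :: "nat \<Rightarrow> nat \<Rightarrow> nat \<Rightarrow> complex"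
begin

text \<open>\<open>ev n t\<close> is the image of the degree \<open>n\<close> component of \<open>t\<close> under the algebra homomorphism that sends the
  letter dual to \<open>fe a\<close> to the matrix \<open>M a\<close>.\<close>

primrec ev :: "nat \<Rightarrow> ('e, complex) tseries \<Rightarrow> nat \<Rightarrow> nat \<Rightarrow> complex" where
  "ev 0 t = (\<lambda>i j. if i = j then t [] else 0)"
| "ev (Suc n) t = (\<lambda>i j. \<Sum>a<d. \<Sum>q<N. ev n (\<lambda>us. t (us @ [fe a])) i q * M a q j)"

lemma ev_add: "ev n (\<lambda>us. s us + t us) i j = ev n s i j + ev n t i j"
  by (induction n arbitrary: s t j) (auto simp: sum.distrib algebra_simps)

lemma ev_cmult: "ev n (\<lambda>us. c * t us) i j = c * ev n t i j"
  by (induction n arbitrary: t j) (auto simp: sum_distrib_left mult.assoc)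

lemma ev_sum: "ev n (\<lambda>us. \<Sum>x\<in>I. t x us) i j = (\<Sum>x\<in>I. ev n (t x) i j)"
proof (induction I rule: infinite_finite_induct)
  case (infinite I)
  then show ?case using ev_cmult[of n 0 "\<lambda>_. 0" i j] by simp
next
  case empty
  then show ?case using ev_cmult[of n 0 "\<lambda>_. 0" i j] by simp
qed (simp_all add: ev_add)

lemma ev_cong: "(\<And>us. length us = n \<Longrightarrow> s us = t us) \<Longrightarrow> ev n s i j = ev n t i j"
proof (induction n arbitrary: s t j)
  case (Suc n)
  have "ev n (\<lambda>us. s (us @ [fe a])) i q = ev n (\<lambda>us. t (us @ [fe a])) i q" for a q
    by (rule Suc.IH) (simp add: Suc.prems)
  then show ?case by simp
qed simp

definition letter_bound :: real where
  "letter_bound = (\<Sum>a<d. \<Sum>q<N. \<Sum>j<N. norm (M a q j))"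

lemma letter_bound_nonneg: "0 \<le> letter_bound"
  unfolding letter_bound_def by (intro sum_nonneg) auto

lemma ev_bound:
  assumes "0 \<le> c" "\<And>us. length us = n \<Longrightarrow> set us \<subseteq> fe ` {..<d} \<Longrightarrow> norm (t us) \<le> c" and "j < N"
  shows "norm (ev n t i j) \<le> c * letter_bound ^ n"
  using assms(2,3)
proof (induction n arbitrary: t j)
  case 0
  then show ?case using assms(1) by auto
next
  case (Suc n)
  have IH: "norm (ev n (\<lambda>us. t (us @ [fe a])) i q) \<le> c * letter_bound ^ n" if "a < d" "q < N" for a q
    by (rule Suc.IH) (use Suc.prems that in auto)
  have "norm (ev (Suc n) t i j) \<le> (\<Sum>a<d. \<Sum>q<N. c * letter_bound ^ n * norm (M a q j))"
    unfolding ev.simps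
    by (intro order_trans[OF norm_sum sum_mono] order_trans[OF norm_mult_ineq mult_right_mono] IH) auto
  also have "\<dots> \<le> (\<Sum>a<d. \<Sum>q<N. c * letter_bound ^ n * (\<Sum>j<N. norm (M a q j)))"
    using Suc.prems(2) assms(1) letter_bound_nonneg
    by (intro sum_mono mult_left_mono member_le_sum[where f = "\<lambda>j. norm (M _ _ j)"]) auto
  also have "\<dots> = c * letter_bound ^ Suc n"
    by (simp add: sum_distrib_left[symmetric] letter_bound_def[symmetric])
  finally show ?case .
qed

text \<open>Multiplicativity of the development, split by degree: the last letter belongs to
  \<open>t\<close>, except in the term where the whole word is taken by \<open>s\<close>.\<close>

lemma ev_tmul:
  assumes "i < N" "j < N"
  shows "ev n (tmul s t) i j = (\<Sum>k\<le>n. \<Sum>q<N. ev k s i q * ev (n - k) t q j)"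
  using assms(2)
proof (induction n arbitrary: t j)
  case 0
  have "(\<Sum>q<N. ev 0 s i q * ev 0 t q j) = (\<Sum>q<N. if q = i then s [] * (if i = j then t [] else 0) else 0)"
    by (intro sum.cong) auto
  then show ?case using assms by (simp add: tmul_Nil)
next
  case (Suc n)
  have "ev (Suc n) (tmul s t) i j
      = (\<Sum>a<d. \<Sum>p<N. (ev n (tmul s (\<lambda>us. t (us @ [fe a]))) i p + t [] * ev n (\<lambda>us. s (us @ [fe a])) i p) * M a p j)"
    by (simp add: tmul_snoc ev_add ev_cmult[symmetric] mult.commute)
  also have "\<dots> = (\<Sum>a<d. \<Sum>p<N. ev n (tmul s (\<lambda>us. t (us @ [fe a]))) i p * M a p j) + ev (Suc n) s i j * t []"
    by (simp add: algebra_simps sum.distrib sum_distrib_left)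
  also have "(\<Sum>a<d. \<Sum>p<N. ev n (tmul s (\<lambda>us. t (us @ [fe a]))) i p * M a p j)
      = (\<Sum>a<d. \<Sum>p<N. \<Sum>k\<le>n. \<Sum>q<N. ev k s i q * ev (n - k) (\<lambda>us. t (us @ [fe a])) q p * M a p j)"
    using Suc.IH by (simp add: sum_distrib_right)
  also have "\<dots> = (\<Sum>k\<le>n. \<Sum>q<N. \<Sum>a<d. \<Sum>p<N. ev k s i q * ev (n - k) (\<lambda>us. t (us @ [fe a])) q p * M a p j)"
  proof -
    define X where "X a p k q = ev k s i q * ev (n - k) (\<lambda>us. t (us @ [fe a])) q p * M a p j" for a p k q
    have "(\<Sum>a<d. \<Sum>p<N. \<Sum>k\<le>n. \<Sum>q<N. X a p k q) = (\<Sum>a<d. \<Sum>k\<le>n. \<Sum>p<N. \<Sum>q<N. X a p k q)"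
      by (rule sum.cong[OF refl], rule sum.swap)
    also have "\<dots> = (\<Sum>k\<le>n. \<Sum>a<d. \<Sum>p<N. \<Sum>q<N. X a p k q)" by (rule sum.swap)
    also have "\<dots> = (\<Sum>k\<le>n. \<Sum>a<d. \<Sum>q<N. \<Sum>p<N. X a p k q)"
      by (rule sum.cong[OF refl], rule sum.cong[OF refl], rule sum.swap)
    also have "\<dots> = (\<Sum>k\<le>n. \<Sum>q<N. \<Sum>a<d. \<Sum>p<N. X a p k q)"
      by (rule sum.cong[OF refl], rule sum.swap)
    finally show ?thesis by (simp only: X_def)
  qed
  also have "\<dots> = (\<Sum>k\<le>n. \<Sum>q<N. ev k s i q * ev (Suc n - k) t q j)"
    by (intro sum.cong refl) (simp add: Suc_diff_le sum_distrib_left mult.assoc)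
  also have "ev (Suc n) s i j * t [] = (\<Sum>q<N. ev (Suc n) s i q * ev 0 t q j)"
  proof -
    have "(\<Sum>q<N. ev (Suc n) s i q * ev 0 t q j) = (\<Sum>q<N. if q = j then ev (Suc n) s i j * t [] else 0)"
      by (intro sum.cong) auto
    then show ?thesis using Suc.prems by simp
  qed
  finally show ?case by simp
qed

text \<open>The series variable is the scaling factor \<open>z\<close> of the matrices, so this is
  the development under \<open>z A\<close> as a power series in \<open>z\<close>.\<close>

definition evs :: "('e, complex) tseries \<Rightarrow> nat \<Rightarrow> nat \<Rightarrow> complex fps" where
  "evs t i j = Abs_fps (\<lambda>n. ev n t i j)"

lemma evs_nth [simp]: "fps_nth (evs t i j) n = ev n t i j"
  by (simp add: evs_def)

lemma evs_tmul:
  assumes "i < N" "j < N"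
  shows "evs (tmul s t) i j = (\<Sum>q<N. evs s i q * evs t q j)"
  by (rule fps_ext) (simp add: ev_tmul[OF assms] fps_sum_nth fps_mult_nth atLeast0AtMost, rule sum.swap)

lemma evs_tpow:
  assumes "i < N" "j < N"
  shows "evs (tpow t k) i j = mpow N (evs t) k i j"
  using assms(2)
proof (induction k arbitrary: j)
  case 0
  have "ev n tone i j = fps_nth (if i = j then 1 else 0) n" for n
  proof (cases n)
    case (Suc k)
    have "(\<lambda>us. tone (us @ [fe a])) = (\<lambda>us. 0 * tone us :: complex)" for a by (simp add: tone_def fun_eq_iff)
    then show ?thesis using Suc by (simp only: ev.simps ev_cmult) simp
  qed (simp add: tone_def)
  then show ?case by (simp add: fps_eq_iff)
next
  case (Suc k)
  then show ?case using assms(1) by (simp add: tpow_Suc_right evs_tmul del: tpow.simps)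
qed

end

lemma of_real_tpow:
  "(\<lambda>fs. of_real (tpow t k fs)) = (tpow (\<lambda>fs. of_real (t fs)) k :: ('e::real_vector, complex) tseries)"
proof (induction k)
  case 0
  then show ?case by (simp add: tone_def fun_eq_iff)
next
  case (Suc k)
  have "(\<lambda>fs. complex_of_real (tmul t (tpow t k) fs)) = tmul (\<lambda>fs. of_real (t fs)) (\<lambda>fs. of_real (tpow t k fs))"
    by (simp add: tmul_def fun_eq_iff)
  then show ?case using Suc by simp
qed

lemma tlog_Nil: "tlog g [] = 0"
  by (simp add: tlog_def)

lemma tlog_singleton: "g [] = 1 \<Longrightarrow> tlog g [f] = g [f]"
  by (simp add: tlog_def tmul_tone_right tone_def)

context letters
begin

text \<open>With \<open>L\<close> the image of \<open>tlog g\<close>, the image of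
  \<open>g^m\<close> is the sum of \<open>m^k / k! L^k\<close>. By rigidity the trace of
  \<open>L^k\<close> lives in degree \<open>k\<close> alone, where it only sees the degree 1 part of
  \<open>L\<close>, which is that of \<open>g\<close>.\<close>

lemma trace_tpow:
  fixes g :: "('e, real) tseries"
  assumes g: "g [] = 1"
    and rad: "\<And>i j. i < N \<Longrightarrow> j < N \<Longrightarrow> fps_conv_radius (evs (\<lambda>us. of_real (tlog g us)) i j) = \<infinity>"
    and bound: "\<And>n i j. i < N \<Longrightarrow> j < N \<Longrightarrow> norm (ev n (\<lambda>us. of_real (g us)) i j) \<le> K * C ^ n / fact n"
    and K: "0 \<le> K"
  shows "(\<Sum>i<N. ev n (\<lambda>us. of_real (tpow g m us)) i i)
    = of_nat m ^ n / fact n * (\<Sum>i<N. mpow N (\<lambda>i j. \<Sum>a<d. of_real (g [fe a]) * M a i j) n i i)"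
proof -
  define L where "L = evs (\<lambda>us. of_real (tlog g us))"
  have L0: "fps_nth (L i j) 0 = 0" for i j by (simp add: L_def tlog_Nil)
  have L1: "fps_nth (L i j) 1 = (\<Sum>a<d. of_real (g [fe a]) * M a i j)" if "i < N" for i j
  proof -
    have "fps_nth (L i j) 1 = (\<Sum>a<d. \<Sum>q<N. if q = i then of_real (g [fe a]) * M a i j else 0)"
      unfolding L_def evs_nth One_nat_def ev.simps
      by (intro sum.cong refl) (auto simp: tlog_singleton[of g, OF g])
    then show ?thesis using that by simp
  qed
  have exp: "ev n (\<lambda>us. of_real (tpow g m us)) i j = (\<Sum>k\<le>n. of_nat m ^ k / fact k * fps_nth (mpow N L k i j) n)"
    if "i < N" "j < N" for n m i j
  proof -
    have "ev n (\<lambda>us. of_real (tpow g m us)) i j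
        = ev n (\<lambda>us. \<Sum>k\<le>n. of_nat m ^ k / fact k * of_real (tpow (tlog g) k us)) i j"
      by (rule ev_cong) (simp add: tpow_eq_exp_tlog[of g, OF g])
    also have "\<dots> = (\<Sum>k\<le>n. of_nat m ^ k / fact k * ev n (\<lambda>us. of_real (tpow (tlog g) k us)) i j)"
      by (simp only: ev_sum ev_cmult)
    also have "\<dots> = (\<Sum>k\<le>n. of_nat m ^ k / fact k * fps_nth (mpow N L k i j) n)"
      unfolding of_real_tpow L_def evs_tpow[OF that, symmetric] by simp
    finally show ?thesis .
  qed
  \<comment> \<open>The case \<open>m = 1\<close> turns the assumed growth of the development of
    \<open>g\<close> into the growth hypothesis on \<open>exp L\<close>; the rigidity obtained from
    it is used for arbitrary \<open>m\<close>.\<close>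
  have F: "norm (\<Sum>k\<le>n. 1 / fact k * fps_nth (mpow N L k i j) n) \<le> K * C ^ n / fact n"
    if "i < N" "j < N" for i j n
    using exp[OF that, of n 1] bound[OF that, of n] by (simp add: tmul_tone_right)
  have rig: "fps_nth (\<Sum>i<N. mpow N L k i i) n = 0" if "k < n" for k n
    by (rule trace_power_rigidity[OF _ _ F K that]) (use rad L0 in \<open>auto simp: L_def\<close>)
  have "(\<Sum>i<N. ev n (\<lambda>us. of_real (tpow g m us)) i i)
      = (\<Sum>k\<le>n. of_nat m ^ k / fact k * fps_nth (\<Sum>i<N. mpow N L k i i) n)"
    by (simp add: exp fps_sum_nth sum_distrib_left) (rule sum.swap)
  also have "\<dots> = (\<Sum>k\<in>{n}. of_nat m ^ k / fact k * fps_nth (\<Sum>i<N. mpow N L k i i) n)"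
    using rig by (intro sum.mono_neutral_right) auto
  also have "\<dots> = of_nat m ^ n / fact n * (\<Sum>i<N. mpow N (\<lambda>i j. fps_nth (L i j) 1) n i i)"
    using mpow_nth_diag[of N L] L0 by (simp add: fps_sum_nth)
  also have "(\<Sum>i<N. mpow N (\<lambda>i j. fps_nth (L i j) 1) n i i)
      = (\<Sum>i<N. mpow N (\<lambda>i j. \<Sum>a<d. of_real (g [fe a]) * M a i j) n i i)"
  proof (intro sum.cong refl)
    fix i assume "i \<in> {..<N}"
    then have "mpow N (\<lambda>i j. fps_nth (L i j) 1) n i j = mpow N (\<lambda>i j. \<Sum>a<d. of_real (g [fe a]) * M a i j) n i j" for j
      by (induction n arbitrary: j) (simp, simp only: mpow.simps, intro sum.cong refl, simp only: L1 lessThan_iff)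
    then show "mpow N (\<lambda>i j. fps_nth (L i j) 1) n i i = mpow N (\<lambda>i j. \<Sum>a<d. of_real (g [fe a]) * M a i j) n i i" .
  qed
  finally show ?thesis .
qed

end


section \<open>The radius of convergence over a finite-dimensional space\<close>

lemma dual_functionals:
  fixes B :: "'v::real_vector set"
  assumes B: "finite B" "independent B"
  obtains g :: "'v \<Rightarrow> 'v \<Rightarrow> real" where "\<And>\<beta>. \<beta> \<in> B \<Longrightarrow> linear (g \<beta>)"
    "\<And>x. x \<in> span B \<Longrightarrow> x = (\<Sum>\<beta>\<in>B. g \<beta> x *\<^sub>R \<beta>)"
proof -
  have "\<forall>\<beta>\<in>B. \<exists>h. linear (h :: 'v \<Rightarrow> real) \<and> (\<forall>x\<in>B. h x = (if x = \<beta> then 1 else 0))"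
  proof
    fix \<beta>
    show "\<exists>h. linear (h :: 'v \<Rightarrow> real) \<and> (\<forall>x\<in>B. h x = (if x = \<beta> then 1 else 0))"
      using linear_independent_extend[OF B(2), of "\<lambda>x. if x = \<beta> then 1 else 0"] by simp
  qed
  from bchoice[OF this] obtain g where g: "\<forall>\<beta>\<in>B. linear (g \<beta> :: 'v \<Rightarrow> real) \<and> (\<forall>x\<in>B. g \<beta> x = (if x = \<beta> then 1 else 0))"
    by auto
  have rep: "x = (\<Sum>\<beta>\<in>B. g \<beta> x *\<^sub>R \<beta>)" if "x \<in> span B" for x
  proof -
    have "(\<lambda>x. x) x = (\<lambda>x. \<Sum>\<beta>\<in>B. g \<beta> x *\<^sub>R \<beta>) x"
    proof (rule linear_eq_on_span[OF _ _ _ that])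
      show "linear (\<lambda>x. \<Sum>\<beta>\<in>B. g \<beta> x *\<^sub>R \<beta>)"
      proof (intro linear_compose_sum ballI)
        fix \<beta> assume "\<beta> \<in> B"
        then have l: "linear (g \<beta>)" using g by auto
        show "linear (\<lambda>x. g \<beta> x *\<^sub>R \<beta>)"
          by (rule linearI) (simp_all add: linear_add[OF l] linear_cmul[OF l] scaleR_add_left)
      qed
      fix x assume x: "x \<in> B"
      have "(\<Sum>\<beta>\<in>B. g \<beta> x *\<^sub>R \<beta>) = (\<Sum>\<beta>\<in>B. if \<beta> = x then x else 0)"
        by (intro sum.cong refl) (use g x in auto)
      then show "x = (\<Sum>\<beta>\<in>B. g \<beta> x *\<^sub>R \<beta>)" using x B(1) by simp
    qed (rule linear_id[unfolded id_def])
    then show ?thesis by simp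
  qed
  show thesis
  proof (rule that[of g])
    show "linear (g \<beta>)" if "\<beta> \<in> B" for \<beta> using g that by auto
  qed (rule rep)
qed

text \<open>The norm is arbitrary, so boundedness comes by induction over a basis. If
  \<open>b\<close> were a limit of points of \<open>span B\<close>, their coordinates would be
  Cauchy by the induction hypothesis and the limit would lie in the span. Hence \<open>b\<close> has
  a positive distance \<open>d\<close> from it, and this bounds the coefficient of
  \<open>b\<close>.\<close>

lemma finite_dim_functional_bounded_on_span:
  fixes B :: "'v::real_normed_vector set"
  assumes "finite B" "independent B" "linear (f :: 'v \<Rightarrow> real)"
  shows "\<exists>k\<ge>0. \<forall>x\<in>span B. \<bar>f x\<bar> \<le> k * norm x"
  using assms
proof (induction B arbitrary: f rule: finite_induct)
  case empty
  then show ?case by (intro exI[of _ 0]) (auto simp: linear_0)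
next
  case (insert b B)
  have indB: "independent B" and bB: "b \<notin> span B"
    using insert.prems(1) insert.hyps by (auto simp: independent_insert)
  have "\<exists>d>0. \<forall>y\<in>span B. d \<le> norm (b - y)"
  proof (rule ccontr)
    assume neg: "\<not> ?thesis"
    have "\<exists>y\<in>span B. norm (b - y) < 1 / real (Suc n)" for n
      using neg by (auto simp: not_le dest!: spec[of _ "1 / real (Suc n)"])
    then obtain y where y: "\<And>n. y n \<in> span B" "\<And>n. norm (b - y n) < 1 / real (Suc n)" by metis
    have lim: "y \<longlonglongrightarrow> b"
    proof (rule metric_LIMSEQ_I)
      fix r :: real assume "r > 0"
      then obtain n0 where n0: "1 / real (Suc n0) < r" using reals_Archimedean[of r] by (auto simp: inverse_eq_divide)
      have "dist (y n) b < r" if "n \<ge> n0" for n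
      proof -
        have "1 / real (Suc n) \<le> 1 / real (Suc n0)" using that by (simp add: frac_le)
        then show ?thesis using y(2)[of n] n0 unfolding dist_norm norm_minus_commute[of "y n" b] by linarith
      qed
      then show "\<exists>n0. \<forall>n\<ge>n0. dist (y n) b < r" by auto
    qed
    obtain g :: "'v \<Rightarrow> 'v \<Rightarrow> real" where g: "\<And>\<beta>. \<beta> \<in> B \<Longrightarrow> linear (g \<beta>)"
      and rep: "\<And>x. x \<in> span B \<Longrightarrow> x = (\<Sum>\<beta>\<in>B. g \<beta> x *\<^sub>R \<beta>)"
      by (rule dual_functionals[OF insert.hyps(1) indB]) (rule that)
    have conv: "convergent (\<lambda>n. g \<beta> (y n))" if \<beta>: "\<beta> \<in> B" for \<beta>
    proof -
      obtain k where k: "k \<ge> 0" "\<And>x. x \<in> span B \<Longrightarrow> \<bar>g \<beta> x\<bar> \<le> k * norm x"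
        using insert.IH[OF indB g[OF \<beta>]] by auto
      have cy: "Cauchy y" using lim by (rule LIMSEQ_imp_Cauchy)
      have "Cauchy (\<lambda>n. g \<beta> (y n))"
      proof (rule CauchyI)
        fix e :: real assume "e > 0"
        then have "e / (k + 1) > 0" using k by auto
        then obtain M where M: "\<And>m n. m \<ge> M \<Longrightarrow> n \<ge> M \<Longrightarrow> norm (y m - y n) < e / (k + 1)"
          using CauchyD[OF cy, of "e / (k + 1)"] by auto
        have "norm (g \<beta> (y m) - g \<beta> (y n)) < e" if "m \<ge> M" "n \<ge> M" for m n
        proof -
          have "norm (g \<beta> (y m) - g \<beta> (y n)) = \<bar>g \<beta> (y m - y n)\<bar>" by (simp add: linear_diff[OF g[OF \<beta>]])
          also have "\<dots> \<le> k * norm (y m - y n)" using k(2) y(1) by (simp add: span_diff)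
          also have "\<dots> \<le> (k + 1) * norm (y m - y n)" by (simp add: mult_right_mono)
          also have "\<dots> < (k + 1) * (e / (k + 1))" using M[OF that] k(1) by (intro mult_strict_left_mono) auto
          also have "\<dots> = e" using k(1) by simp
          finally show ?thesis .
        qed
        then show "\<exists>M. \<forall>m\<ge>M. \<forall>n\<ge>M. norm (g \<beta> (y m) - g \<beta> (y n)) < e" by auto
      qed
      then show ?thesis by (simp add: Cauchy_convergent_iff)
    qed
    have "(\<lambda>n. \<Sum>\<beta>\<in>B. g \<beta> (y n) *\<^sub>R \<beta>) \<longlonglongrightarrow> (\<Sum>\<beta>\<in>B. lim (\<lambda>n. g \<beta> (y n)) *\<^sub>R \<beta>)"
      by (intro tendsto_sum tendsto_scaleR tendsto_const convergent_LIMSEQ_iff[THEN iffD1] conv)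
    then have "y \<longlonglongrightarrow> (\<Sum>\<beta>\<in>B. lim (\<lambda>n. g \<beta> (y n)) *\<^sub>R \<beta>)"
      by (simp only: rep[OF y(1), symmetric])
    then have "b = (\<Sum>\<beta>\<in>B. lim (\<lambda>n. g \<beta> (y n)) *\<^sub>R \<beta>)" by (rule LIMSEQ_unique[OF lim])
    also have "\<dots> \<in> span B" by (intro span_sum span_scale span_base)
    finally show False using bB by simp
  qed
  then obtain d where d: "d > 0" "\<And>y. y \<in> span B \<Longrightarrow> d \<le> norm (b - y)" by auto
  obtain k where k: "k \<ge> 0" "\<And>x. x \<in> span B \<Longrightarrow> \<bar>f x\<bar> \<le> k * norm x"
    using insert.IH[OF indB insert.prems(2)] by auto
  \<comment> \<open>For \<open>x = c b + y\<close> with \<open>y\<close> in the span,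
    \<open>|c| \<le> norm x / d\<close> and
    \<open>norm y \<le> norm x (1 + norm b / d)\<close>.\<close>
  define K where "K = \<bar>f b\<bar> / d + k * (1 + norm b / d)"
  have "\<bar>f x\<bar> \<le> K * norm x" if xs: "x \<in> span (insert b B)" for x
  proof -
    obtain c where c: "x - c *\<^sub>R b \<in> span B" using span_breakdown_eq[of x b B] xs by auto
    define y where "y = x - c *\<^sub>R b"
    have cd: "\<bar>c\<bar> * d \<le> norm x"
    proof (cases "c = 0")
      case False
      have "- (1 / c) *\<^sub>R y \<in> span B" using c unfolding y_def by (rule span_scale)
      then have "d \<le> norm (b - - (1 / c) *\<^sub>R y)" by (rule d(2))
      also have "b - - (1 / c) *\<^sub>R y = (1 / c) *\<^sub>R x" using False by (simp add: y_def algebra_simps)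
      finally show ?thesis using False by (simp add: field_simps)
    qed simp
    then have cb: "\<bar>c\<bar> \<le> norm x / d" using d(1) by (simp add: field_simps)
    have "norm y \<le> norm x + \<bar>c\<bar> * norm b"
      unfolding y_def using norm_triangle_ineq4[of x "c *\<^sub>R b"] by simp
    also have "\<dots> \<le> norm x + norm x / d * norm b" using cb by (intro add_left_mono mult_right_mono) auto
    finally have yb: "norm y \<le> norm x + norm x / d * norm b" .
    have "f x = c * f b + f y"
      unfolding y_def by (simp add: linear_diff[OF insert.prems(2)] linear_cmul[OF insert.prems(2)])
    then have "\<bar>f x\<bar> \<le> \<bar>c\<bar> * \<bar>f b\<bar> + \<bar>f y\<bar>" by (metis abs_mult abs_triangle_ineq)
    also have "\<dots> \<le> norm x / d * \<bar>f b\<bar> + k * (norm x + norm x / d * norm b)"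
    proof (rule add_mono)
      show "\<bar>c\<bar> * \<bar>f b\<bar> \<le> norm x / d * \<bar>f b\<bar>" using cb by (intro mult_right_mono) auto
      have "\<bar>f y\<bar> \<le> k * norm y" using k(2) c by (simp add: y_def)
      also have "\<dots> \<le> k * (norm x + norm x / d * norm b)" using yb k(1) by (rule mult_left_mono)
      finally show "\<bar>f y\<bar> \<le> k * (norm x + norm x / d * norm b)" .
    qed
    also have "\<dots> = K * norm x" by (simp add: K_def algebra_simps)
    finally show ?thesis .
  qed
  moreover have "K \<ge> 0" using k d by (simp add: K_def)
  ultimately show ?case by auto
qed

section \<open>Dual bases and multilinear forms\<close>

text \<open>\<open>covector\<close> consists of all linear functionals; the last clause is what
  relates them to the norm.\<close>

locale dual_basis =
  fixes B :: "'v::real_normed_vector set" and cb :: "'v \<Rightarrow> 'v covector"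
  assumes finite_B: "finite B"
    and expansion: "\<And>x :: 'v. x = (\<Sum>\<beta>\<in>B. cov (cb \<beta>) x *\<^sub>R \<beta>)"
    and functional_bounded: "\<And>f :: 'v covector. \<exists>k\<ge>0. \<forall>x. \<bar>cov f x\<bar> \<le> k * norm x"

lemma cov_Abs_covector: "linear f \<Longrightarrow> cov (Abs_covector f) = f"
  by (rule Abs_covector_inverse) simp

lemma dual_basis_exists:
  assumes "\<exists>B :: 'v::real_normed_vector set. finite B \<and> span B = UNIV"
  obtains B cb where "dual_basis (B :: 'v set) cb"
proof -
  obtain S :: "'v set" where S: "finite S" "span S = UNIV" using assms by blast
  obtain B where B: "B \<subseteq> S" "independent B" "S \<subseteq> span B"
    by (rule maximal_independent_subset[of S]) (rule that)
  have fB: "finite B" using B(1) S(1) by (rule finite_subset)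
  have sB: "span B = UNIV" using span_minimal[OF B(3) subspace_span] S(2) by auto
  obtain g :: "'v \<Rightarrow> 'v \<Rightarrow> real" where g: "\<And>\<beta>. \<beta> \<in> B \<Longrightarrow> linear (g \<beta>)"
    and rep: "\<And>x. x \<in> span B \<Longrightarrow> x = (\<Sum>\<beta>\<in>B. g \<beta> x *\<^sub>R \<beta>)"
    by (rule dual_functionals[OF fB B(2)]) (rule that)
  define cb where "cb \<beta> = Abs_covector (g \<beta>)" for \<beta>
  have rep: "x = (\<Sum>\<beta>\<in>B. cov (cb \<beta>) x *\<^sub>R \<beta>)" for x
  proof -
    have "(\<Sum>\<beta>\<in>B. cov (cb \<beta>) x *\<^sub>R \<beta>) = (\<Sum>\<beta>\<in>B. g \<beta> x *\<^sub>R \<beta>)"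
      by (intro sum.cong refl) (simp add: cb_def cov_Abs_covector g)
    also have "\<dots> = x" by (rule rep[symmetric]) (simp add: sB)
    finally show ?thesis by (rule sym)
  qed
  have "dual_basis B cb"
  proof
    show "finite B" by (rule fB)
    show "x = (\<Sum>\<beta>\<in>B. cov (cb \<beta>) x *\<^sub>R \<beta>)" for x by (rule rep)
    show "\<exists>k\<ge>0. \<forall>x. \<bar>cov f x\<bar> \<le> k * norm x" for f :: "'v covector"
      using finite_dim_functional_bounded_on_span[OF fB B(2) linear_cov, of f] sB by simp
  qed
  then show thesis by (rule that)
qed

context dual_basis
begin

lemma cov_expansion: "cov f x = (\<Sum>\<beta>\<in>B. cov f \<beta> * cov (cb \<beta>) x)"
proof -
  have "cov f x = cov f (\<Sum>\<beta>\<in>B. cov (cb \<beta>) x *\<^sub>R \<beta>)" by (rule arg_cong[OF expansion])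
  then show ?thesis by (simp add: cov_simps mult.commute)
qed

text \<open>A function on words of functionals is a tensor only if it is linear in each slot;
  expansion in the dual basis expresses this without vector space operations on
  \<open>covector\<close>.\<close>

definition multilinear :: "('v covector list \<Rightarrow> real) \<Rightarrow> bool" where
  "multilinear t \<longleftrightarrow> (\<forall>us f vs. t (us @ f # vs) = (\<Sum>\<beta>\<in>B. cov f \<beta> * t (us @ cb \<beta> # vs)))"

lemma multilinearD:
  assumes "multilinear t"
  shows "t (us @ f # vs) = (\<Sum>\<beta>\<in>B. cov f \<beta> * t (us @ cb \<beta> # vs))"
  by (rule assms[unfolded multilinear_def, rule_format])

lemma multilinearD_Nil:
  assumes "multilinear t"
  shows "t (f # vs) = (\<Sum>\<beta>\<in>B. cov f \<beta> * t (cb \<beta> # vs))"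
  using multilinearD[OF assms, of "[]" f vs] by (simp only: append_Nil)

lemma multilinearI:
  "(\<And>us f vs. t (us @ f # vs) = (\<Sum>\<beta>\<in>B. cov f \<beta> * t (us @ cb \<beta> # vs))) \<Longrightarrow> multilinear t"
  unfolding multilinear_def by (intro allI)

lemma multilinear_Cons:
  assumes "multilinear t"
  shows "multilinear (\<lambda>us. t (u # us))"
proof (rule multilinearI)
  fix us f vs
  show "t (u # us @ f # vs) = (\<Sum>\<beta>\<in>B. cov f \<beta> * t (u # us @ cb \<beta> # vs))"
    using multilinearD[OF assms, of "u # us" f vs] by (simp only: append_Cons)
qed

lemma multilinear_tmul:
  assumes "multilinear s" "multilinear t"
  shows "multilinear (tmul s t)"
proof -
  have "tmul s t (us @ f # vs) = (\<Sum>\<beta>\<in>B. cov f \<beta> * tmul s t (us @ cb \<beta> # vs))"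
    if "multilinear s" for us f vs s
    using that
  proof (induction us arbitrary: s)
    case Nil
    have "tmul (\<lambda>ws. s (f # ws)) t vs = tmul (\<lambda>ws. \<Sum>\<beta>\<in>B. cov f \<beta> * s (cb \<beta> # ws)) t vs"
      by (simp only: multilinearD_Nil[OF Nil, of f])
    also have "\<dots> = (\<Sum>\<beta>\<in>B. cov f \<beta> * tmul (\<lambda>ws. s (cb \<beta> # ws)) t vs)"
      by (simp only: tmul_sum_left tmul_cmult_left)
    moreover have "s [] * t (f # vs) = (\<Sum>\<beta>\<in>B. cov f \<beta> * (s [] * t (cb \<beta> # vs)))"
      by (subst multilinearD_Nil[OF assms(2)]) (simp only: sum_distrib_left mult.left_commute)
    ultimately show ?case
      by (simp only: append_Nil tmul_Cons distrib_left sum.distrib)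
  next
    case (Cons u us)
    have "s [] * t (u # us @ f # vs) = (\<Sum>\<beta>\<in>B. cov f \<beta> * (s [] * t (u # us @ cb \<beta> # vs)))"
      using multilinearD[OF assms(2), of "u # us" f vs]
      by (simp only: append_Cons sum_distrib_left mult.left_commute)
    then show ?case
      using Cons.IH[OF multilinear_Cons[OF Cons.prems]]
      by (simp only: append_Cons tmul_Cons distrib_left sum.distrib)
  qed
  then show ?thesis using assms(1) by (intro multilinearI)
qed

lemma multilinear_tone: "multilinear tone"
  by (simp add: multilinear_def tone_def)

lemma multilinear_tpow: "multilinear t \<Longrightarrow> multilinear (tpow t k)"
  by (induction k) (auto intro: multilinear_tone multilinear_tmul)

lemma multilinear_tlog:
  assumes "multilinear g"
  shows "multilinear (tlog g)"
proof -
  have "multilinear (\<lambda>us. g us - tone us)"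
  proof (rule multilinearI)
    fix us f vs
    have t0: "tone (us @ h # vs) = 0" for h :: "'v covector" by (simp add: tone_def)
    show "g (us @ f # vs) - tone (us @ f # vs) = (\<Sum>\<beta>\<in>B. cov f \<beta> * (g (us @ cb \<beta> # vs) - tone (us @ cb \<beta> # vs)))"
      unfolding t0 diff_0_right by (rule multilinearD[OF assms])
  qed
  then have p: "tpow (\<lambda>us. g us - tone us) k (us @ f # vs)
      = (\<Sum>\<beta>\<in>B. cov f \<beta> * tpow (\<lambda>us. g us - tone us) k (us @ cb \<beta> # vs))" for k us f vs
    by (rule multilinearD[OF multilinear_tpow])
  show ?thesis
  proof (rule multilinearI)
    fix us f vs
    define c where "c k = (- 1) ^ (k + 1) / real k" for k
    define P where "P h k = tpow (\<lambda>us. g us - tone us) k (us @ h # vs)" for h k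
    define L where "L = length us + Suc (length vs)"
    have "tlog g (us @ f # vs) = (\<Sum>k=1..L. c k * P f k)"
      by (simp add: tlog_def c_def P_def L_def)
    also have "\<dots> = (\<Sum>k=1..L. \<Sum>\<beta>\<in>B. cov f \<beta> * (c k * P (cb \<beta>) k))"
    proof (rule sum.cong[OF refl])
      fix k
      show "c k * P f k = (\<Sum>\<beta>\<in>B. cov f \<beta> * (c k * P (cb \<beta>) k))"
        unfolding P_def by (subst p) (simp only: sum_distrib_left mult.left_commute)
    qed
    also have "\<dots> = (\<Sum>\<beta>\<in>B. cov f \<beta> * (\<Sum>k=1..L. c k * P (cb \<beta>) k))"
      unfolding sum_distrib_left by (rule sum.swap)
    also have "\<dots> = (\<Sum>\<beta>\<in>B. cov f \<beta> * tlog g (us @ cb \<beta> # vs))"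
      by (simp add: tlog_def c_def P_def L_def)
    finally show "tlog g (us @ f # vs) = (\<Sum>\<beta>\<in>B. cov f \<beta> * tlog g (us @ cb \<beta> # vs))" .
  qed
qed

text \<open>The integral is linear in the integrator, which handles the expanded letter, and linear
  in the integrand, which carries the expansion through the letters integrated after it.\<close>

lemma multilinear_path_sig:
  assumes "tame_on T \<eta>"
  shows "multilinear (path_sig T \<eta>)"
proof -
  obtain V where V: "control V T" "control.tame V T \<eta>" using assms unfolding tame_on_def by blast
  interpret control V T by fact
  have main: "iter_int \<eta> (us @ f # vs) t = (\<Sum>\<beta>\<in>B. cov f \<beta> * iter_int \<eta> (us @ cb \<beta> # vs) t)"
    if "0 \<le> t" "t \<le> T" for us f vs t
    using that
  proof (induction us arbitrary: t)
    case Nil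
    have "dint (\<lambda>t. \<Sum>\<beta>\<in>B. cov f \<beta> * iter_int \<eta> (cb \<beta> # vs) t) (iter_int \<eta> vs) (\<lambda>t. \<Sum>\<beta>\<in>B. cov f \<beta> * cov (cb \<beta>) (\<eta> t))"
      by (intro dint_sum_right dint_cmult_right iter_int_vlip_dint(2) V(2))
    then have "dint (\<lambda>t. \<Sum>\<beta>\<in>B. cov f \<beta> * iter_int \<eta> (cb \<beta> # vs) t) (iter_int \<eta> vs) (\<lambda>t. cov f (\<eta> t))"
      by (simp only: cov_expansion[symmetric])
    from dint_unique[OF iter_int_vlip_dint(2)[OF V(2)] this _ Nil]
    show ?case using iter_int_vlip_dint(3)[OF V(2)] by (simp del: iter_int.simps)
  next
    case (Cons u us)
    have "dint (\<lambda>t. \<Sum>\<beta>\<in>B. cov f \<beta> * iter_int \<eta> (u # us @ cb \<beta> # vs) t)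
       (\<lambda>t. \<Sum>\<beta>\<in>B. cov f \<beta> * iter_int \<eta> (us @ cb \<beta> # vs) t) (\<lambda>t. cov u (\<eta> t))"
      by (intro dint_sum_left dint_cmult_left iter_int_vlip_dint(2) V(2))
    then have "dint (\<lambda>t. \<Sum>\<beta>\<in>B. cov f \<beta> * iter_int \<eta> (u # us @ cb \<beta> # vs) t)
       (iter_int \<eta> (us @ f # vs)) (\<lambda>t. cov u (\<eta> t))"
      by (rule dint_cong[where k = 0]) (use Cons.IH in auto)
    from dint_unique[OF iter_int_vlip_dint(2)[OF V(2)] this _ Cons.prems]
    show ?case using iter_int_vlip_dint(3)[OF V(2)] by (simp del: iter_int.simps)
  qed
  show ?thesis
  proof (intro multilinearI)
    fix us f vs
    show "path_sig T \<eta> (us @ f # vs) = (\<Sum>\<beta>\<in>B. cov f \<beta> * path_sig T \<eta> (us @ cb \<beta> # vs))"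
      using main[OF T_nonneg order_refl, of "rev vs" f "rev us"]
      by (simp only: path_sig_def rev_append rev.simps append_assoc append_Cons append_Nil)
  qed
qed

lemma elem_tensor_Cons: "elem_tensor (z # zs) (f # fs) = ccov f z * elem_tensor zs fs"
  by (simp add: elem_tensor_def)

lemma sum_list_B: 
  obtains bs where "set bs = B" "\<And>h :: 'v \<Rightarrow> complex. sum_list (map h bs) = (\<Sum>\<beta>\<in>B. h \<beta>)"
proof -
  obtain bs where "set bs = B" "distinct bs" using finite_distinct_list[OF finite_B] by auto
  then show thesis by (intro that[of bs]) (auto simp: sum_list_distinct_conv_sum_set)
qed

text \<open>Ensures that the infimum in \<open>proj_norm\<close> runs over a nonempty set. Degrees
  start at 1, as an empty product of vectors leaves no room for a scalar.\<close>

lemma elementary_tensor_representation: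
  assumes "multilinear t"
  shows "\<exists>zss. (\<forall>zs\<in>set zss. length zs = Suc n) \<and>
    (\<forall>fs. length fs = Suc n \<longrightarrow> complex_of_real (t fs) = (\<Sum>zs\<leftarrow>zss. elem_tensor zs fs))"
  using assms
proof (induction n arbitrary: t)
  case 0
  obtain bs where bs: "set bs = B" "\<And>h :: 'v \<Rightarrow> complex. sum_list (map h bs) = (\<Sum>\<beta>\<in>B. h \<beta>)"
    by (rule sum_list_B) (rule that)
  have t1: "t [f] = (\<Sum>\<beta>\<in>B. cov f \<beta> * t [cb \<beta>])" for f
    by (rule multilinearD_Nil[OF 0])
  have e: "elem_tensor [(c *\<^sub>R \<beta>, 0)] [f] = complex_of_real (cov f \<beta> * c)" for c \<beta> and f :: "'v covector"
    by (simp add: elem_tensor_def ccov_def cov_simps complex_eq_iff)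
  show ?case
  proof (intro exI conjI allI impI)
    show "\<forall>zs\<in>set (map (\<lambda>\<beta>. [(t [cb \<beta>] *\<^sub>R \<beta>, 0)]) bs). length zs = Suc 0" by simp
    fix fs :: "'v covector list" assume "length fs = Suc 0"
    then obtain f where f: "fs = [f]" by (auto simp: length_Suc_conv)
    have "complex_of_real (t fs) = of_real (\<Sum>\<beta>\<in>B. cov f \<beta> * t [cb \<beta>])"
      unfolding f by (rule arg_cong[OF t1])
    also have "\<dots> = (\<Sum>\<beta>\<in>B. of_real (cov f \<beta> * t [cb \<beta>]))" by (rule of_real_sum)
    also have "\<dots> = (\<Sum>zs\<leftarrow>map (\<lambda>\<beta>. [(t [cb \<beta>] *\<^sub>R \<beta>, 0)]) bs. elem_tensor zs fs)"
      by (simp only: f map_map comp_def bs(2) e)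
    finally show "complex_of_real (t fs) = (\<Sum>zs\<leftarrow>map (\<lambda>\<beta>. [(t [cb \<beta>] *\<^sub>R \<beta>, 0)]) bs. elem_tensor zs fs)" .
  qed
next
  case (Suc n)
  obtain bs where bs: "set bs = B" "\<And>h :: 'v \<Rightarrow> complex. sum_list (map h bs) = (\<Sum>\<beta>\<in>B. h \<beta>)"
    by (rule sum_list_B) (rule that)
  have "\<exists>zss. (\<forall>zs\<in>set zss. length zs = Suc n) \<and>
    (\<forall>fs. length fs = Suc n \<longrightarrow> complex_of_real (t (cb \<beta> # fs)) = (\<Sum>zs\<leftarrow>zss. elem_tensor zs fs))" for \<beta>
    by (rule Suc.IH[OF multilinear_Cons[OF Suc.prems]])
  then obtain zss where zss: "\<And>\<beta> zs. zs \<in> set (zss \<beta>) \<Longrightarrow> length zs = Suc n"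
    "\<And>\<beta> fs. length fs = Suc n \<Longrightarrow> complex_of_real (t (cb \<beta> # fs)) = (\<Sum>zs\<leftarrow>zss \<beta>. elem_tensor zs fs)"
    by metis
  define Z where "Z = concat (map (\<lambda>\<beta>. map ((#) (\<beta>, 0)) (zss \<beta>)) bs)"
  have "complex_of_real (t fs) = (\<Sum>zs\<leftarrow>Z. elem_tensor zs fs)" if fs: "length fs = Suc (Suc n)" for fs
  proof -
    obtain f gs where f: "fs = f # gs" "length gs = Suc n" using fs by (cases fs) auto
    have "t fs = (\<Sum>\<beta>\<in>B. cov f \<beta> * t (cb \<beta> # gs))"
      unfolding f by (rule multilinearD_Nil[OF Suc.prems])
    then have "complex_of_real (t fs) = (\<Sum>\<beta>\<in>B. of_real (cov f \<beta>) * (\<Sum>zs\<leftarrow>zss \<beta>. elem_tensor zs gs))"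
      using zss(2)[OF f(2)] by simp
    also have "\<dots> = (\<Sum>\<beta>\<in>B. \<Sum>zs\<leftarrow>map ((#) (\<beta>, 0)) (zss \<beta>). elem_tensor zs fs)"
      by (intro sum.cong refl)
         (simp add: f comp_def elem_tensor_Cons ccov_def cov_simps sum_list_const_mult complex_of_real_def)
    also have "\<dots> = (\<Sum>zs\<leftarrow>Z. elem_tensor zs fs)"
      unfolding Z_def bs(2)[symmetric] by (induction bs) auto
    finally show ?thesis .
  qed
  moreover have "length zs = Suc (Suc n)" if "zs \<in> set Z" for zs
    using that zss(1) by (auto simp: Z_def)
  ultimately show ?case by blast
qed

section \<open>Coefficient estimates from the projective norm\<close>

text \<open>After division by \<open>k\<close> the functional competes in the supremum that defines
  \<open>cplx_norm\<close>; that supremum is finite, being at most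
  \<open>norm (fst z) + norm (snd z)\<close>.\<close>

lemma ccov_le_cplx_norm:
  fixes f :: "'v covector" and z :: "'v cplx"
  assumes k: "k > 0" "\<And>x. \<bar>cov f x\<bar> \<le> k * norm x"
  shows "cmod (ccov f z) \<le> k * cplx_norm z"
proof -
  define g where "g = Abs_covector (\<lambda>x. (1 / k) *\<^sub>R cov f x)"
  have g: "cov g = (\<lambda>x. (1 / k) *\<^sub>R cov f x)"
    unfolding g_def by (intro cov_Abs_covector linear_compose_scale_right linear_cov)
  have og: "onorm (cov g) \<le> 1"
    by (rule onorm_bound) (use k in \<open>auto simp: g field_simps\<close>)
  have bdd: "bdd_above ((\<lambda>f. cmod (ccov f z)) ` {f. onorm (cov f) \<le> 1})"
  proof (rule bdd_aboveI2)
    fix h :: "'v covector" assume h: "h \<in> {f. onorm (cov f) \<le> 1}"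
    obtain K where "\<And>x. \<bar>cov h x\<bar> \<le> K * norm x" using functional_bounded by blast
    then have "bounded_linear (cov h)"
      by (intro bounded_linear_intro[of _ K]) (auto simp: cov_simps mult.commute)
    then have *: "\<bar>cov h x\<bar> \<le> norm x" for x
      using onorm[of "cov h" x] mult_right_mono[of "onorm (cov h)" 1 "norm x"] h by simp
    show "cmod (ccov h z) \<le> norm (fst z) + norm (snd z)"
      using cmod_le[of "ccov h z"] *[of "fst z"] *[of "snd z"] by (simp add: ccov_def)
  qed
  have "cmod (ccov g z) \<le> cplx_norm z"
    unfolding cplx_norm_def by (rule cSUP_upper[OF _ bdd]) (use og in simp)
  moreover have "ccov g z = of_real (1 / k) * ccov f z"
    by (simp add: ccov_def g complex_eq_iff)
  ultimately show ?thesis using k(1) by (simp add: norm_mult norm_divide field_simps)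
qed

lemma elem_tensor_bound:
  fixes fs :: "'v covector list"
  assumes "k > 0" "\<And>f x. f \<in> set fs \<Longrightarrow> \<bar>cov f x\<bar> \<le> k * norm x" "length fs = length zs"
  shows "cmod (elem_tensor zs fs) \<le> k ^ length zs * (\<Prod>z\<leftarrow>zs. cplx_norm z)"
  using assms(3,2)
proof (induction fs zs rule: list_induct2)
  case Nil
  then show ?case by (simp add: elem_tensor_def)
next
  case (Cons f fs z zs)
  have "cmod (elem_tensor (z # zs) (f # fs)) = cmod (ccov f z) * cmod (elem_tensor zs fs)"
    by (simp add: elem_tensor_Cons norm_mult)
  also have "\<dots> \<le> (k * cplx_norm z) * (k ^ length zs * (\<Prod>z\<leftarrow>zs. cplx_norm z))"
  proof (rule mult_mono)
    show c: "cmod (ccov f z) \<le> k * cplx_norm z"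
      by (rule ccov_le_cplx_norm[OF assms(1)]) (use Cons.prems in auto)
    show "cmod (elem_tensor zs fs) \<le> k ^ length zs * (\<Prod>z\<leftarrow>zs. cplx_norm z)"
      by (rule Cons.IH) (use Cons.prems in auto)
    show "0 \<le> k * cplx_norm z" using order_trans[OF norm_ge_zero c] .
  qed simp
  finally show ?case by (simp add: mult_ac)
qed

text \<open>Infinite radius says that the \<open>n\<close>-th roots of the projective norms have
  upper limit 0, so eventually some representation by elementary tensors costs less than
  \<open>e^n\<close>. Evaluating it on functionals of size \<open>k\<close> multiplies the cost by
  at most \<open>k^n\<close>.\<close>

lemma tradius_infinite_bound:
  fixes t :: "('v, real) tseries"
  assumes "multilinear t" "tradius t = \<infinity>" and e: "e > 0" and k: "k > 0"
  shows "\<forall>\<^sub>F n in sequentially. \<forall>fs. length fs = n \<longrightarrow> (\<forall>f\<in>set fs. \<forall>x. \<bar>cov f x\<bar> \<le> k * norm x)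
    \<longrightarrow> \<bar>t fs\<bar> \<le> (k * e) ^ n"
proof -
  have "limsup (\<lambda>n. ereal (root n (proj_norm n (\<lambda>fs. complex_of_real (t fs))))) < ereal e"
  proof -
    have "x = 0" if "inverse x = \<infinity>" for x :: ereal
      using that by (cases x) (auto split: if_splits)
    then show ?thesis using assms(2) e unfolding tradius_def by simp
  qed
  then have "\<forall>\<^sub>F n in sequentially. ereal (root n (proj_norm n (\<lambda>fs. complex_of_real (t fs)))) < ereal e"
    by (rule Limsup_lessD)
  then show ?thesis using eventually_gt_at_top[of 0]
  proof eventually_elim
    case (elim n)
    then have pn: "proj_norm n (\<lambda>fs. complex_of_real (t fs)) < e ^ n"
    proof -
      have "root n (proj_norm n (\<lambda>fs. complex_of_real (t fs))) < root n (e ^ n)"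
        using elim e by (simp add: real_root_power_cancel)
      then show ?thesis using elim by (simp only: real_root_less_iff)
    qed
    define X where "X = {(\<Sum>zs\<leftarrow>zss. \<Prod>z\<leftarrow>zs. cplx_norm z) | zss.
      (\<forall>zs\<in>set zss. length zs = n) \<and>
      (\<forall>fs. length fs = n \<longrightarrow> complex_of_real (t fs) = (\<Sum>zs\<leftarrow>zss. elem_tensor zs fs))}"
    have "X \<noteq> {}"
      using elementary_tensor_representation[OF assms(1), of "n - 1"] elim by (auto simp: X_def)
    then have "\<exists>x\<in>X. x < e ^ n" using pn unfolding proj_norm_def X_def[symmetric] by (rule cInf_lessD)
    then obtain zss where zss: "\<And>zs. zs \<in> set zss \<Longrightarrow> length zs = n"
      "\<And>fs. length fs = n \<Longrightarrow> complex_of_real (t fs) = (\<Sum>zs\<leftarrow>zss. elem_tensor zs fs)"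
      "(\<Sum>zs\<leftarrow>zss. \<Prod>z\<leftarrow>zs. cplx_norm z) < e ^ n"
      by (auto simp: X_def)
    show ?case
    proof (intro allI impI)
      fix fs :: "'v covector list" assume fs: "length fs = n" "\<forall>f\<in>set fs. \<forall>x. \<bar>cov f x\<bar> \<le> k * norm x"
      have "\<bar>t fs\<bar> = cmod (complex_of_real (t fs))" by simp
      also have "\<dots> = cmod (\<Sum>zs\<leftarrow>zss. elem_tensor zs fs)" by (simp only: zss(2)[OF fs(1)])
      also have "\<dots> \<le> (\<Sum>zs\<leftarrow>zss. k ^ n * (\<Prod>z\<leftarrow>zs. cplx_norm z))"
        using zss(1)
      proof (induction zss)
        case (Cons zs zss)
        have "cmod (elem_tensor zs fs) \<le> k ^ length zs * (\<Prod>z\<leftarrow>zs. cplx_norm z)"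
          by (rule elem_tensor_bound) (use k fs Cons.prems in auto)
        then show ?case
          using Cons by (auto intro!: order_trans[OF norm_triangle_ineq] add_mono)
      qed simp
      also have "\<dots> = k ^ n * (\<Sum>zs\<leftarrow>zss. \<Prod>z\<leftarrow>zs. cplx_norm z)" by (simp add: sum_list_const_mult)
      also have "\<dots> \<le> k ^ n * e ^ n" using zss(3) k by (intro mult_left_mono) auto
      finally show "\<bar>t fs\<bar> \<le> (k * e) ^ n" by (simp add: power_mult_distrib)
    qed
  qed
qed

end


section \<open>Unitary developments of paths\<close>

context control
begin

text \<open>The majorant makes the tail uniformly small relative to \<open>dV\<close>, and the
  finite head is a sum of negligible terms.\<close>

lemma negl_suminf:
  fixes \<Phi> :: "nat \<Rightarrow> real \<Rightarrow> real \<Rightarrow> 'a::banach"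
  assumes \<Phi>: "\<And>n. negl (\<Phi> n)" and b: "summable b"
    and bound: "\<And>n c c'. 0 \<le> c \<Longrightarrow> c \<le> c' \<Longrightarrow> c' \<le> T \<Longrightarrow> norm (\<Phi> n c c') \<le> b n * (V c' - V c)"
  shows "negl (\<lambda>c c'. \<Sum>n. \<Phi> n c c')"
proof (rule neglI)
  fix e :: real assume "e > 0"
  then obtain K where K: "norm (\<Sum>i. b (i + K)) < e / 2"
    using suminf_exist_split[OF _ b, of "e / 2"] by auto
  have "negl (\<lambda>c c'. \<Sum>n<K. \<Phi> n c c')" by (rule negl_sum) (rule \<Phi>)
  then obtain d where d: "d > 0" "\<And>c c'. 0 \<le> c \<Longrightarrow> c \<le> c' \<Longrightarrow> c' \<le> T \<Longrightarrow> c' - c < d \<Longrightarrow>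
      norm (\<Sum>n<K. \<Phi> n c c') \<le> e / 2 * (V c' - V c)"
    by (rule neglD[where e = "e / 2"]) (use \<open>e > 0\<close> in simp, rule that)
  have "norm (\<Sum>n. \<Phi> n c c') \<le> e * (V c' - V c)" if c: "0 \<le> c" "c \<le> c'" "c' \<le> T" "c' - c < d" for c c'
  proof -
    have sb: "summable (\<lambda>n. b n * (V c' - V c))" using b by (rule summable_mult2)
    have s: "summable (\<lambda>n. \<Phi> n c c')"
      by (rule summable_comparison_test'[OF sb, of 0]) (rule bound[OF c(1-3)])
    have "(\<Sum>n. \<Phi> n c c') = (\<Sum>n. \<Phi> (n + K) c c') + (\<Sum>n<K. \<Phi> n c c')"
      by (rule suminf_split_initial_segment[OF s])
    moreover have "norm (\<Sum>n. \<Phi> (n + K) c c') \<le> (\<Sum>n. b (n + K) * (V c' - V c))"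
      by (rule norm_suminf_le[OF bound[OF c(1-3)]]) (use summable_ignore_initial_segment[OF sb, of K] in simp)
    moreover have "(\<Sum>n. b (n + K) * (V c' - V c)) = (\<Sum>n. b (n + K)) * (V c' - V c)"
      using suminf_mult2[OF summable_ignore_initial_segment[OF b, of K]] by simp
    moreover have "(\<Sum>n. b (n + K)) * (V c' - V c) \<le> e / 2 * (V c' - V c)"
      using K V_le[OF c(1-3)] by (intro mult_right_mono) auto
    ultimately have tail: "norm (\<Sum>n. \<Phi> (n + K) c c') \<le> e / 2 * (V c' - V c)"
      and split: "(\<Sum>n. \<Phi> n c c') = (\<Sum>n. \<Phi> (n + K) c c') + (\<Sum>n<K. \<Phi> n c c')" by auto
    have "norm (\<Sum>n. \<Phi> n c c') \<le> e / 2 * (V c' - V c) + e / 2 * (V c' - V c)"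
      unfolding split by (rule order_trans[OF norm_triangle_ineq add_mono[OF tail d(2)[OF c]]])
    then show ?thesis by (simp add: algebra_simps)
  qed
  then show "\<exists>d>0. \<forall>c c'. 0 \<le> c \<and> c \<le> c' \<and> c' \<le> T \<and> c' - c < d \<longrightarrow> norm (\<Sum>n. \<Phi> n c c') \<le> e * (V c' - V c)"
    using d(1) by auto
qed

end

locale development = control V T + letters N d fe M
  for V :: "real \<Rightarrow> real" and T :: real and N d :: nat
    and fe :: "nat \<Rightarrow> 'e::real_vector covector" and M :: "nat \<Rightarrow> nat \<Rightarrow> nat \<Rightarrow> complex" +
  fixes \<beta> :: "real \<Rightarrow> 'e"
  assumes tame: "tame \<beta>"
begin

lemma letters_lipschitz:
  obtains k where "k \<ge> 0"
    "\<And>a c c'. a < d \<Longrightarrow> 0 \<le> c \<Longrightarrow> c \<le> c' \<Longrightarrow> c' \<le> T \<Longrightarrow> \<bar>cov (fe a) (\<beta> c') - cov (fe a) (\<beta> c)\<bar> \<le> k * (V c' - V c)"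
proof -
  have "\<forall>a. \<exists>k\<ge>0. \<forall>c c'. 0 \<le> c \<and> c \<le> c' \<and> c' \<le> T \<longrightarrow> \<bar>cov (fe a) (\<beta> c') - cov (fe a) (\<beta> c)\<bar> \<le> k * (V c' - V c)"
    using tame unfolding tame_def vlip_def by simp
  from choice[OF this] obtain k where k: "\<And>a. k a \<ge> 0"
    "\<And>a c c'. 0 \<le> c \<and> c \<le> c' \<and> c' \<le> T \<longrightarrow> \<bar>cov (fe a) (\<beta> c') - cov (fe a) (\<beta> c)\<bar> \<le> k a * (V c' - V c)"
    by auto
  show thesis
  proof (rule that[of "\<Sum>a<d. k a"])
    show "(\<Sum>a<d. k a) \<ge> 0" using k(1) by (simp add: sum_nonneg)
    fix a c c' assume a: "a < d" and c: "0 \<le> c" "c \<le> c'" "c' \<le> T"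
    have "k a \<le> (\<Sum>a<d. k a)" using a k(1) by (intro member_le_sum) auto
    then have "k a * (V c' - V c) \<le> (\<Sum>a<d. k a) * (V c' - V c)"
      using V_le[OF c] by (intro mult_right_mono) auto
    then show "\<bar>cov (fe a) (\<beta> c') - cov (fe a) (\<beta> c)\<bar> \<le> (\<Sum>a<d. k a) * (V c' - V c)"
      using k(2)[of c c' a] c by linarith
  qed
qed

definition G :: "nat \<Rightarrow> nat \<Rightarrow> nat \<Rightarrow> real \<Rightarrow> complex" where
  "G n i j t = ev n (\<lambda>us. of_real (path_sig t \<beta> us)) i j"

text \<open>The development at scale 1. It solves \<open>dY = Y dA\<close> with the identity as
  initial value; the series converges at every time by the factorial decay of iterated
  integrals.\<close>

definition Y :: "nat \<Rightarrow> nat \<Rightarrow> real \<Rightarrow> complex" where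
  "Y i j t = (\<Sum>n. G n i j t)"

definition dA :: "nat \<Rightarrow> nat \<Rightarrow> real \<Rightarrow> real \<Rightarrow> complex" where
  "dA q j c c' = (\<Sum>a<d. M a q j * of_real (cov (fe a) (\<beta> c') - cov (fe a) (\<beta> c)))"

lemma dint_ev:
  assumes "\<And>us. dint (J us) (K us) g"
  shows "dint (\<lambda>t. ev n (\<lambda>us. of_real (J us t)) i j) (\<lambda>t. ev n (\<lambda>us. of_real (K us t)) i j) (\<lambda>t. of_real (g t))"
  using assms
proof (induction n arbitrary: J K j)
  case 0
  show ?case
  proof (cases "i = j")
    case True
    then show ?thesis using dint_of_real[OF 0[of "[]"], where 'a = complex] by simp
  qed (simp add: dint_def negl_0)
next
  case (Suc n)
  show ?case
    unfolding ev.simps mult.commute[of _ "M _ _ _"]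
    by (intro dint_sum_left dint_cmult_left Suc.IH Suc.prems)
qed

lemma path_sig_bound:
  obtains C where "C \<ge> 0"
    "\<And>n us t. 0 \<le> t \<Longrightarrow> t \<le> T \<Longrightarrow> set us \<subseteq> fe ` {..<d} \<Longrightarrow> \<bar>path_sig t \<beta> us\<bar> \<le> C ^ length us / fact (length us)"
proof -
  obtain k where k: "k \<ge> 0"
    "\<And>a c c'. a < d \<Longrightarrow> 0 \<le> c \<Longrightarrow> c \<le> c' \<Longrightarrow> c' \<le> T \<Longrightarrow> \<bar>cov (fe a) (\<beta> c') - cov (fe a) (\<beta> c)\<bar> \<le> k * (V c' - V c)"
    by (rule letters_lipschitz) (rule that)
  show thesis
  proof (rule that[of "k * (V T - V 0)"])
    show "0 \<le> k * (V T - V 0)" using k(1) V_le[of 0 T] T_nonneg by simp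
    fix us t assume t: "0 \<le> t" "t \<le> T" and us: "set us \<subseteq> fe ` {..<d}"
    have "\<bar>path_sig t \<beta> us\<bar> \<le> (k * (V t - V 0)) ^ length (rev us) / fact (length (rev us))"
      unfolding path_sig_def
      by (rule iter_int_bound[OF tame _ k(1) t]) (use us k(2) in auto)
    also have "\<dots> \<le> (k * (V T - V 0)) ^ length (rev us) / fact (length (rev us))"
      using k(1) V_le[of 0 t] V_le[of t T] t by (intro divide_right_mono power_mono mult_left_mono) auto
    finally show "\<bar>path_sig t \<beta> us\<bar> \<le> (k * (V T - V 0)) ^ length us / fact (length us)" by simp
  qed
qed

lemma G_bound:
  obtains C where "C \<ge> 0" "\<And>n i j t. 0 \<le> t \<Longrightarrow> t \<le> T \<Longrightarrow> j < N \<Longrightarrow> norm (G n i j t) \<le> C ^ n / fact n"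
proof -
  obtain C where C: "C \<ge> 0"
    "\<And>n us t. 0 \<le> t \<Longrightarrow> t \<le> T \<Longrightarrow> set us \<subseteq> fe ` {..<d} \<Longrightarrow> \<bar>path_sig t \<beta> us\<bar> \<le> C ^ length us / fact (length us)"
    by (rule path_sig_bound) (rule that)
  show thesis
  proof (rule that[of "C * letter_bound"])
    show "0 \<le> C * letter_bound" using C(1) letter_bound_nonneg by simp
    fix n i j t assume t: "0 \<le> t" "t \<le> T" and j: "j < N"
    have "norm (G n i j t) \<le> C ^ n / fact n * letter_bound ^ n"
      unfolding G_def
    proof (rule ev_bound[OF _ _ j])
      fix us :: "'e covector list" assume us: "length us = n" "set us \<subseteq> fe ` {..<d}"
      show "norm (complex_of_real (path_sig t \<beta> us)) \<le> C ^ n / fact n" using C(2)[OF t us(2)] us(1) by simp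
    qed (use C(1) in simp)
    then show "norm (G n i j t) \<le> (C * letter_bound) ^ n / fact n" by (simp add: power_mult_distrib)
  qed
qed

lemma summable_exp_series: "summable (\<lambda>n. (C::real) ^ n / fact n)"
  using summable_exp_generic[of C] by (simp add: divide_inverse mult.commute)

lemma Y_sums: "0 \<le> t \<Longrightarrow> t \<le> T \<Longrightarrow> j < N \<Longrightarrow> (\<lambda>n. G n i j t) sums Y i j t"
proof -
  assume t: "0 \<le> t" "t \<le> T" "j < N"
  obtain C where C: "C \<ge> 0" "\<And>n i j t. 0 \<le> t \<Longrightarrow> t \<le> T \<Longrightarrow> j < N \<Longrightarrow> norm (G n i j t) \<le> C ^ n / fact n"
    by (rule G_bound) (rule that)
  have "summable (\<lambda>n. G n i j t)"
    by (rule summable_comparison_test'[OF summable_exp_series[of C], of 0]) (rule C(2)[OF t])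
  then show ?thesis unfolding Y_def by (rule summable_sums)
qed

lemma G_vlip: "vlip (G n i j)"
proof -
  have main: "vlip (\<lambda>t. ev n (\<lambda>us. of_real (J us t)) i j)" if "\<And>us. vlip (J us)" for J :: "'e covector list \<Rightarrow> real \<Rightarrow> real"
    using that
  proof (induction n arbitrary: J j)
    case 0
    then show ?case by (cases "i = j") (auto intro: vlip_const vlip_bounded_linear[OF _ bounded_linear_of_real])
  next
    case (Suc n)
    show ?case unfolding ev.simps mult.commute[of _ "M _ _ _"]
      by (intro vlip_sum vlip_cmult Suc.IH Suc.prems)
  qed
  show ?thesis
    unfolding G_def[abs_def] path_sig_def by (rule main[of "\<lambda>us. iter_int \<beta> (rev us)"]) (rule iter_int_vlip_dint(1)[OF tame])
qed

text \<open>Degree by degree, \<open>G (Suc n)\<close> is the integral of \<open>G n\<close> against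
  the matrix path. The defects are dominated by multiples of \<open>C^n / n!\<close>, so they may be
  summed by \<open>negl_suminf\<close>.\<close>

lemma Y_negl_vlip:
  assumes j: "j < N"
  shows "negl (\<lambda>c c'. Y i j c' - Y i j c - (\<Sum>q<N. Y i q c * dA q j c c'))" and "vlip (Y i j)"
proof -
  obtain C where C: "C \<ge> 0" "\<And>n i j t. 0 \<le> t \<Longrightarrow> t \<le> T \<Longrightarrow> j < N \<Longrightarrow> norm (G n i j t) \<le> C ^ n / fact n"
    by (rule G_bound) (rule that)
  obtain k where k: "k \<ge> 0"
    "\<And>a c c'. a < d \<Longrightarrow> 0 \<le> c \<Longrightarrow> c \<le> c' \<Longrightarrow> c' \<le> T \<Longrightarrow> \<bar>cov (fe a) (\<beta> c') - cov (fe a) (\<beta> c)\<bar> \<le> k * (V c' - V c)"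
    by (rule letters_lipschitz) (rule that)
  define b where "b n = C ^ n / fact n" for n
  have b: "summable b" unfolding b_def by (rule summable_exp_series)
  have b0: "0 \<le> b n" for n using C(1) by (simp add: b_def)
  define m where "m = (\<Sum>a<d. \<Sum>q<N. norm (M a q j))"
  have m0: "0 \<le> m" by (simp add: m_def sum_nonneg)
  define J where "J n a q t = ev n (\<lambda>us. of_real (iter_int \<beta> (fe a # rev us) t)) i q" for n a q t
  have GS: "G (Suc n) i j t = (\<Sum>a<d. \<Sum>q<N. J n a q t * M a q j)" for n t
    by (simp add: G_def J_def path_sig_def del: iter_int.simps)
  have dJ: "dint (J n a q) (G n i q) (\<lambda>t. of_real (cov (fe a) (\<beta> t)))" for n a q
    unfolding J_def[abs_def] G_def[abs_def] path_sig_def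
    by (rule dint_ev) (rule iter_int_vlip_dint(2)[OF tame])
  have Jinc: "norm (J n a q c' - J n a q c) \<le> b n * k * (V c' - V c)"
    if "a < d" "q < N" "0 \<le> c" "c \<le> c'" "c' \<le> T" for n a q c c'
    by (rule dint_increment_bound[OF dJ, where M = "b n" and k = k])
       (use that k(2)[of a] C(2) in \<open>auto simp: b_def simp flip: of_real_diff\<close>)
  have GSinc: "norm (G (Suc n) i j c' - G (Suc n) i j c) \<le> b n * k * m * (V c' - V c)"
    if c: "0 \<le> c" "c \<le> c'" "c' \<le> T" for n c c'
  proof -
    have "norm (G (Suc n) i j c' - G (Suc n) i j c) = norm (\<Sum>a<d. \<Sum>q<N. (J n a q c' - J n a q c) * M a q j)"
      by (simp add: GS sum_subtractf left_diff_distrib)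
    also have "\<dots> \<le> (\<Sum>a<d. \<Sum>q<N. b n * k * (V c' - V c) * norm (M a q j))"
      by (intro order_trans[OF norm_sum sum_mono] order_trans[OF norm_mult_ineq mult_right_mono] Jinc c) auto
    also have "\<dots> = b n * k * m * (V c' - V c)"
      by (simp add: m_def sum_distrib_left sum_distrib_right mult_ac)
    finally show ?thesis .
  qed
  define \<Phi> where "\<Phi> n c c' = G (Suc n) i j c' - G (Suc n) i j c - (\<Sum>q<N. G n i q c * dA q j c c')" for n c c'
  have dAb: "norm (\<Sum>q<N. G n i q c * dA q j c c') \<le> b n * k * m * (V c' - V c)"
    if c: "0 \<le> c" "c \<le> c'" "c' \<le> T" for n c c'
  proof -
    have "norm (\<Sum>q<N. G n i q c * dA q j c c') \<le> (\<Sum>q<N. b n * (\<Sum>a<d. norm (M a q j) * (k * (V c' - V c))))"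
    proof (intro order_trans[OF norm_sum sum_mono] order_trans[OF norm_mult_ineq mult_mono])
      fix q assume q: "q \<in> {..<N}"
      show "norm (G n i q c) \<le> b n" using C(2) q c by (simp add: b_def)
      show "norm (dA q j c c') \<le> (\<Sum>a<d. norm (M a q j) * (k * (V c' - V c)))"
        unfolding dA_def
        by (intro order_trans[OF norm_sum sum_mono] order_trans[OF norm_mult_ineq mult_left_mono])
           (use k(2) c in \<open>auto simp: norm_of_real simp del: of_real_diff\<close>)
    qed (use b0 in auto)
    also have "\<dots> = (\<Sum>a<d. \<Sum>q<N. b n * (norm (M a q j) * (k * (V c' - V c))))"
      unfolding sum_distrib_left by (rule sum.swap)
    also have "\<dots> = b n * k * m * (V c' - V c)"
      by (simp add: m_def sum_distrib_left sum_distrib_right mult_ac)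
    finally show ?thesis .
  qed
  have \<Phi>: "negl (\<Phi> n)" for n
  proof -
    have "negl (\<lambda>c c'. \<Sum>a<d. \<Sum>q<N. M a q j * (J n a q c' - J n a q c - G n i q c * (of_real (cov (fe a) (\<beta> c')) - of_real (cov (fe a) (\<beta> c)))))"
      using dJ unfolding dint_def by (intro negl_sum negl_cmult)
    then show ?thesis
    proof (rule negl_cong)
      fix c c'
      have "(\<Sum>q<N. G n i q c * dA q j c c') = (\<Sum>a<d. \<Sum>q<N. M a q j * (G n i q c * (of_real (cov (fe a) (\<beta> c')) - of_real (cov (fe a) (\<beta> c)))))"
        unfolding dA_def sum_distrib_left by (subst sum.swap) (simp add: mult_ac)
      then show "\<Phi> n c c' = (\<Sum>a<d. \<Sum>q<N. M a q j * (J n a q c' - J n a q c - G n i q c * (of_real (cov (fe a) (\<beta> c')) - of_real (cov (fe a) (\<beta> c)))))"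
        by (simp add: \<Phi>_def GS right_diff_distrib sum_subtractf mult.commute[of "M _ _ _"])
    qed
  qed
  have "negl (\<lambda>c c'. \<Sum>n. \<Phi> n c c')"
  proof (rule negl_suminf[OF \<Phi>])
    show "summable (\<lambda>n. 2 * k * m * b n)" using b by (rule summable_mult)
    fix n c c' assume c: "0 \<le> c" "c \<le> c'" "c' \<le> T"
    have "norm (\<Phi> n c c') \<le> norm (G (Suc n) i j c' - G (Suc n) i j c) + norm (\<Sum>q<N. G n i q c * dA q j c c')"
      unfolding \<Phi>_def by (rule norm_triangle_ineq4)
    then show "norm (\<Phi> n c c') \<le> 2 * k * m * b n * (V c' - V c)"
      using GSinc[OF c, of n] dAb[OF c, of n] by (simp add: algebra_simps)
  qed
  moreover have Y0: "(\<lambda>n. G (Suc n) i j t) sums (Y i j t - G 0 i j t)" if "0 \<le> t" "t \<le> T" for t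
    using Y_sums[OF that j, of i] sums_Suc_iff[of "\<lambda>n. G n i j t" "Y i j t - G 0 i j t"] by simp
  have G0: "G 0 i j t = G 0 i j c" for t c by (simp add: G_def path_sig_def)
  have inc: "(\<lambda>n. G (Suc n) i j c' - G (Suc n) i j c) sums (Y i j c' - Y i j c)"
    if "0 \<le> c" "c \<le> c'" "c' \<le> T" for c c'
    using sums_diff[OF Y0[of c'] Y0[of c]] that G0[of c' c] by simp
  ultimately show "negl (\<lambda>c c'. Y i j c' - Y i j c - (\<Sum>q<N. Y i q c * dA q j c c'))"
  proof (elim negl_cong)
    fix c c' assume c: "0 \<le> c" "c \<le> c'" "c' \<le> T"
    have "(\<lambda>n. \<Sum>q<N. G n i q c * dA q j c c') sums (\<Sum>q<N. Y i q c * dA q j c c')"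
      by (intro sums_sum sums_mult2 Y_sums) (use c in auto)
    from sums_diff[OF inc[OF c] this]
    show "Y i j c' - Y i j c - (\<Sum>q<N. Y i q c * dA q j c c') = (\<Sum>n. \<Phi> n c c')"
      unfolding \<Phi>_def by (rule sums_unique)
  qed
  show "vlip (Y i j)"
  proof (rule vlipI)
    have "uniform_limit {0..T} (\<lambda>n t. \<Sum>i'<n. G i' i j t) (\<lambda>t. Y i j t) sequentially"
      unfolding Y_def by (rule Weierstrass_m_test[OF _ b]) (use C(2) j in \<open>auto simp: b_def\<close>)
    then show "continuous_on {0..T} (Y i j)"
      by (rule uniform_limit_theorem[rotated])
         (auto intro!: always_eventually continuous_on_sum vlip_continuous[OF G_vlip])
    fix c c' assume c: "0 \<le> c" "c \<le> c'" "c' \<le> T"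
    have "norm (Y i j c' - Y i j c) \<le> (\<Sum>n. b n * k * m * (V c' - V c))"
      unfolding sums_unique[OF inc[OF c]]
      by (rule norm_suminf_le[OF GSinc[OF c]]) (intro summable_mult2 b)
    also have "\<dots> = (\<Sum>n. b n) * k * m * (V c' - V c)"
      using b by (simp add: suminf_mult2[symmetric] summable_mult2)
    finally show "norm (Y i j c' - Y i j c) \<le> (\<Sum>n. b n) * k * m * (V c' - V c)" .
  qed
qed

lemma Y_0:
  assumes "j < N"
  shows "Y i j 0 = (if i = j then 1 else 0)"
proof -
  have "G n i j 0 = (if n = 0 then (if i = j then 1 else 0) else 0)" for n
  proof (cases n)
    case (Suc k)
    have "(\<lambda>us. complex_of_real (path_sig 0 \<beta> (us @ [fe a]))) = (\<lambda>us. 0 * 0)" for a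
      by (simp add: path_sig_0_length tone_def)
    then show ?thesis unfolding G_def Suc ev.simps by (simp only: ev_cmult) simp
  qed (simp add: G_def path_sig_def)
  then have "(\<lambda>n. G n i j 0) = (\<lambda>n. if n = 0 then (if i = j then 1 else 0) else 0)" by (rule ext)
  then have "(\<lambda>n. G n i j 0) sums (if i = j then 1 else 0)"
    using sums_single[of 0 "\<lambda>_. if i = j then 1 else 0 :: complex"] by simp
  then show ?thesis using sums_unique2[OF Y_sums[of 0 j i]] assms T_nonneg by simp
qed

text \<open>The differential of the squared row norm pairs the row with the Hermitian part of
  \<open>dA\<close>, which vanishes for skew-Hermitian letters.\<close>

lemma row_norm:
  assumes skew: "\<And>a q j. a < d \<Longrightarrow> q < N \<Longrightarrow> j < N \<Longrightarrow> cnj (M a q j) = - M a j q"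
    and i: "i < N" and t: "0 \<le> t" "t \<le> T"
  shows "(\<Sum>k<N. (norm (Y i k t))\<^sup>2) = 1"
proof -
  have cA: "cnj (dA q j c c') = - dA j q c c'" if "q < N" "j < N" for q j c c'
    using that by (simp add: dA_def skew sum_negf)
  define U where "U t = (\<Sum>k<N. Y i k t * cnj (Y i k t))" for t
  have cn: "vlip (\<lambda>t. cnj (Y i k t))" if "k < N" for k
    by (rule vlip_bounded_linear[OF Y_negl_vlip(2)[OF that] bounded_linear_cnj])
  have 1: "negl (\<lambda>c c'. cnj (Y i k c') - cnj (Y i k c) - (\<Sum>q<N. cnj (Y i q c) * cnj (dA q k c c')))" if "k < N" for k
  proof (rule negl_bounded_by[OF Y_negl_vlip(1)[OF that, of i], where K = 1])
    fix c c'
    have "cnj (Y i k c') - cnj (Y i k c) - (\<Sum>q<N. cnj (Y i q c) * cnj (dA q k c c'))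
        = cnj (Y i k c' - Y i k c - (\<Sum>q<N. Y i q c * dA q k c c'))" by simp
    then show "norm (cnj (Y i k c') - cnj (Y i k c) - (\<Sum>q<N. cnj (Y i q c) * cnj (dA q k c c')))
        \<le> 1 * norm (Y i k c' - Y i k c - (\<Sum>q<N. Y i q c * dA q k c c'))"
      by (simp only: complex_mod_cnj mult_1 order_refl)
  qed
  have "negl (\<lambda>c c'. \<Sum>k<N. ((Y i k c' * cnj (Y i k c') - Y i k c * cnj (Y i k c)) -
       (Y i k c * (cnj (Y i k c') - cnj (Y i k c)) + cnj (Y i k c) * (Y i k c' - Y i k c)))
      + Y i k c * (cnj (Y i k c') - cnj (Y i k c) - (\<Sum>q<N. cnj (Y i q c) * cnj (dA q k c c')))
      + cnj (Y i k c) * (Y i k c' - Y i k c - (\<Sum>q<N. Y i q c * dA q k c c')))"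
    by (intro negl_sum negl_add dint_product negl_mult_continuous 1 Y_negl_vlip cn vlip_continuous) auto
  then have "negl (\<lambda>c c'. U c' - U c)"
  proof (rule negl_cong)
    fix c c'
    \<comment> \<open>Exchanging the two summation indices and using skewness maps one sum to the
      negative of the other.\<close>
    have z: "(\<Sum>k<N. Y i k c * (\<Sum>q<N. cnj (Y i q c) * cnj (dA q k c c'))) + (\<Sum>k<N. cnj (Y i k c) * (\<Sum>q<N. Y i q c * dA q k c c')) = 0"
    proof -
      have "(\<Sum>k<N. Y i k c * (\<Sum>q<N. cnj (Y i q c) * cnj (dA q k c c'))) = (\<Sum>k<N. \<Sum>q<N. - (Y i k c * cnj (Y i q c) * dA k q c c'))"
        unfolding sum_distrib_left by (intro sum.cong refl) (simp add: cA)
      also have "\<dots> = (\<Sum>q<N. \<Sum>k<N. - (Y i k c * cnj (Y i q c) * dA k q c c'))" by (rule sum.swap)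
      also have "\<dots> = - (\<Sum>k<N. cnj (Y i k c) * (\<Sum>q<N. Y i q c * dA q k c c'))"
        by (simp add: sum_distrib_left sum_negf mult_ac)
      finally show ?thesis by simp
    qed
    show "U c' - U c = (\<Sum>k<N. ((Y i k c' * cnj (Y i k c') - Y i k c * cnj (Y i k c)) -
       (Y i k c * (cnj (Y i k c') - cnj (Y i k c)) + cnj (Y i k c) * (Y i k c' - Y i k c)))
      + Y i k c * (cnj (Y i k c') - cnj (Y i k c) - (\<Sum>q<N. cnj (Y i q c) * cnj (dA q k c c')))
      + cnj (Y i k c) * (Y i k c' - Y i k c - (\<Sum>q<N. Y i q c * dA q k c c')))"
      using z by (simp add: U_def sum.distrib sum_subtractf right_diff_distrib algebra_simps)
  qed
  then have "U t = U 0" using t by (rule negl_increments_imp_const)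
  also have "U 0 = (\<Sum>k<N. if k = i then 1 else 0)"
    unfolding U_def by (intro sum.cong refl) (auto simp: Y_0)
  also have "\<dots> = 1" using i by simp
  finally have "complex_of_real (\<Sum>k<N. (norm (Y i k t))\<^sup>2) = complex_of_real 1"
    unfolding U_def of_real_sum by (simp only: complex_norm_square of_real_1)
  then show ?thesis by (simp only: of_real_eq_iff)
qed

text \<open>Entries of unit rows have modulus at most 1, so trace \<open>N\<close> forces every
  diagonal entry to have real part 1, which leaves nothing for the rest of its row.\<close>

lemma row_off_diagonal_zero:
  assumes skew: "\<And>a q j. a < d \<Longrightarrow> q < N \<Longrightarrow> j < N \<Longrightarrow> cnj (M a q j) = - M a j q"
    and tr: "(\<Sum>i<N. Y i i T) = of_nat N"
    and "i < N" "j < N" "i \<noteq> j"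
  shows "Y i j T = 0"
proof -
  have rn: "(\<Sum>k<N. (norm (Y i k T))\<^sup>2) = 1" if "i < N" for i
    by (rule row_norm[OF skew that]) (use T_nonneg in auto)
  have le1: "norm (Y i i T) \<le> 1" if "i < N" for i
  proof -
    have "(norm (Y i i T))\<^sup>2 \<le> (\<Sum>k<N. (norm (Y i k T))\<^sup>2)" using that by (intro member_le_sum[where f = "\<lambda>k. (norm (Y _ k T))\<^sup>2"]) auto
    then show ?thesis using rn[OF that] by (simp add: abs_square_le_1)
  qed
  have "(\<Sum>k<N. 1 - Re (Y k k T)) = 0"
    using arg_cong[OF tr, of Re] by (simp add: sum_subtractf)
  moreover have "0 \<le> 1 - Re (Y k k T)" if "k < N" for k
    using le1[OF that] complex_Re_le_cmod[of "Y k k T"] by linarith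
  ultimately have "1 - Re (Y i i T) = 0"
    using assms(3) by (subst (asm) sum_nonneg_eq_0_iff) auto
  then have "1 \<le> norm (Y i i T)" using complex_Re_le_cmod[of "Y i i T"] by linarith
  then have n1: "norm (Y i i T) = 1" using le1[OF assms(3)] by linarith
  have "(norm (Y i i T))\<^sup>2 + (norm (Y i j T))\<^sup>2 = (\<Sum>k\<in>{i, j}. (norm (Y i k T))\<^sup>2)" using assms(5) by simp
  also have "\<dots> \<le> (\<Sum>k<N. (norm (Y i k T))\<^sup>2)" using assms(3,4) by (intro sum_mono2) auto
  finally show ?thesis using rn[OF assms(3)] n1 by simp
qed

end

section \<open>Developments of concatenation powers\<close>

lemma path_sig_path_pow:
  assumes \<gamma>: "tame_on T \<gamma>" and "0 \<le> T"
  shows "path_sig (real m * T) (path_pow T \<gamma> m) = tpow (path_sig T \<gamma>) m"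
proof (induction m)
  case 0
  then show ?case by (simp add: path_sig_0_length)
next
  case (Suc m)
  let ?S = "real m * T"
  obtain V where V: "control V (?S + T)" "control.tame V (?S + T) (path_pow T \<gamma> (Suc m))"
    using tame_on_path_pow[OF \<gamma>, of "Suc m"] unfolding tame_on_def by (auto simp: algebra_simps)
  obtain V1 where V1: "control V1 ?S" "control.tame V1 ?S (path_pow T \<gamma> m)"
    using tame_on_path_pow[OF \<gamma>, of m] unfolding tame_on_def by auto
  have S: "0 \<le> ?S" using assms(2) by simp
  have "path_sig (?S + T) (path_pow T \<gamma> (Suc m)) = tmul (path_sig ?S (path_pow T \<gamma> (Suc m))) (path_sig T \<gamma>)"
  proof (rule path_sig_chen[OF V(1) S assms(2) V(2)])
    fix f s assume s: "0 \<le> s" "s \<le> T"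
    have *: "path_pow T \<gamma> (Suc m) (?S + s) = path_pow T \<gamma> m ?S + (\<gamma> s - \<gamma> 0)"
      using s by (auto simp: path_concat_def)
    show "cov f (\<gamma> s) = cov f (path_pow T \<gamma> (Suc m) (?S + s)) + (cov f (\<gamma> 0) - cov f (path_pow T \<gamma> m ?S))"
      unfolding * by (simp add: cov_simps)
  qed
  also have "path_sig ?S (path_pow T \<gamma> (Suc m)) = path_sig ?S (path_pow T \<gamma> m)"
  proof
    fix fs
    interpret control V1 ?S by fact
    show "path_sig ?S (path_pow T \<gamma> (Suc m)) fs = path_sig ?S (path_pow T \<gamma> m) fs"
      unfolding path_sig_def
      by (rule iter_int_cong[OF V1(2), where k = "\<lambda>_. 0"]) (use S in \<open>auto simp: path_concat_def\<close>)
  qed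
  finally show ?case using Suc by (simp add: tpow_Suc_right algebra_simps del: tpow.simps path_pow.simps)
qed

context dual_basis
begin

lemma common_bound:
  fixes d :: nat and fe :: "nat \<Rightarrow> 'v covector"
  obtains k where "k > 0" "\<And>a x. a < d \<Longrightarrow> \<bar>cov (fe a) x\<bar> \<le> k * norm x"
proof -
  have "\<forall>a. \<exists>k\<ge>0. \<forall>x. \<bar>cov (fe a :: 'v covector) x\<bar> \<le> k * norm x" using functional_bounded by simp
  from choice[OF this] obtain k where k: "\<And>a. k a \<ge> 0" "\<And>a x. \<bar>cov (fe a) x\<bar> \<le> k a * norm x" by auto
  show thesis
  proof (rule that[of "(\<Sum>a<d. k a) + 1"])
    show "(\<Sum>a<d. k a) + 1 > 0" using k(1) by (simp add: add_nonneg_pos sum_nonneg)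
    fix a :: nat and x :: 'v assume "a < d"
    then have "k a \<le> (\<Sum>a<d. k a)" using k(1) by (intro member_le_sum) auto
    then have "k a * norm x \<le> ((\<Sum>a<d. k a) + 1) * norm x" by (intro mult_right_mono) auto
    then show "\<bar>cov (fe a) x\<bar> \<le> ((\<Sum>a<d. k a) + 1) * norm x" using k(2)[of a x] by linarith
  qed
qed

text \<open>The coefficients of the logarithm decay faster than every geometric rate, which beats
  any fixed \<open>norm z\<close> and any size of the matrices.\<close>

lemma evs_tlog_entire:
  fixes g :: "('v, real) tseries"
  assumes g: "multilinear g" "tradius (tlog g) = \<infinity>" and j: "j < N"
  shows "fps_conv_radius (letters.evs N d fe M (\<lambda>us. of_real (tlog g us)) i j) = \<infinity>"
proof -
  interpret letters N d fe M .
  obtain k where k: "k > 0" "\<And>a x. a < d \<Longrightarrow> \<bar>cov (fe a) x\<bar> \<le> k * norm x"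
    by (rule common_bound[of d fe]) (rule that)
  show ?thesis
    unfolding fps_conv_radius_def
  proof (rule conv_radius_inftyI'')
    fix z :: complex
    \<comment> \<open>Chosen so that the terms of the series at \<open>z\<close> are eventually at
      most \<open>(1/2)^n\<close>; the added ones avoid zero denominators.\<close>
    define e where "e = 1 / (2 * k * (letter_bound + 1) * (norm z + 1))"
    have p: "2 * k * (letter_bound + 1) * (norm z + 1) > 0"
      using k letter_bound_nonneg by (intro mult_pos_pos) (auto simp: add_nonneg_pos)
    then have e: "e > 0" by (simp add: e_def)
    have small: "k * e * letter_bound * norm z \<le> 1 / 2"
    proof -
      have "k * e * letter_bound * norm z \<le> k * e * (letter_bound + 1) * (norm z + 1)"
        using k e letter_bound_nonneg by (intro mult_mono) auto
      also have "\<dots> = 1 / 2"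
      proof -
        have "letter_bound + 1 \<noteq> 0" "norm z + 1 \<noteq> 0" "k \<noteq> 0"
          using letter_bound_nonneg norm_ge_zero[of z] k(1) by linarith+
        then show ?thesis unfolding e_def by (simp add: divide_simps)
      qed
      finally show ?thesis .
    qed
    have "\<forall>\<^sub>F n in sequentially. norm (fps_nth (evs (\<lambda>us. of_real (tlog g us)) i j) n * z ^ n) \<le> (1 / 2) ^ n"
      using tradius_infinite_bound[OF multilinear_tlog[OF g(1)] g(2) e k(1)]
    proof eventually_elim
      case (elim n)
      have "norm (ev n (\<lambda>us. of_real (tlog g us)) i j) \<le> (k * e) ^ n * letter_bound ^ n"
      proof (rule ev_bound[OF _ _ j])
        fix us :: "'v covector list" assume us: "length us = n" "set us \<subseteq> fe ` {..<d}"
        have "\<forall>f\<in>set us. \<forall>x. \<bar>cov f x\<bar> \<le> k * norm x" using us(2) k(2) by auto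
        then show "norm (complex_of_real (tlog g us)) \<le> (k * e) ^ n" using elim us(1) by simp
      qed (use k e in simp)
      then have "norm (ev n (\<lambda>us. of_real (tlog g us)) i j) * norm z ^ n \<le> (k * e) ^ n * letter_bound ^ n * norm z ^ n"
        by (rule mult_right_mono) simp
      also have "\<dots> = (k * e * letter_bound * norm z) ^ n" by (simp add: power_mult_distrib)
      also have "\<dots> \<le> (1 / 2) ^ n"
        using small k e letter_bound_nonneg by (intro power_mono) auto
      finally show ?case by (simp add: norm_mult norm_power)
    qed
    then show "summable (\<lambda>n. fps_nth (evs (\<lambda>us. of_real (tlog g us)) i j) n * z ^ n)"
      by (rule summable_comparison_test_ev) (rule summable_geometric, simp)
  qed
qed

end

lemma mpow_diagonal:
  fixes D :: "nat \<Rightarrow> 'a::comm_semiring_1"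
  assumes "i < N" "j < N"
  shows "mpow N (\<lambda>i j. if i = j then D i else 0) k i j = (if i = j then D i ^ k else 0)"
  using assms(2)
proof (induction k arbitrary: j)
  case (Suc k)
  have "mpow N (\<lambda>i j. if i = j then D i else 0) (Suc k) i j = (\<Sum>q<N. if q = i then (if i = j then D i ^ k * D i else 0) else 0)"
    unfolding mpow.simps by (intro sum.cong refl) (use Suc in auto)
  then show ?case using assms(1) by (simp add: mult.commute)
qed simp

locale resonant_path = dual_basis B cb
  for B :: "'v::real_normed_vector set" and cb :: "'v \<Rightarrow> 'v covector" +
  fixes \<gamma> :: "real \<Rightarrow> 'v" and T :: real and v :: 'v and lf :: "'v covector" and m :: nat
  assumes T_pos: "T > 0" and tame_\<gamma>: "tame_on T \<gamma>"
    and start: "\<gamma> 0 = 0" and endpoint: "\<gamma> T = v" and lf: "cov lf v = 1"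
    and radius: "tradius (tlog (path_sig T \<gamma>)) = \<infinity>" and m: "m \<ge> 1"
begin

abbreviation \<beta> :: "real \<Rightarrow> 'v" where "\<beta> \<equiv> path_pow T \<gamma> m"
abbreviation T' :: real where "T' \<equiv> real m * T"

lemma T'_nonneg: "0 \<le> T'" using T_pos by simp

lemma path_sig_singleton: "path_sig T \<gamma> [f] = cov f v"
proof -
  obtain V where V: "control V T" "control.tame V T \<gamma>" using tame_\<gamma> unfolding tame_on_def by auto
  interpret control V T by fact
  have "iter_int \<gamma> [f] T = cov f (\<gamma> T) - cov f (\<gamma> 0)"
  proof (rule dint_unique[OF iter_int_vlip_dint(2)[OF V(2)], where J' = "\<lambda>t. cov f (\<gamma> t) - cov f (\<gamma> 0)"])
    show "dint (\<lambda>t. cov f (\<gamma> t) - cov f (\<gamma> 0)) (iter_int \<gamma> []) (\<lambda>t. cov f (\<gamma> t))"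
      unfolding dint_def by (rule negl_cong[OF negl_0]) simp
  qed (use T_pos iter_int_vlip_dint(3)[OF V(2), of f "[]"] in auto)
  then show ?thesis by (simp add: path_sig_def start endpoint cov_simps)
qed

text \<open>The development of the \<open>m\<close>-fold power is the image of the
  \<open>m\<close>-th power of the signature, and by \<open>trace_tpow\<close> its trace depends on
  the increment \<open>v\<close> only. All letters except \<open>lf\<close> vanish on
  \<open>v\<close>, so the matrix of \<open>v\<close> is diagonal and the trace is a sum of
  exponentials of multiples of \<open>2 \<pi> \<i>\<close>.\<close>

lemma trace_development:
  fixes N n :: nat and fe :: "nat \<Rightarrow> 'v covector" and M :: "nat \<Rightarrow> nat \<Rightarrow> nat \<Rightarrow> complex" and \<theta> :: "nat \<Rightarrow> real"
  assumes "development V T' \<beta>"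
    and fe0: "fe 0 = lf" and fe: "\<And>a. 0 < a \<Longrightarrow> a < d \<Longrightarrow> cov (fe a) v = 0" and d: "0 < d"
    and M0: "\<And>i j. M 0 i j = (if i = j then \<i> * of_real (\<theta> i) else 0)"
    and res: "\<And>i. i < N \<Longrightarrow> real m * \<theta> i \<in> (\<lambda>k. 2 * pi * k) ` \<int>"
  shows "(\<Sum>i<N. development.Y N d fe M \<beta> i i T') = of_nat N"
proof -
  interpret development V T' N d fe M \<beta> by fact
  define g where "g = path_sig T \<gamma>"
  have g0: "g [] = 1" by (simp add: g_def path_sig_def)
  obtain V1 where V1: "control V1 T" "control.tame V1 T \<gamma>" using tame_\<gamma> unfolding tame_on_def by auto
  \<comment> \<open>The development of a single copy of \<open>\<gamma>\<close> supplies the growth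
    bound, while the unprefixed \<open>G\<close> and \<open>Y\<close> belong to the
    \<open>m\<close>-fold power.\<close>
  interpret D1: development V1 T N d fe M \<gamma>
    by (intro development.intro V1(1) development_axioms.intro V1(2))
  obtain C where C: "C \<ge> 0" "\<And>n i j t. 0 \<le> t \<Longrightarrow> t \<le> T \<Longrightarrow> j < N \<Longrightarrow> norm (D1.G n i j t) \<le> C ^ n / fact n"
    by (rule D1.G_bound) (rule that)
  have L1: "(\<Sum>a<d. of_real (g [fe a]) * M a i j) = (if i = j then \<i> * of_real (\<theta> i) else 0)" for i j
  proof -
    have "(\<Sum>a<d. of_real (g [fe a]) * M a i j) = (\<Sum>a<d. if a = 0 then M 0 i j else 0)"
    proof (intro sum.cong refl)
      fix a assume "a \<in> {..<d}"
      then show "of_real (g [fe a]) * M a i j = (if a = 0 then M 0 i j else 0)"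
        using fe[of a] by (cases "a = 0") (auto simp: g_def path_sig_singleton fe0 lf)
    qed
    then show ?thesis using d by (simp add: M0)
  qed
  have tr: "(\<Sum>i<N. G n i i T') = (\<Sum>i<N. (\<i> * of_real (real m * \<theta> i)) ^ n /\<^sub>R fact n)" for n
  proof -
    have "(\<Sum>i<N. G n i i T') = (\<Sum>i<N. ev n (\<lambda>us. of_real (tpow g m us)) i i)"
      by (simp add: G_def g_def path_sig_path_pow[OF tame_\<gamma>] T_pos less_imp_le)
    also have "\<dots> = of_nat m ^ n / fact n * (\<Sum>i<N. mpow N (\<lambda>i j. \<Sum>a<d. of_real (g [fe a]) * M a i j) n i i)"
    proof (rule trace_tpow[where g = g and K = 1 and C = C, OF g0])
      show "fps_conv_radius (evs (\<lambda>us. of_real (tlog g us)) i j) = \<infinity>" if "j < N" for i j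
        unfolding g_def by (rule evs_tlog_entire[OF multilinear_path_sig[OF tame_\<gamma>] radius that])
      show "norm (ev n (\<lambda>us. complex_of_real (g us)) i j) \<le> 1 * C ^ n / fact n" if "j < N" for n i j
        using C(2)[of T j n i] T_pos that by (simp add: D1.G_def g_def)
    qed auto
    also have "(\<Sum>i<N. mpow N (\<lambda>i j. \<Sum>a<d. of_real (g [fe a]) * M a i j) n i i) = (\<Sum>i<N. (\<i> * of_real (\<theta> i)) ^ n)"
      unfolding L1 by (intro sum.cong refl) (simp add: mpow_diagonal)
    finally show ?thesis
      by (simp add: sum_distrib_left power_mult_distrib scaleR_conv_of_real divide_inverse mult_ac)
  qed
  have "(\<lambda>n. \<Sum>i<N. G n i i T') sums (\<Sum>i<N. Y i i T')"
    by (intro sums_sum Y_sums T'_nonneg) auto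
  moreover have "(\<lambda>n. \<Sum>i<N. G n i i T') sums (\<Sum>i<N. exp (\<i> * of_real (real m * \<theta> i)))"
    unfolding tr by (intro sums_sum exp_converges)
  ultimately have "(\<Sum>i<N. Y i i T') = (\<Sum>i<N. exp (\<i> * of_real (real m * \<theta> i)))" by (rule sums_unique2)
  also have "\<dots> = (\<Sum>i<N. 1)"
  proof (intro sum.cong refl)
    fix i assume "i \<in> {..<N}"
    then obtain k where k: "real m * \<theta> i = 2 * pi * k" "k \<in> \<int>" using res[of i] by auto
    have "cis (2 * pi * k) = 1" using k(2) by (rule cis_multiple_2pi)
    then show "exp (\<i> * of_real (real m * \<theta> i)) = 1" unfolding k(1) by (simp add: cis_conv_exp)
  qed
  finally show ?thesis by simp
qed

end


section \<open>Vanishing of resonant iterated integrals\<close>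

context control
begin

lemma negl_increment_bound_const:
  fixes J :: "real \<Rightarrow> 'a::real_normed_vector"
  assumes "negl (\<lambda>c c'. J c' - J c - \<Phi> c c')"
    and "\<And>c c'. 0 \<le> c \<Longrightarrow> c \<le> c' \<Longrightarrow> c' \<le> T \<Longrightarrow> norm (\<Phi> c c') \<le> K * (V c' - V c)"
    and "0 \<le> t" "t \<le> T" "0 \<le> K"
  shows "norm (J t - J 0) \<le> K * (V T - V 0)"
proof -
  have "norm (J t - J 0) \<le> K * V t - K * V 0"
    by (rule negl_increment_bound[OF assms(1)]) (use assms(2,3,4) in \<open>auto simp: algebra_simps\<close>)
  also have "\<dots> \<le> K * (V T - V 0)"
    using assms V_le[of t T] mult_left_mono[of "V t" "V T" K] by (simp add: algebra_simps)
  finally show ?thesis .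
qed

text \<open>A nearest-neighbour system whose couplings are of size \<open>\<epsilon>\<close>: the \<open>k\<close>-th component is of order
  \<open>\<epsilon>^k\<close> and its leading coefficient is produced by the unique shortest walk from \<open>0\<close> to \<open>k\<close>.\<close>

lemma ladder_limit:
  fixes u :: "nat \<Rightarrow> real \<Rightarrow> complex" and Q :: "real \<Rightarrow> nat \<Rightarrow> real \<Rightarrow> complex"
    and e f :: "nat \<Rightarrow> real \<Rightarrow> complex" and A :: "nat \<Rightarrow> real \<Rightarrow> real"
  assumes n: "n > 0" and k: "k \<ge> 0"
    and A: "\<And>j c c'. j < n \<Longrightarrow> 0 \<le> c \<Longrightarrow> c \<le> c' \<Longrightarrow> c' \<le> T \<Longrightarrow> \<bar>A j c' - A j c\<bar> \<le> k * (V c' - V c)"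
    and ef: "\<And>j c. norm (e j c) \<le> 1" "\<And>j c. norm (f j c) \<le> 1"
    and u0: "\<And>t. 0 \<le> t \<Longrightarrow> t \<le> T \<Longrightarrow> u 0 t = 1" and u: "\<And>j. j < n \<Longrightarrow> u (Suc j) 0 = 0"
      "\<And>j. j < n \<Longrightarrow> negl (\<lambda>c c'. u (Suc j) c' - u (Suc j) c - u j c * e j c * of_real (A j c' - A j c))"
    and Q_bound: "\<And>\<epsilon> j t. 0 < \<epsilon> \<Longrightarrow> \<epsilon> \<le> 1 \<Longrightarrow> j \<le> n \<Longrightarrow> 0 \<le> t \<Longrightarrow> t \<le> T \<Longrightarrow> norm (Q \<epsilon> j t) \<le> 1"
    and Q_start: "\<And>\<epsilon>. 0 < \<epsilon> \<Longrightarrow> \<epsilon> \<le> 1 \<Longrightarrow> Q \<epsilon> 0 0 = 1"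
      "\<And>\<epsilon> j. 0 < \<epsilon> \<Longrightarrow> \<epsilon> \<le> 1 \<Longrightarrow> j < n \<Longrightarrow> Q \<epsilon> (Suc j) 0 = 0"
    and Q_negl: "\<And>\<epsilon> j. 0 < \<epsilon> \<Longrightarrow> \<epsilon> \<le> 1 \<Longrightarrow> j \<le> n \<Longrightarrow> negl (\<lambda>c c'. Q \<epsilon> j c' - Q \<epsilon> j c -
        ((if j = 0 then 0 else of_real \<epsilon> * (Q \<epsilon> (j - 1) c * e (j - 1) c * of_real (A (j - 1) c' - A (j - 1) c)))
         - (if j < n then of_real \<epsilon> * (Q \<epsilon> (Suc j) c * f j c * of_real (A j c' - A j c)) else 0)))"
    and Q_end: "\<And>\<epsilon>. 0 < \<epsilon> \<Longrightarrow> \<epsilon> \<le> 1 \<Longrightarrow> Q \<epsilon> n T = 0"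
  shows "u n T = 0"
proof -
  define W where "W = V T - V 0"
  have W: "W \<ge> 0" using V_le[of 0 T] T_nonneg by (simp add: W_def)
  \<comment> \<open>A component is fed by at most two neighbours, each at rate \<open>k\<close>,
    over the total control \<open>W\<close>.\<close>
  define C where "C = 2 * k * W"
  have C: "C \<ge> 0" using k W by (simp add: C_def)
  have coupling: "norm (of_real \<epsilon> * (q * w * of_real (A j c' - A j c))) \<le> \<epsilon> * K * k * (V c' - V c)"
    if "0 < \<epsilon>" "norm q \<le> K" "norm w \<le> 1" "j < n" "0 \<le> c" "c \<le> c'" "c' \<le> T"
    for \<epsilon> K :: real and q w :: complex and j c c'
  proof -
    have "norm (of_real \<epsilon> * (q * w * of_real (A j c' - A j c))) = \<epsilon> * (norm q * norm w * \<bar>A j c' - A j c\<bar>)"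
      using that(1) by (simp add: norm_mult del: of_real_diff)
    also have "\<dots> \<le> \<epsilon> * (K * 1 * (k * (V c' - V c)))"
      using that A[of j c c'] order_trans[OF norm_ge_zero that(2)] by (intro mult_left_mono mult_mono) auto
    finally show ?thesis by (simp add: mult_ac)
  qed
  \<comment> \<open>Each pass through the equation gains a factor \<open>C * \<epsilon>\<close>.
    Both neighbours of \<open>j\<close> have index at least \<open>j - 1\<close>, so the order
    \<open>p\<close> is reached for every \<open>p \<le> j\<close>.\<close>
  have small: "norm (Q \<epsilon> j t) \<le> (C * \<epsilon>) ^ p"
    if "0 < \<epsilon>" "\<epsilon> \<le> 1" "p \<le> j" "j \<le> n" "0 \<le> t" "t \<le> T" for \<epsilon> p j t
    using that(3-)
  proof (induction p arbitrary: j t)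
    case 0
    then show ?case using Q_bound[OF that(1,2)] by simp
  next
    case (Suc p)
    then obtain i where j: "j = Suc i" by (cases j) auto
    have IH: "norm (Q \<epsilon> j t) \<le> (C * \<epsilon>) ^ p" if "p \<le> j" "j \<le> n" "0 \<le> t" "t \<le> T" for j t
      using Suc.IH that by blast
    have p0: "0 \<le> \<epsilon> * (C * \<epsilon>) ^ p * k" using that(1) C k by simp
    have "norm (Q \<epsilon> j t - Q \<epsilon> j 0) \<le> (2 * (\<epsilon> * (C * \<epsilon>) ^ p * k)) * (V T - V 0)"
    proof (rule negl_increment_bound_const[OF Q_negl[OF that(1,2) Suc.prems(2)]])
      fix c c' assume c: "0 \<le> c" "c \<le> c'" "c' \<le> T"
      have a: "norm (of_real \<epsilon> * (Q \<epsilon> i c * e i c * of_real (A i c' - A i c))) \<le> \<epsilon> * (C * \<epsilon>) ^ p * k * (V c' - V c)"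
        by (rule coupling) (use that Suc.prems j c IH[of i c] ef in auto)
      have b: "norm (if j < n then of_real \<epsilon> * (Q \<epsilon> (Suc j) c * f j c * of_real (A j c' - A j c)) else 0) \<le> \<epsilon> * (C * \<epsilon>) ^ p * k * (V c' - V c)"
      proof (cases "j < n")
        case True
        have "norm (of_real \<epsilon> * (Q \<epsilon> (Suc j) c * f j c * of_real (A j c' - A j c))) \<le> \<epsilon> * (C * \<epsilon>) ^ p * k * (V c' - V c)"
          by (rule coupling) (use that Suc.prems True c IH[of "Suc j" c] ef in auto)
        then show ?thesis using True by simp
      next
        case False
        then show ?thesis using p0 V_le[OF c] by simp
      qed
      show "norm ((if j = 0 then 0 else of_real \<epsilon> * (Q \<epsilon> (j - 1) c * e (j - 1) c * of_real (A (j - 1) c' - A (j - 1) c)))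
         - (if j < n then of_real \<epsilon> * (Q \<epsilon> (Suc j) c * f j c * of_real (A j c' - A j c)) else 0))
         \<le> 2 * (\<epsilon> * (C * \<epsilon>) ^ p * k) * (V c' - V c)"
        by (rule order_trans[OF norm_triangle_ineq4]) (use a b j in \<open>simp add: algebra_simps del: of_real_diff\<close>)
    qed (use Suc.prems p0 in auto)
    also have "\<dots> = (C * \<epsilon>) ^ Suc p" by (simp add: C_def W_def)
    finally show ?case using Q_start(2)[OF that(1,2), of i] j Suc.prems by simp
  qed
  \<comment> \<open>Subtracting \<open>\<epsilon>^j\<close> times \<open>u j\<close> cancels the
    forward coupling to leading order. The backward coupling comes from component
    \<open>j + 1\<close>, which by \<open>small\<close> has one more power of
    \<open>\<epsilon>\<close>, and it enters with a further factor
    \<open>\<epsilon>\<close>.\<close>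
  have approx: "\<exists>D\<ge>0. \<forall>\<epsilon> t. 0 < \<epsilon> \<and> \<epsilon> \<le> 1 \<and> 0 \<le> t \<and> t \<le> T \<longrightarrow> norm (Q \<epsilon> j t - of_real (\<epsilon> ^ j) * u j t) \<le> D * \<epsilon> ^ Suc j"
    if "j \<le> n" for j
    using that
  proof (induction j)
    case 0
    have "norm (Q \<epsilon> 0 t - 1) \<le> k * W * \<epsilon>" if \<epsilon>: "0 < \<epsilon>" "\<epsilon> \<le> 1" and t: "0 \<le> t" "t \<le> T" for \<epsilon> t
    proof -
      have "norm (Q \<epsilon> 0 t - Q \<epsilon> 0 0) \<le> (\<epsilon> * 1 * k) * (V T - V 0)"
      proof (rule negl_increment_bound_const[OF Q_negl[OF \<epsilon>, of 0, simplified if_True simp_thms]])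
        fix c c' assume c: "0 \<le> c" "c \<le> c'" "c' \<le> T"
        show "norm (0 - (if 0 < n then of_real \<epsilon> * (Q \<epsilon> (Suc 0) c * f 0 c * of_real (A 0 c' - A 0 c)) else 0)) \<le> \<epsilon> * 1 * k * (V c' - V c)"
          using coupling[OF \<epsilon>(1) _ ef(2) n c, of "Q \<epsilon> (Suc 0) c" 1 0 c] Q_bound[OF \<epsilon>, of "Suc 0" c] n c by (simp del: of_real_diff)
      qed (use t \<epsilon> k in auto)
      then show ?thesis by (simp add: Q_start(1)[OF \<epsilon>] W_def mult_ac)
    qed
    then show ?case using k W u0 by (intro exI[of _ "k * W"]) auto
  next
    case (Suc j)
    then obtain D where D: "D \<ge> 0"
      "\<And>\<epsilon> t. 0 < \<epsilon> \<Longrightarrow> \<epsilon> \<le> 1 \<Longrightarrow> 0 \<le> t \<Longrightarrow> t \<le> T \<Longrightarrow> norm (Q \<epsilon> j t - of_real (\<epsilon> ^ j) * u j t) \<le> D * \<epsilon> ^ Suc j"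
      by auto
    define D' where "D' = (D + C ^ Suc (Suc j)) * k * W"
    have "norm (Q \<epsilon> (Suc j) t - of_real (\<epsilon> ^ Suc j) * u (Suc j) t) \<le> D' * \<epsilon> ^ Suc (Suc j)"
      if \<epsilon>: "0 < \<epsilon>" "\<epsilon> \<le> 1" and t: "0 \<le> t" "t \<le> T" for \<epsilon> t
    proof -
      define R where "R t = Q \<epsilon> (Suc j) t - of_real (\<epsilon> ^ Suc j) * u (Suc j) t" for t
      define \<Phi> where "\<Phi> c c' = of_real \<epsilon> * ((Q \<epsilon> j c - of_real (\<epsilon> ^ j) * u j c) * e j c * of_real (A j c' - A j c))
          - (if Suc j < n then of_real \<epsilon> * (Q \<epsilon> (Suc (Suc j)) c * f (Suc j) c * of_real (A (Suc j) c' - A (Suc j) c)) else 0)" for c c'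
      have "negl (\<lambda>c c'. R c' - R c - \<Phi> c c')"
        using negl_diff[OF Q_negl[OF \<epsilon> Suc.prems] negl_cmult[OF u(2)[of j, OF Suc_le_lessD[OF Suc.prems]], of "of_real (\<epsilon> ^ Suc j)"]]
        by (rule negl_cong) (simp add: R_def \<Phi>_def algebra_simps)
      moreover have "norm (\<Phi> c c') \<le> (D + C ^ Suc (Suc j)) * \<epsilon> ^ Suc (Suc j) * k * (V c' - V c)"
        if c: "0 \<le> c" "c \<le> c'" "c' \<le> T" for c c'
      proof -
        have a: "norm (of_real \<epsilon> * ((Q \<epsilon> j c - of_real (\<epsilon> ^ j) * u j c) * e j c * of_real (A j c' - A j c)))
            \<le> \<epsilon> * (D * \<epsilon> ^ Suc j) * k * (V c' - V c)"
          by (rule coupling) (use \<epsilon> D(2)[OF \<epsilon>, of c] ef Suc.prems c in auto)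
        have b: "norm (if Suc j < n then of_real \<epsilon> * (Q \<epsilon> (Suc (Suc j)) c * f (Suc j) c * of_real (A (Suc j) c' - A (Suc j) c)) else 0)
            \<le> C ^ Suc (Suc j) * \<epsilon> ^ Suc (Suc j) * k * (V c' - V c)"
        proof (cases "Suc j < n")
          case True
          have "norm (of_real \<epsilon> * (Q \<epsilon> (Suc (Suc j)) c * f (Suc j) c * of_real (A (Suc j) c' - A (Suc j) c)))
             \<le> \<epsilon> * (C * \<epsilon>) ^ Suc (Suc j) * k * (V c' - V c)"
            by (rule coupling) (use \<epsilon> True small[OF \<epsilon>, of "Suc (Suc j)" "Suc (Suc j)" c] ef c in auto)
          also have "\<dots> \<le> 1 * (C * \<epsilon>) ^ Suc (Suc j) * k * (V c' - V c)"
            using \<epsilon> C k V_le[OF c] by (intro mult_right_mono) auto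
          finally show ?thesis using True by (simp add: power_mult_distrib mult_ac)
        next
          case False
          then show ?thesis using C \<epsilon> k V_le[OF c] by simp
        qed
        show ?thesis unfolding \<Phi>_def
          by (rule order_trans[OF norm_triangle_ineq4 order_trans[OF add_mono[OF a b]]]) (simp add: algebra_simps)
      qed
      ultimately have "norm (R t - R 0) \<le> ((D + C ^ Suc (Suc j)) * \<epsilon> ^ Suc (Suc j) * k) * (V T - V 0)"
        by (rule negl_increment_bound_const) (use t D C k \<epsilon> in auto)
      moreover have "R 0 = 0" using Q_start(2)[OF \<epsilon>, of j] u(1)[of j] Suc.prems by (simp add: R_def)
      ultimately show ?thesis by (simp add: R_def D'_def W_def mult_ac)
    qed
    moreover have "D' \<ge> 0" using D C k W by (simp add: D'_def)
    ultimately show ?case by auto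
  qed
  obtain D where D: "D \<ge> 0" "\<And>\<epsilon>. 0 < \<epsilon> \<Longrightarrow> \<epsilon> \<le> 1 \<Longrightarrow> norm (Q \<epsilon> n T - of_real (\<epsilon> ^ n) * u n T) \<le> D * \<epsilon> ^ Suc n"
    using approx[OF order_refl] T_nonneg by auto
  have "norm (u n T) \<le> D * \<epsilon>" if "0 < \<epsilon>" "\<epsilon> \<le> 1" for \<epsilon>
  proof -
    have "\<epsilon> ^ n * norm (u n T) \<le> \<epsilon> ^ n * (D * \<epsilon>)"
      using D(2)[OF that] Q_end[OF that] that by (simp add: norm_mult norm_power mult_ac)
    then show ?thesis using that by (simp add: mult_le_cancel_left)
  qed
  then have "\<forall>\<^sub>F \<epsilon> in at_right 0. norm (u n T) \<le> D * \<epsilon>"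
    by (auto simp: eventually_at_right_field intro!: exI[of _ 1])
  moreover have "((\<lambda>\<epsilon>. D * \<epsilon>) \<longlongrightarrow> D * 0) (at_right 0)" by (intro tendsto_intros)
  ultimately have "norm (u n T) \<le> D * 0"
    by (intro tendsto_lowerbound[of _ _ "at_right 0"]) auto
  then show ?thesis by simp
qed

section \<open>The chain rule for phases\<close>

text \<open>Factoring out \<open>cis (w * x c)\<close> leaves the first-order Taylor remainder of
  \<open>exp\<close> at 0, which is small relative to the increment of \<open>x\<close>.\<close>

lemma negl_cis:
  assumes "vlip x"
  shows "negl (\<lambda>c c'. cis (w * x c') - cis (w * x c) - \<i> * of_real w * cis (w * x c) * of_real (x c' - x c))"
    and "vlip (\<lambda>t. cis (w * x t))"
proof -
  obtain k where k: "k \<ge> 0"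
    and x: "\<And>c c'. 0 \<le> c \<Longrightarrow> c \<le> c' \<Longrightarrow> c' \<le> T \<Longrightarrow> norm (x c' - x c) \<le> k * (V c' - V c)"
    by (rule vlipE[OF assms]) (rule that)
  show n: "negl (\<lambda>c c'. cis (w * x c') - cis (w * x c) - \<i> * of_real w * cis (w * x c) * of_real (x c' - x c))"
  proof (rule neglI)
    fix e :: real assume "e > 0"
    define e' where "e' = e / ((\<bar>w\<bar> + 1) * (k + 1))"
    have "e' > 0" using \<open>e > 0\<close> k by (simp add: e'_def)
    have "(exp has_derivative (*) (exp 0)) (at (0::complex))"
      using DERIV_exp[of "0::complex"] unfolding has_field_derivative_def .
    then obtain d where d: "d > 0" "\<And>y::complex. norm y < d \<Longrightarrow> norm (exp y - 1 - y) \<le> e' * norm y"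
      using \<open>e' > 0\<close> unfolding has_derivative_at_alt by auto
    have "d / (\<bar>w\<bar> + 1) > 0" using d(1) by simp
    then obtain d' where d': "d' > 0"
      "\<And>s t. 0 \<le> s \<Longrightarrow> s \<le> T \<Longrightarrow> 0 \<le> t \<Longrightarrow> t \<le> T \<Longrightarrow> \<bar>t - s\<bar> < d' \<Longrightarrow> norm (x t - x s) < d / (\<bar>w\<bar> + 1)"
      using uniformly_small_increments[OF vlip_continuous[OF assms]] by metis
    have "norm (cis (w * x c') - cis (w * x c) - \<i> * of_real w * cis (w * x c) * of_real (x c' - x c)) \<le> e * (V c' - V c)"
      if c: "0 \<le> c" "c \<le> c'" "c' \<le> T" "c' - c < d'" for c c'
    proof -
      define y where "y = \<i> * complex_of_real (w * (x c' - x c))"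
      have ny: "norm y = \<bar>w\<bar> * \<bar>x c' - x c\<bar>" by (simp add: y_def norm_mult abs_mult del: of_real_mult of_real_diff)
      have xs: "\<bar>x c' - x c\<bar> < d / (\<bar>w\<bar> + 1)" using d'(2)[of c c'] c by simp
      have "norm y \<le> (\<bar>w\<bar> + 1) * \<bar>x c' - x c\<bar>" unfolding ny by (intro mult_right_mono) auto
      also have "\<dots> < (\<bar>w\<bar> + 1) * (d / (\<bar>w\<bar> + 1))" using xs by (intro mult_strict_left_mono) auto
      finally have yd: "norm y < d" by simp
      have "cis (w * x c') = cis (w * x c) * exp y"
        unfolding y_def cis_conv_exp exp_add[symmetric] by (simp add: algebra_simps)
      then have "cis (w * x c') - cis (w * x c) - \<i> * of_real w * cis (w * x c) * of_real (x c' - x c)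
          = cis (w * x c) * (exp y - 1 - y)"
        by (simp add: y_def algebra_simps)
      then have "norm (cis (w * x c') - cis (w * x c) - \<i> * of_real w * cis (w * x c) * of_real (x c' - x c))
          = norm (exp y - 1 - y)"
        by (simp add: norm_mult)
      also have "\<dots> \<le> e' * norm y" by (rule d(2)[OF yd])
      also have "\<dots> \<le> e' * ((\<bar>w\<bar> + 1) * ((k + 1) * (V c' - V c)))"
      proof (rule mult_left_mono)
        have "\<bar>x c' - x c\<bar> \<le> (k + 1) * (V c' - V c)"
          using x[OF c(1-3)] V_le[OF c(1-3)] by (simp add: distrib_right)
        then show "norm y \<le> (\<bar>w\<bar> + 1) * ((k + 1) * (V c' - V c))"
          unfolding ny by (intro mult_mono) auto
      qed (use \<open>e' > 0\<close> in simp)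
      also have "\<dots> = e * (V c' - V c)"
      proof -
        have "\<bar>w\<bar> + 1 \<noteq> 0" "k + 1 \<noteq> 0" using k by linarith+
        then show ?thesis by (simp add: e'_def)
      qed
      finally show ?thesis .
    qed
    then show "\<exists>d>0. \<forall>c c'. 0 \<le> c \<and> c \<le> c' \<and> c' \<le> T \<and> c' - c < d \<longrightarrow>
        norm (cis (w * x c') - cis (w * x c) - \<i> * of_real w * cis (w * x c) * of_real (x c' - x c)) \<le> e * (V c' - V c)"
      using d'(1) by auto
  qed
  have cont: "continuous_on {0..T} (\<lambda>t. cis (w * x t))"
    unfolding cis_conv_exp by (intro continuous_intros vlip_continuous assms)
  show "vlip (\<lambda>t. cis (w * x t))"
  proof (rule dint_vlip)
    show "dint (\<lambda>t. cis (w * x t)) (\<lambda>t. \<i> * of_real w * cis (w * x t)) (\<lambda>t. of_real (x t))"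
      unfolding dint_def using n by simp
    show "continuous_on {0..T} (\<lambda>t. \<i> * of_real w * cis (w * x t))"
      by (intro continuous_intros cont)
    show "vlip (\<lambda>t. complex_of_real (x t))"
      by (rule vlip_bounded_linear[OF assms bounded_linear_of_real])
  qed
qed

end

section \<open>The ladder of skew-Hermitian matrices\<close>

context resonant_path
begin

text \<open>Letter 0 goes with \<open>lf\<close> and generates the phases; letter
  \<open>Suc b\<close> couples the neighbours \<open>b\<close> and \<open>Suc b\<close>. The sign of
  the lower entry is forced by skewness.\<close>

definition ladder_matrix :: "(nat \<Rightarrow> real) \<Rightarrow> real \<Rightarrow> nat \<Rightarrow> nat \<Rightarrow> nat \<Rightarrow> complex" where
  "ladder_matrix \<theta> \<epsilon> a i j = (case a of 0 \<Rightarrow> if i = j then \<i> * of_real (\<theta> i) else 0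
     | Suc b \<Rightarrow> if i = b \<and> j = Suc b then of_real \<epsilon> else if i = Suc b \<and> j = b then - of_real \<epsilon> else 0)"

lemma ladder_matrix_skew: "cnj (ladder_matrix \<theta> \<epsilon> a i j) = - ladder_matrix \<theta> \<epsilon> a j i"
  by (auto simp: ladder_matrix_def split: nat.split)

lemma ladder_matrix_sum:
  fixes q :: "nat \<Rightarrow> complex" and z :: "nat \<Rightarrow> complex"
  assumes "j \<le> n"
  shows "(\<Sum>i<Suc n. q i * (\<Sum>a<Suc n. ladder_matrix \<theta> \<epsilon> a i j * z a))
    = q j * (\<i> * of_real (\<theta> j)) * z 0
      + (if j = 0 then 0 else of_real \<epsilon> * (q (j - 1) * z j))
      - (if j < n then of_real \<epsilon> * (q (Suc j) * z (Suc j)) else 0)"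
proof -
  have "(\<Sum>i<Suc n. q i * (\<Sum>a<Suc n. ladder_matrix \<theta> \<epsilon> a i j * z a))
     = (\<Sum>a<Suc n. \<Sum>i<Suc n. q i * ladder_matrix \<theta> \<epsilon> a i j * z a)"
    unfolding sum_distrib_left by (subst sum.swap) (simp only: mult.assoc)
  also have "\<dots> = (\<Sum>i<Suc n. q i * ladder_matrix \<theta> \<epsilon> 0 i j * z 0)
      + (\<Sum>b<n. \<Sum>i<Suc n. q i * ladder_matrix \<theta> \<epsilon> (Suc b) i j * z (Suc b))"
    by (rule sum.lessThan_Suc_shift)
  also have "(\<Sum>i<Suc n. q i * ladder_matrix \<theta> \<epsilon> 0 i j * z 0)
      = (\<Sum>i<Suc n. if i = j then q j * (\<i> * of_real (\<theta> j)) * z 0 else 0)"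
    by (intro sum.cong refl) (auto simp: ladder_matrix_def)
  also have "\<dots> = q j * (\<i> * of_real (\<theta> j)) * z 0" using assms by simp
  also have "(\<Sum>b<n. \<Sum>i<Suc n. q i * ladder_matrix \<theta> \<epsilon> (Suc b) i j * z (Suc b))
      = (\<Sum>b<n. (if Suc b = j then of_real \<epsilon> * (q b * z j) else 0) - (if b = j then of_real \<epsilon> * (q (Suc j) * z (Suc j)) else 0))"
  proof (intro sum.cong refl)
    fix b assume b: "b \<in> {..<n}"
    have "(\<Sum>i<Suc n. q i * ladder_matrix \<theta> \<epsilon> (Suc b) i j * z (Suc b))
      = (\<Sum>i<Suc n. (if i = b then (if Suc b = j then of_real \<epsilon> * (q b * z j) else 0) else 0)
          - (if i = Suc b then (if b = j then of_real \<epsilon> * (q (Suc j) * z (Suc j)) else 0) else 0))"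
      by (intro sum.cong refl) (auto simp: ladder_matrix_def)
    also have "\<dots> = (if Suc b = j then of_real \<epsilon> * (q b * z j) else 0) - (if b = j then of_real \<epsilon> * (q (Suc j) * z (Suc j)) else 0)"
      unfolding sum_subtractf using b by (subst sum.delta, simp, subst sum.delta) auto
    finally show "(\<Sum>i<Suc n. q i * ladder_matrix \<theta> \<epsilon> (Suc b) i j * z (Suc b))
      = (if Suc b = j then of_real \<epsilon> * (q b * z j) else 0) - (if b = j then of_real \<epsilon> * (q (Suc j) * z (Suc j)) else 0)" .
  qed
  also have "\<dots> = (if j = 0 then 0 else of_real \<epsilon> * (q (j - 1) * z j))
      - (if j < n then of_real \<epsilon> * (q (Suc j) * z (Suc j)) else 0)"
    unfolding sum_subtractf
  proof (intro arg_cong2[where f = "(-)"])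
    show "(\<Sum>b<n. if Suc b = j then of_real \<epsilon> * (q b * z j) else 0) = (if j = 0 then 0 else of_real \<epsilon> * (q (j - 1) * z j))"
    proof (cases j)
      case (Suc i)
      have "(\<Sum>b<n. if Suc b = j then of_real \<epsilon> * (q b * z j) else 0) = (\<Sum>b<n. if b = i then of_real \<epsilon> * (q i * z j) else 0)"
        by (intro sum.cong refl) (auto simp: Suc)
      then show ?thesis using Suc assms by simp
    qed simp
    show "(\<Sum>b<n. if b = j then of_real \<epsilon> * (q (Suc j) * z (Suc j)) else 0)
       = (if j < n then of_real \<epsilon> * (q (Suc j) * z (Suc j)) else 0)" by simp
  qed
  finally show ?thesis by simp
qed

text \<open>The frequencies are prescribed and the phases of the ladder are adapted to them; the
  \<open>u j\<close> are the partial iterated integrals of the word. One rung per letter, in the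
  order of the word, is what isolates a single word instead of a linear combination of
  words.\<close>

lemma word_integral_zero:
  fixes n :: nat and \<omega> :: "nat \<Rightarrow> real" and \<alpha> :: "nat \<Rightarrow> 'v covector" and u :: "nat \<Rightarrow> real \<Rightarrow> complex"
  assumes V: "control V T'" "control.tame V T' \<beta>" and n: "n > 0"
    and \<alpha>: "\<And>j. j < n \<Longrightarrow> cov (\<alpha> j) v = 0"
    and \<omega>: "\<And>j. j < n \<Longrightarrow> real m * \<omega> j \<in> (\<lambda>k. 2 * pi * k) ` \<int>"
    and u0: "\<And>t. 0 \<le> t \<Longrightarrow> t \<le> T' \<Longrightarrow> u 0 t = 1" and u1: "\<And>j. j < n \<Longrightarrow> u (Suc j) 0 = 0"
    and u: "\<And>j. j < n \<Longrightarrow> control.negl V T' (\<lambda>c c'. u (Suc j) c' - u (Suc j) c -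
          u j c * cis (\<omega> j * cov lf (\<beta> c)) * of_real (cov (\<alpha> j) (\<beta> c') - cov (\<alpha> j) (\<beta> c)))"
  shows "u n T' = 0"
proof -
  interpret control V T' by fact
  \<comment> \<open>Negative partial sums give
    \<open>\<theta> j - \<theta> (Suc j) = \<omega> j\<close>; integer multiples of
    \<open>2 \<pi> / m\<close> are closed under addition, so the phases stay resonant.\<close>
  define \<theta> where "\<theta> j = - (\<Sum>i<j. \<omega> i)" for j
  define fe where "fe = (\<lambda>a. case a of 0 \<Rightarrow> lf | Suc b \<Rightarrow> \<alpha> b)"
  define x where "x t = cov lf (\<beta> t)" for t
  have fe: "fe 0 = lf" "fe (Suc j) = \<alpha> j" for j by (simp_all add: fe_def)
  have dev: "development V T' \<beta>"
    by (intro development.intro V(1) development_axioms.intro V(2))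
  have res: "real m * \<theta> i \<in> (\<lambda>k. 2 * pi * k) ` \<int>" if "i \<le> n" for i
    using that
  proof (induction i)
    case 0
    have "real m * \<theta> 0 = 2 * pi * of_int 0" by (simp add: \<theta>_def)
    then show ?case using Ints_0 by (intro image_eqI[of _ _ 0]) auto
  next
    case (Suc i)
    obtain k1 where k1: "real m * \<theta> i = 2 * pi * k1" "k1 \<in> \<int>" using Suc by auto
    obtain k2 where k2: "real m * \<omega> i = 2 * pi * k2" "k2 \<in> \<int>" using \<omega>[of i] Suc.prems by auto
    have "real m * \<theta> (Suc i) = 2 * pi * (k1 - k2)"
      using k1(1) k2(1) by (simp add: \<theta>_def algebra_simps)
    then show ?case using k1(2) k2(2) by (intro image_eqI[of _ _ "k1 - k2"]) auto
  qed
  define D where "D \<epsilon> = development.Y (Suc n) (Suc n) fe (ladder_matrix \<theta> \<epsilon>) \<beta>" for \<epsilon>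
  \<comment> \<open>Passing to the rotating frame removes the diagonal term
    \<open>\<i> \<theta> j dx\<close> and moves the phases into the couplings.\<close>
  define Q where "Q \<epsilon> j t = D \<epsilon> 0 j t * cis (- \<theta> j * x t)" for \<epsilon> j t
  obtain k where k: "k \<ge> 0"
    "\<And>a c c'. a < Suc n \<Longrightarrow> 0 \<le> c \<Longrightarrow> c \<le> c' \<Longrightarrow> c' \<le> T' \<Longrightarrow> \<bar>cov (fe a) (\<beta> c') - cov (fe a) (\<beta> c)\<bar> \<le> k * (V c' - V c)"
    by (rule development.letters_lipschitz[OF dev]) (rule that)
  have vx: "vlip x" unfolding x_def[abs_def] using V(2) by (simp add: tame_def)
  show ?thesis
  proof (rule ladder_limit[where Q = Q and e = "\<lambda>j c. cis (\<omega> j * x c)" and f = "\<lambda>j c. cis (- \<omega> j * x c)"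
        and A = "\<lambda>j t. cov (\<alpha> j) (\<beta> t)" and k = k, OF n k(1)])
    show "\<bar>cov (\<alpha> j) (\<beta> c') - cov (\<alpha> j) (\<beta> c)\<bar> \<le> k * (V c' - V c)"
      if "j < n" "0 \<le> c" "c \<le> c'" "c' \<le> T'" for j c c'
      using k(2)[of "Suc j" c c'] that by (simp add: fe)
    show "negl (\<lambda>c c'. u (Suc j) c' - u (Suc j) c -
          u j c * cis (\<omega> j * x c) * of_real (cov (\<alpha> j) (\<beta> c') - cov (\<alpha> j) (\<beta> c)))" if "j < n" for j
      using u[OF that] by (simp only: x_def)
  next
    fix \<epsilon> :: real
    interpret development V T' "Suc n" "Suc n" fe "ladder_matrix \<theta> \<epsilon>" \<beta> by (rule dev)
    have Y: "D \<epsilon> = Y" by (simp add: D_def)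
    have norm_Q: "norm (Q \<epsilon> j t) = norm (Y 0 j t)" for j t by (simp add: Q_def Y norm_mult)
    show "Q \<epsilon> 0 0 = 1" by (simp add: Q_def Y Y_0 \<theta>_def)
    show "Q \<epsilon> (Suc j) 0 = 0" if "j < n" for j using that by (simp add: Q_def Y Y_0)
    show "norm (Q \<epsilon> j t) \<le> 1" if "j \<le> n" "0 \<le> t" "t \<le> T'" for j t
    proof -
      have "(norm (Y 0 j t))\<^sup>2 \<le> (\<Sum>k<Suc n. (norm (Y 0 k t))\<^sup>2)"
        using that(1) by (intro member_le_sum[where f = "\<lambda>k. (norm (Y 0 k t))\<^sup>2"]) auto
      also have "\<dots> = 1" by (rule row_norm[OF ladder_matrix_skew _ that(2,3)]) simp
      finally show ?thesis unfolding norm_Q by (simp add: abs_square_le_1)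
    qed
    show "Q \<epsilon> n T' = 0"
    proof -
      have "(\<Sum>i<Suc n. Y i i T') = of_nat (Suc n)"
        by (rule trace_development[where fe = fe and \<theta> = \<theta> and M = "ladder_matrix \<theta> \<epsilon>", OF dev fe(1)])
           (use \<alpha> res in \<open>auto simp: fe_def ladder_matrix_def split: nat.split\<close>)
      then have "Y 0 n T' = 0"
        by (intro row_off_diagonal_zero[OF ladder_matrix_skew]) (use n in auto)
      then show ?thesis by (simp add: Q_def Y)
    qed
    show "negl (\<lambda>c c'. Q \<epsilon> j c' - Q \<epsilon> j c -
        ((if j = 0 then 0 else of_real \<epsilon> * (Q \<epsilon> (j - 1) c * cis (\<omega> (j - 1) * x c) * of_real (cov (\<alpha> (j - 1)) (\<beta> c') - cov (\<alpha> (j - 1)) (\<beta> c))))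
         - (if j < n then of_real \<epsilon> * (Q \<epsilon> (Suc j) c * cis (- \<omega> j * x c) * of_real (cov (\<alpha> j) (\<beta> c') - cov (\<alpha> j) (\<beta> c))) else 0)))"
      if j: "j \<le> n" for j
    proof -
      define ex where "ex t = cis (- \<theta> j * x t)" for t
      have ex: "vlip ex" "negl (\<lambda>c c'. ex c' - ex c - \<i> * of_real (- \<theta> j) * ex c * of_real (x c' - x c))"
        unfolding ex_def[abs_def] by (rule negl_cis[OF vx])+
      have Yj: "vlip (Y 0 j)" "negl (\<lambda>c c'. Y 0 j c' - Y 0 j c - (\<Sum>q<Suc n. Y 0 q c * dA q j c c'))"
        by (rule Y_negl_vlip(2), use j in simp) (rule Y_negl_vlip(1), use j in simp)
      have "negl (\<lambda>c c'. ((Y 0 j c' * ex c' - Y 0 j c * ex c) - (Y 0 j c * (ex c' - ex c) + ex c * (Y 0 j c' - Y 0 j c)))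
         + Y 0 j c * (ex c' - ex c - \<i> * of_real (- \<theta> j) * ex c * of_real (x c' - x c))
         + ex c * (Y 0 j c' - Y 0 j c - (\<Sum>q<Suc n. Y 0 q c * dA q j c c')))"
        by (intro negl_add dint_product negl_mult_continuous vlip_continuous ex Yj)
      then show ?thesis
      proof (rule negl_cong)
        fix c c'
        define z where "z a = complex_of_real (cov (fe a) (\<beta> c') - cov (fe a) (\<beta> c))" for a
        have S: "(\<Sum>q<Suc n. Y 0 q c * dA q j c c') = Y 0 j c * (\<i> * of_real (\<theta> j)) * z 0
            + (if j = 0 then 0 else of_real \<epsilon> * (Y 0 (j - 1) c * z j))
            - (if j < n then of_real \<epsilon> * (Y 0 (Suc j) c * z (Suc j)) else 0)"
          unfolding dA_def z_def[symmetric] by (rule ladder_matrix_sum[OF j])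
        have z0: "z 0 = of_real (x c' - x c)" by (simp add: z_def fe x_def)
        have low: "ex c * Y 0 (j - 1) c = Q \<epsilon> (j - 1) c * cis (\<omega> (j - 1) * x c)" if j0: "j \<noteq> 0"
        proof -
          obtain i where i: "j = Suc i" using j0 not0_implies_Suc by auto
          have "ex c = cis (- \<theta> i * x c) * cis (\<omega> i * x c)"
            by (simp add: ex_def cis_mult i \<theta>_def algebra_simps)
          then show ?thesis by (simp add: Q_def Y i)
        qed
        have high: "ex c * Y 0 (Suc j) c = Q \<epsilon> (Suc j) c * cis (- \<omega> j * x c)"
        proof -
          have "ex c = cis (- \<theta> (Suc j) * x c) * cis (- \<omega> j * x c)"
            unfolding ex_def cis_mult by (simp add: \<theta>_def algebra_simps)
          then show ?thesis by (simp add: Q_def Y)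
        qed
        have zl: "z j = of_real (cov (\<alpha> (j - 1)) (\<beta> c') - cov (\<alpha> (j - 1)) (\<beta> c))" if "j \<noteq> 0"
          using that by (cases j) (simp_all add: z_def fe)
        have zh: "z (Suc j) = of_real (cov (\<alpha> j) (\<beta> c') - cov (\<alpha> j) (\<beta> c))" by (simp add: z_def fe)
        have l: "(if j = 0 then 0 else of_real \<epsilon> * (Q \<epsilon> (j - 1) c * cis (\<omega> (j - 1) * x c) * of_real (cov (\<alpha> (j - 1)) (\<beta> c') - cov (\<alpha> (j - 1)) (\<beta> c))))
           = ex c * (if j = 0 then 0 else of_real \<epsilon> * (Y 0 (j - 1) c * z j))"
        proof (cases "j = 0")
          case False
          show ?thesis unfolding low[OF False, symmetric] zl[OF False, symmetric] using False by simp
        qed simp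
        have h: "(if j < n then of_real \<epsilon> * (Q \<epsilon> (Suc j) c * cis (- \<omega> j * x c) * of_real (cov (\<alpha> j) (\<beta> c') - cov (\<alpha> j) (\<beta> c))) else 0)
           = ex c * (if j < n then of_real \<epsilon> * (Y 0 (Suc j) c * z (Suc j)) else 0)"
          unfolding high[symmetric] zh[symmetric] by simp
        have q: "Q \<epsilon> j t = Y 0 j t * ex t" for t by (simp add: Q_def ex_def Y)
        show "Q \<epsilon> j c' - Q \<epsilon> j c -
          ((if j = 0 then 0 else of_real \<epsilon> * (Q \<epsilon> (j - 1) c * cis (\<omega> (j - 1) * x c) * of_real (cov (\<alpha> (j - 1)) (\<beta> c') - cov (\<alpha> (j - 1)) (\<beta> c))))
           - (if j < n then of_real \<epsilon> * (Q \<epsilon> (Suc j) c * cis (- \<omega> j * x c) * of_real (cov (\<alpha> j) (\<beta> c') - cov (\<alpha> j) (\<beta> c))) else 0))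
         = ((Y 0 j c' * ex c' - Y 0 j c * ex c) - (Y 0 j c * (ex c' - ex c) + ex c * (Y 0 j c' - Y 0 j c)))
         + Y 0 j c * (ex c' - ex c - \<i> * of_real (- \<theta> j) * ex c * of_real (x c' - x c))
         + ex c * (Y 0 j c' - Y 0 j c - (\<Sum>q<Suc n. Y 0 q c * dA q j c c'))"
          unfolding l h q S z0 by (simp only: of_real_minus) (simp only: ring_distribs mult_minus_left mult_minus_right, simp add: mult_ac)
      qed
    qed
  qed (use u0 u1 in auto)
qed

end


section \<open>The decorated path\<close>

lemma (in control) dint_cnj:
  assumes "dint J f g"
  shows "dint (\<lambda>t. cnj (J t)) (\<lambda>t. cnj (f t)) (\<lambda>t. cnj (g t))"
  unfolding dint_def
proof (rule negl_bounded_by[OF assms[unfolded dint_def], where K = 1])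
  fix c c'
  have "cnj (J c') - cnj (J c) - cnj (f c) * (cnj (g c') - cnj (g c)) = cnj (J c' - J c - f c * (g c' - g c))"
    by simp
  then show "norm (cnj (J c') - cnj (J c) - cnj (f c) * (cnj (g c') - cnj (g c))) \<le> 1 * norm (J c' - J c - f c * (g c' - g c))"
    by (simp only: complex_mod_cnj mult_1 order_refl)
qed

text \<open>Compares Riemann sums directly, because the pairing of scalars with vectors in
  \<open>deco_path\<close> is not the multiplication of a normed algebra to which
  \<open>dint\<close> applies.\<close>

lemma has_rs_integral_linear_combination:
  assumes "finite B"
    and int: "\<And>b. b \<in> B \<Longrightarrow> has_rs_integral prd (f b) (g b) a c (I b)"
    and h: "\<And>b. b \<in> B \<Longrightarrow> bounded_linear (h b)"
    and eq: "\<And>x s s'. prd' (F x) (G s' - G s) = (\<Sum>b\<in>B. h b (prd (f b x) (g b s' - g b s)))"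
  shows "has_rs_integral prd' F G a c (\<Sum>b\<in>B. h b (I b))"
proof -
  define S where "S p b = (\<Sum>(x, K)\<in>p. prd (f b x) (g b (Sup K) - g b (Inf K)))" for p b
  have "\<exists>d>0. \<forall>p. p tagged_division_of {a..c} \<and> (\<lambda>x. ball x d) fine p \<longrightarrow>
      norm ((\<Sum>b\<in>B. h b (S p b)) - (\<Sum>b\<in>B. h b (I b))) < e" if "e > 0" for e
    using assms(1-3) that
  proof (induction B arbitrary: e rule: finite_induct)
    case empty
    then show ?case by (intro exI[of _ 1]) auto
  next
    case (insert b B)
    have hb: "bounded_linear (h b)" using insert.prems by simp
    obtain K where K: "K > 0" "\<And>x. norm (h b x) \<le> norm x * K"
      using bounded_linear.pos_bounded[OF hb] by auto
    have "e / 2 / K > 0" using insert.prems K by simp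
    then obtain d1 where d1: "d1 > 0" "\<And>p. p tagged_division_of {a..c} \<Longrightarrow> (\<lambda>x. ball x d1) fine p \<Longrightarrow> norm (S p b - I b) < e / 2 / K"
      using insert.prems(1)[of b] unfolding has_rs_integral_def S_def by auto
    obtain d2 where d2: "d2 > 0" "\<And>p. p tagged_division_of {a..c} \<Longrightarrow> (\<lambda>x. ball x d2) fine p \<Longrightarrow>
        norm ((\<Sum>b\<in>B. h b (S p b)) - (\<Sum>b\<in>B. h b (I b))) < e / 2"
      using insert.IH[of "e / 2"] insert.prems by auto
    have "norm ((\<Sum>b\<in>insert b B. h b (S p b)) - (\<Sum>b\<in>insert b B. h b (I b))) < e"
      if p: "p tagged_division_of {a..c}" "(\<lambda>x. ball x (min d1 d2)) fine p" for p
    proof -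
      have fine: "(\<lambda>x. ball x d1) fine p" "(\<lambda>x. ball x d2) fine p"
        using fineD[OF p(2)] subset_ball[of "min d1 d2" d1] subset_ball[of "min d1 d2" d2]
        by (auto intro!: fineI simp: subset_eq)
      have "norm (h b (S p b) - h b (I b)) \<le> norm (S p b - I b) * K"
        using K(2)[of "S p b - I b"] by (simp add: linear_diff[OF bounded_linear.linear[OF hb]])
      also have "\<dots> < e / 2 / K * K" using d1(2)[OF p(1) fine(1)] K(1) by (intro mult_strict_right_mono)
      also have "\<dots> = e / 2" using K(1) by simp
      finally have 1: "norm (h b (S p b) - h b (I b)) < e / 2" .
      have "norm ((\<Sum>b\<in>insert b B. h b (S p b)) - (\<Sum>b\<in>insert b B. h b (I b)))
          = norm ((h b (S p b) - h b (I b)) + ((\<Sum>b\<in>B. h b (S p b)) - (\<Sum>b\<in>B. h b (I b))))"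
        using insert.hyps by (simp add: algebra_simps)
      also have "\<dots> \<le> norm (h b (S p b) - h b (I b)) + norm ((\<Sum>b\<in>B. h b (S p b)) - (\<Sum>b\<in>B. h b (I b)))"
        by (rule norm_triangle_ineq)
      finally show ?thesis using 1 d2(2)[OF p(1) fine(2)] by linarith
    qed
    then show ?case using d1(1) d2(1) by (intro exI[of _ "min d1 d2"]) auto
  qed
  moreover have "(\<Sum>(x, K)\<in>p. prd' (F x) (G (Sup K) - G (Inf K))) = (\<Sum>b\<in>B. h b (S p b))" for p
  proof -
    have "(\<Sum>(x, K)\<in>p. prd' (F x) (G (Sup K) - G (Inf K)))
       = (\<Sum>xK\<in>p. \<Sum>b\<in>B. h b (case xK of (x, K) \<Rightarrow> prd (f b x) (g b (Sup K) - g b (Inf K))))"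
      by (simp add: eq case_prod_unfold)
    also have "\<dots> = (\<Sum>b\<in>B. \<Sum>xK\<in>p. h b (case xK of (x, K) \<Rightarrow> prd (f b x) (g b (Sup K) - g b (Inf K))))"
      by (rule sum.swap)
    also have "\<dots> = (\<Sum>b\<in>B. h b (S p b))"
      unfolding S_def by (intro sum.cong refl linear_sum[symmetric] bounded_linear.linear h)
    finally show ?thesis .
  qed
  ultimately show ?thesis unfolding has_rs_integral_def by simp
qed

lemma has_rs_integral_cong:
  assumes "\<And>x. a \<le> x \<Longrightarrow> x \<le> b \<Longrightarrow> f x = f' x" "\<And>x. a \<le> x \<Longrightarrow> x \<le> b \<Longrightarrow> g x = g' x"
  shows "has_rs_integral prd f g a b = has_rs_integral prd f' g' a b"
proof -
  have eq: "(\<Sum>(x, K)\<in>p. prd (f x) (g (Sup K) - g (Inf K))) = (\<Sum>(x, K)\<in>p. prd (f' x) (g' (Sup K) - g' (Inf K)))"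
    if p: "p tagged_division_of {a..b}" for p
  proof (rule sum.cong[OF refl], clarify)
    fix x K assume xK: "(x, K) \<in> p"
    obtain c d where K: "K = {c..d}" using tagged_division_ofD(4)[OF p xK] by auto
    have x: "x \<in> K" "K \<subseteq> {a..b}" using tagged_division_ofD(2,3)[OF p xK] by auto
    then have "c \<le> d" "c \<in> {a..b}" "d \<in> {a..b}" "x \<in> {a..b}" using K by auto
    then show "prd (f x) (g (Sup K) - g (Inf K)) = prd (f' x) (g' (Sup K) - g' (Inf K))"
      using assms K by simp
  qed
  show ?thesis
    unfolding has_rs_integral_def fun_eq_iff
    by (intro allI iff_allI iff_exI imp_cong conj_cong refl) (simp only: eq)
qed

lemma rs_integral_cong:
  assumes "\<And>x. a \<le> x \<Longrightarrow> x \<le> b \<Longrightarrow> f x = f' x" "\<And>x. a \<le> x \<Longrightarrow> x \<le> b \<Longrightarrow> g x = g' x"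
  shows "rs_integral prd f g a b = rs_integral prd f' g' a b"
  unfolding rs_integral_def using has_rs_integral_cong[of a b f f' g g' prd] assms by simp

lemma sum_fun_apply: "(\<Sum>i\<in>I. F i) x = (\<Sum>i\<in>I. F i x :: 'b::comm_monoid_add)"
  by (induction I rule: infinite_finite_induct) (auto simp: plus_fun_def zero_fun_def)

lemma cscale_real: "cscale c (w, 0) = (Re c *\<^sub>R w, Im c *\<^sub>R w)"
  by (simp add: cscale_def)

lemma cscale_cscale: "cscale c (cscale c' z) = cscale (c * c') z"
  by (simp add: cscale_def prod_eq_iff algebra_simps)

lemma cscale_sum: "cscale c (\<Sum>i\<in>I. z i) = (\<Sum>i\<in>I. cscale c (z i))"
  by (induction I rule: infinite_finite_induct) (auto simp: cscale_def prod_eq_iff algebra_simps)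

lemma bounded_linear_cscale: "bounded_linear (\<lambda>c. cscale c (w :: 'v::real_normed_vector, 0))"
  unfolding cscale_real
  by (intro bounded_linear_Pair bounded_linear_compose[OF bounded_linear_scaleR_left]
      bounded_linear_Re bounded_linear_Im)

lemma deco_path_outside: "\<omega> \<notin> \<Lambda> \<Longrightarrow> deco_path \<Lambda> l v \<eta> t \<omega> = 0"
  by (simp add: deco_path_def)

lemma deco_path_cong:
  assumes "\<And>s. 0 \<le> s \<Longrightarrow> s \<le> t \<Longrightarrow> \<eta> s = \<eta>' s"
  shows "deco_path \<Lambda> l v \<eta> t = deco_path \<Lambda> l v \<eta>' t"
  unfolding deco_path_def
  by (rule ext) (auto intro!: rs_integral_cong simp: assms)

lemma deco_rot_power:
  assumes "\<And>\<omega>. \<omega> \<notin> \<Lambda> \<Longrightarrow> z \<omega> = 0"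
  shows "(deco_rot \<Lambda> ^^ k) z = (\<lambda>\<omega>. if \<omega> \<in> \<Lambda> then cscale (cis (real k * \<omega>)) (z \<omega>) else 0)"
proof (induction k)
  case 0
  then show ?case using assms by (auto simp: fun_eq_iff cscale_def)
next
  case (Suc k)
  have "(deco_rot \<Lambda> ^^ Suc k) z = deco_rot \<Lambda> (\<lambda>\<omega>. if \<omega> \<in> \<Lambda> then cscale (cis (real k * \<omega>)) (z \<omega>) else 0)"
    using Suc by simp
  also have "\<dots> = (\<lambda>\<omega>. if \<omega> \<in> \<Lambda> then cscale (cis (real (Suc k) * \<omega>)) (z \<omega>) else 0)"
    by (auto simp: deco_rot_def fun_eq_iff cscale_cscale cis_mult algebra_simps)
  finally show ?case .
qed

lemma path_sig_linear_image_power: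
  assumes "linear A"
  shows "path_sig T (\<lambda>t. (A ^^ k) (\<eta> t)) = (tmap A ^^ k) (path_sig T \<eta>)"
proof (induction k)
  case (Suc k)
  then show ?case using path_sig_linear_image[OF assms, of T "\<lambda>t. (A ^^ k) (\<eta> t)"] by simp
qed simp

section \<open>Coordinates and letters of decorated paths\<close>

locale decoration = dual_basis B cb
  for B :: "'v::real_normed_vector set" and cb :: "'v \<Rightarrow> 'v covector" +
  fixes lf :: "'v covector" and v :: 'v and \<Lambda> :: "real set"
  assumes lf_v: "cov lf v = 1" and finite_\<Lambda>: "finite \<Lambda>"
begin

text \<open>The coordinate functionals of the transverse part \<open>X\<close>, extended to the
  whole space so that they vanish on \<open>v\<close>.\<close>

definition pr :: "'v \<Rightarrow> 'v covector" where
  "pr b = Abs_covector (\<lambda>y. cov (cb b) (y - cov lf y *\<^sub>R v))"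

lemma cov_pr: "cov (pr b) y = cov (cb b) (y - cov lf y *\<^sub>R v)"
proof -
  have "linear (\<lambda>y. cov (cb b) (y - cov lf y *\<^sub>R v))"
    by (rule linearI) (simp_all add: cov_simps algebra_simps)
  then show ?thesis unfolding pr_def by (simp add: cov_Abs_covector)
qed

lemma cov_pr_v: "cov (pr b) v = 0"
  by (simp add: cov_pr lf_v cov_simps)

text \<open>The coefficient of \<open>b\<close> in the component at frequency
  \<open>\<omega>\<close> of the decorated path; see \<open>deco_eq\<close>.\<close>

definition E :: "(real \<Rightarrow> 'v) \<Rightarrow> real \<Rightarrow> 'v \<Rightarrow> real \<Rightarrow> complex" where
  "E \<eta> \<omega> b = rs_integral (*) (\<lambda>s. cis (\<omega> * cov lf (\<eta> s))) (\<lambda>s. of_real (cov (pr b) (\<eta> s))) 0"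

lemma E_dint:
  assumes "control V S" "control.tame V S \<eta>"
  shows "control.dint V S (E \<eta> \<omega> b) (\<lambda>t. cis (\<omega> * cov lf (\<eta> t))) (\<lambda>t. of_real (cov (pr b) (\<eta> t)))"
    and "E \<eta> \<omega> b 0 = 0" and "control.vlip V S (E \<eta> \<omega> b)"
    and "\<And>t. 0 \<le> t \<Longrightarrow> t \<le> S \<Longrightarrow> has_rs_integral (*) (\<lambda>s. cis (\<omega> * cov lf (\<eta> s))) (\<lambda>s. of_real (cov (pr b) (\<eta> s))) 0 t (E \<eta> \<omega> b t)"
proof -
  interpret control V S by fact
  have v: "vlip (\<lambda>t. cov f (\<eta> t))" for f using assms(2) by (simp add: tame_def)
  have c: "continuous_on {0..S} (\<lambda>t. cis (\<omega> * cov lf (\<eta> t)))"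
    by (intro vlip_continuous negl_cis(2) v)
  have g: "vlip (\<lambda>t. complex_of_real (cov (pr b) (\<eta> t)))"
    by (rule vlip_bounded_linear[OF v bounded_linear_of_real])
  show d: "dint (E \<eta> \<omega> b) (\<lambda>t. cis (\<omega> * cov lf (\<eta> t))) (\<lambda>t. of_real (cov (pr b) (\<eta> t)))"
    unfolding E_def by (rule dint_rs_integral(1)[OF c g])
  show "E \<eta> \<omega> b 0 = 0" unfolding E_def by (rule dint_rs_integral(2)[OF c g])
  show "vlip (E \<eta> \<omega> b)" by (rule dint_vlip[OF d c g])
  show "has_rs_integral (*) (\<lambda>s. cis (\<omega> * cov lf (\<eta> s))) (\<lambda>s. of_real (cov (pr b) (\<eta> s))) 0 t (E \<eta> \<omega> b t)"
    if "0 \<le> t" "t \<le> S" for t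
    unfolding E_def by (rule dint_rs_integral(3)[OF c g that])
qed

abbreviation deco :: "(real \<Rightarrow> 'v) \<Rightarrow> real \<Rightarrow> real \<Rightarrow> 'v cplx" where
  "deco \<equiv> deco_path \<Lambda> (cov lf) v"

lemma deco_eq:
  assumes "control V S" "control.tame V S \<eta>" "0 \<le> t" "t \<le> S" "\<omega> \<in> \<Lambda>"
  shows "deco \<eta> t \<omega> = (\<Sum>b\<in>B. cscale (E \<eta> \<omega> b t) (b, 0))"
proof -
  have "has_rs_integral (\<lambda>c w. cscale c (w, 0)) (\<lambda>s. cis (\<omega> * cov lf (\<eta> s))) (\<lambda>s. \<eta> s - cov lf (\<eta> s) *\<^sub>R v) 0 t
      (\<Sum>b\<in>B. cscale (E \<eta> \<omega> b t) (b, 0))"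
  proof (rule has_rs_integral_linear_combination[OF finite_B E_dint(4)[OF assms(1-4)] bounded_linear_cscale])
    fix x s s'
    define y where "y = (\<eta> s' - cov lf (\<eta> s') *\<^sub>R v) - (\<eta> s - cov lf (\<eta> s) *\<^sub>R v)"
    have d: "complex_of_real (cov (pr b) (\<eta> s')) - complex_of_real (cov (pr b) (\<eta> s)) = of_real (cov (cb b) y)" for b
      by (simp add: cov_pr y_def cov_simps)
    have "cscale (cis (\<omega> * cov lf (\<eta> x))) (y, 0) = cscale (cis (\<omega> * cov lf (\<eta> x))) (\<Sum>b\<in>B. (cov (cb b) y *\<^sub>R b, 0))"
      by (rule arg_cong[where f = "cscale _"]) (simp only: sum_prod expansion[of y, symmetric] sum.neutral_const)
    also have "\<dots> = (\<Sum>b\<in>B. cscale (cis (\<omega> * cov lf (\<eta> x)) * of_real (cov (cb b) y)) (b, 0))"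
      unfolding cscale_sum by (intro sum.cong refl) (simp add: cscale_def)
    finally show "cscale (cis (\<omega> * cov lf (\<eta> x))) ((\<eta> s' - cov lf (\<eta> s') *\<^sub>R v) - (\<eta> s - cov lf (\<eta> s) *\<^sub>R v), 0)
      = (\<Sum>b\<in>B. cscale (cis (\<omega> * cov lf (\<eta> x)) * (complex_of_real (cov (pr b) (\<eta> s')) - complex_of_real (cov (pr b) (\<eta> s)))) (b, 0))"
      unfolding d y_def[symmetric] .
  qed
  then show ?thesis using assms(5) by (simp add: deco_path_def rs_integral_unique)
qed

text \<open>A real functional of the decorated path is a complex combination of the integrals
  \<open>\<integral> exp (\<plusminus> i \<omega> x) d(pr b)(X)\<close>; the boolean selects the sign.\<close>

definition letter_set :: "(real \<times> 'v \<times> bool) set" where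
  "letter_set = \<Lambda> \<times> B \<times> UNIV"

definition freq :: "real \<times> 'v \<times> bool \<Rightarrow> real" where
  "freq q = (case q of (\<omega>, b, s) \<Rightarrow> if s then \<omega> else - \<omega>)"

definition letter_int :: "(real \<Rightarrow> 'v) \<Rightarrow> real \<times> 'v \<times> bool \<Rightarrow> real \<Rightarrow> complex" where
  "letter_int \<eta> q t = (case q of (\<omega>, b, s) \<Rightarrow> if s then E \<eta> \<omega> b t else cnj (E \<eta> \<omega> b t))"

text \<open>With \<open>p\<close> and \<open>r\<close> the values of \<open>f\<close> on the real
  and imaginary directions, \<open>Re z p + Im z r\<close> is rewritten as a complex combination of
  \<open>z\<close> and its conjugate; the halves come from
  \<open>Re z = (z + cnj z) / 2\<close>.\<close>

definition letter_coeff :: "(real \<Rightarrow> 'v cplx) covector \<Rightarrow> real \<times> 'v \<times> bool \<Rightarrow> complex" where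
  "letter_coeff f q = (case q of (\<omega>, b, s) \<Rightarrow>
     let p = of_real (cov f (\<lambda>\<omega>'. if \<omega>' = \<omega> then (b, 0) else 0));
         r = of_real (cov f (\<lambda>\<omega>'. if \<omega>' = \<omega> then (0, b) else 0))
     in if s then (p - \<i> * r) / 2 else (p + \<i> * r) / 2)"

lemma of_real_Re_Im_combination:
  "complex_of_real (Re z) * p + of_real (Im z) * r = (p + \<i> * r) / 2 * cnj z + (p - \<i> * r) / 2 * z"
  by (simp add: complex_eq_iff field_simps)

lemma finite_letter_set: "finite letter_set"
  by (simp add: letter_set_def finite_\<Lambda> finite_B)

lemma cov_deco:
  assumes "control V S" "control.tame V S \<eta>" "0 \<le> t" "t \<le> S"
  shows "complex_of_real (cov f (deco \<eta> t)) = (\<Sum>q\<in>letter_set. letter_coeff f q * letter_int \<eta> q t)"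
proof -
  define si where "si \<omega> z = (\<lambda>\<omega>'. if \<omega>' = \<omega> then z else 0)" for \<omega> :: real and z :: "'v cplx"
  have "deco \<eta> t = (\<Sum>\<omega>\<in>\<Lambda>. \<Sum>b\<in>B. Re (E \<eta> \<omega> b t) *\<^sub>R si \<omega> (b, 0) + Im (E \<eta> \<omega> b t) *\<^sub>R si \<omega> (0, b))"
  proof
    fix \<omega>'
    have "(\<Sum>\<omega>\<in>\<Lambda>. \<Sum>b\<in>B. Re (E \<eta> \<omega> b t) *\<^sub>R si \<omega> (b, 0) + Im (E \<eta> \<omega> b t) *\<^sub>R si \<omega> (0, b)) \<omega>'
       = (\<Sum>\<omega>\<in>\<Lambda>. if \<omega> = \<omega>' then (\<Sum>b\<in>B. cscale (E \<eta> \<omega>' b t) (b, 0)) else 0)"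
      unfolding sum_fun_apply
      by (intro sum.cong refl) (auto simp: si_def scaleR_fun_def plus_fun_def cscale_real intro!: sum.cong)
    also have "\<dots> = deco \<eta> t \<omega>'"
      using finite_\<Lambda> deco_eq[OF assms, of \<omega>'] by (simp add: deco_path_outside)
    finally show "deco \<eta> t \<omega>' = (\<Sum>\<omega>\<in>\<Lambda>. \<Sum>b\<in>B. Re (E \<eta> \<omega> b t) *\<^sub>R si \<omega> (b, 0) + Im (E \<eta> \<omega> b t) *\<^sub>R si \<omega> (0, b)) \<omega>'" by simp
  qed
  then have "complex_of_real (cov f (deco \<eta> t))
      = (\<Sum>\<omega>\<in>\<Lambda>. \<Sum>b\<in>B. of_real (Re (E \<eta> \<omega> b t) * cov f (si \<omega> (b, 0)) + Im (E \<eta> \<omega> b t) * cov f (si \<omega> (0, b))))"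
    by (simp add: cov_simps)
  also have "\<dots> = (\<Sum>\<omega>\<in>\<Lambda>. \<Sum>b\<in>B. \<Sum>s\<in>UNIV. letter_coeff f (\<omega>, b, s) * letter_int \<eta> (\<omega>, b, s) t)"
    by (intro sum.cong refl)
       (simp add: UNIV_bool letter_coeff_def letter_int_def si_def Let_def of_real_Re_Im_combination)
  also have "\<dots> = (\<Sum>q\<in>letter_set. letter_coeff f q * letter_int \<eta> q t)"
    unfolding letter_set_def by (simp add: sum.cartesian_product case_prod_unfold)
  finally show ?thesis .
qed

lemma letter_int_dint:
  assumes "control V S" "control.tame V S \<eta>"
  shows "control.dint V S (letter_int \<eta> q) (\<lambda>t. cis (freq q * cov lf (\<eta> t))) (\<lambda>t. of_real (cov (pr (fst (snd q))) (\<eta> t)))"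
    and "control.vlip V S (letter_int \<eta> q)"
proof -
  interpret control V S by fact
  obtain \<omega> b s where q: "q = (\<omega>, b, s)" by (cases q)
  note e = E_dint(1,3)[OF assms, of \<omega> b]
  have 1: "dint (\<lambda>t. cnj (E \<eta> \<omega> b t)) (\<lambda>t. cis (- \<omega> * cov lf (\<eta> t))) (\<lambda>t. of_real (cov (pr b) (\<eta> t)))"
    using dint_cnj[OF e(1)] by (simp add: cis_cnj)
  have 2: "vlip (\<lambda>t. cnj (E \<eta> \<omega> b t))" by (rule vlip_bounded_linear[OF e(2) bounded_linear_cnj])
  show "dint (letter_int \<eta> q) (\<lambda>t. cis (freq q * cov lf (\<eta> t))) (\<lambda>t. of_real (cov (pr (fst (snd q))) (\<eta> t)))"
    using e(1) 1 by (cases s) (simp_all add: q letter_int_def[abs_def] freq_def)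
  show "vlip (letter_int \<eta> q)"
    using e(2) 2 by (cases s) (simp_all add: q letter_int_def[abs_def])
qed

lemma tame_deco:
  assumes "control V S" "control.tame V S \<eta>"
  shows "control.tame V S (deco \<eta>)"
proof -
  interpret control V S by fact
  show ?thesis
    unfolding tame_def
  proof
    fix f
    have "vlip (\<lambda>t. Re (\<Sum>q\<in>letter_set. letter_coeff f q * letter_int \<eta> q t))"
      by (intro vlip_bounded_linear[OF _ bounded_linear_Re] vlip_sum vlip_cmult letter_int_dint(2) assms)
    then show "vlip (\<lambda>t. cov f (deco \<eta> t))"
      by (rule vlip_cong[where k = 0]) (simp add: cov_deco[OF assms, symmetric])
  qed
qed

text \<open>Each functional of the decorated path is a fixed combination of letters, so expanding
  all of them leaves integrals of letter words with coefficients independent of the time.\<close>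

lemma iter_int_deco_expansion:
  assumes "control V S" "control.tame V S \<eta>"
  shows "\<exists>W C. finite W \<and> (\<forall>w\<in>W. length w = length fs \<and> set w \<subseteq> letter_set) \<and>
    (\<forall>t. 0 \<le> t \<and> t \<le> S \<longrightarrow> complex_of_real (iter_int (deco \<eta>) fs t) = (\<Sum>w\<in>W. C w * iter_rs (letter_int \<eta>) w t))"
proof -
  interpret control V S by fact
  show ?thesis
  proof (induction fs)
    case Nil
    then show ?case by (intro exI[of _ "{[]}"] exI[of _ "\<lambda>_. 1"]) auto
  next
    case (Cons f fs)
    then obtain W C where W: "finite W" "\<And>w. w \<in> W \<Longrightarrow> length w = length fs \<and> set w \<subseteq> letter_set"
      "\<And>t. 0 \<le> t \<Longrightarrow> t \<le> S \<Longrightarrow> complex_of_real (iter_int (deco \<eta>) fs t) = (\<Sum>w\<in>W. C w * iter_rs (letter_int \<eta>) w t)"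
      by auto
    define W' where "W' = (\<lambda>(q, w). q # w) ` (letter_set \<times> W)"
    define C' where "C' w = letter_coeff f (hd w) * C (tl w)" for w
    have inj: "inj_on (\<lambda>(q, w). q # w) (letter_set \<times> W)" by (auto simp: inj_on_def)
    have sumW': "(\<Sum>w\<in>W'. C' w * iter_rs (letter_int \<eta>) w t)
       = (\<Sum>q\<in>letter_set. letter_coeff f q * (\<Sum>w\<in>W. C w * iter_rs (letter_int \<eta>) (q # w) t))" for t
      unfolding W'_def sum.reindex[OF inj]
      by (simp add: C'_def sum.cartesian_product sum_distrib_left case_prod_unfold mult.assoc del: iter_rs.simps)
    have G: "vlip (letter_int \<eta> q)" for q by (rule letter_int_dint(2)[OF assms])
    note ir = iter_rs_vlip_dint[of "letter_int \<eta>", OF G]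
    note ii = iter_int_vlip_dint[OF tame_deco[OF assms]]
    have "dint (\<lambda>t. \<Sum>q\<in>letter_set. letter_coeff f q * (\<Sum>w\<in>W. C w * iter_rs (letter_int \<eta>) (q # w) t))
        (\<lambda>t. \<Sum>w\<in>W. C w * iter_rs (letter_int \<eta>) w t) (\<lambda>t. \<Sum>q\<in>letter_set. letter_coeff f q * letter_int \<eta> q t)"
      by (intro dint_sum_right dint_cmult_right dint_sum_left dint_cmult_left ir)
    then have 1: "dint (\<lambda>t. \<Sum>w\<in>W'. C' w * iter_rs (letter_int \<eta>) w t)
        (\<lambda>t. complex_of_real (iter_int (deco \<eta>) fs t)) (\<lambda>t. of_real (cov f (deco \<eta> t)))"
      by (rule dint_cong[where k = 0]) (use W(3) sumW' cov_deco[OF assms] in auto)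
    have 2: "dint (\<lambda>t. complex_of_real (iter_int (deco \<eta>) (f # fs) t))
        (\<lambda>t. complex_of_real (iter_int (deco \<eta>) fs t)) (\<lambda>t. of_real (cov f (deco \<eta> t)))"
      by (rule dint_of_real[OF ii(2)])
    have "complex_of_real (iter_int (deco \<eta>) (f # fs) t) = (\<Sum>w\<in>W'. C' w * iter_rs (letter_int \<eta>) w t)"
      if "0 \<le> t" "t \<le> S" for t
      by (rule dint_unique[OF 2 1 _ that]) (simp add: ii(3) sumW' ir(3) del: iter_rs.simps iter_int.simps)
    moreover have "finite W'" using W(1) finite_letter_set by (simp add: W'_def)
    moreover have "length w = length (f # fs) \<and> set w \<subseteq> letter_set" if wW: "w \<in> W'" for w
    proof -
      obtain q w' where w: "w = q # w'" "q \<in> letter_set" "w' \<in> W" using wW by (auto simp: W'_def)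
      then show ?thesis using W(2)[of w'] by simp
    qed
    ultimately show ?case by (intro exI[of _ W'] exI[of _ C']) auto
  qed
qed

text \<open>After \<open>m\<close> copies the phase coordinate has grown by
  \<open>m * lf v = m\<close>, while transverse increments are unchanged because \<open>pr b\<close>
  vanishes on \<open>v\<close>. Every integrand thus gains the constant factor
  \<open>cis (m * \<omega>)\<close>, which is the \<open>m\<close>-th power of the rotation.\<close>

lemma deco_shift:
  assumes V: "control V (S + R)" "control.tame V (S + R) \<eta>" and S: "0 \<le> S" "0 \<le> R"
    and \<gamma>: "\<And>s. 0 \<le> s \<Longrightarrow> s \<le> R \<Longrightarrow> \<eta> (S + s) = real m *\<^sub>R v + \<gamma> s"
    and s: "0 \<le> s" "s \<le> R"
  shows "deco \<eta> (S + s) - deco \<eta> S = (deco_rot \<Lambda> ^^ m) (deco \<gamma> s)"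
proof -
  interpret control V "S + R" by (rule V)
  interpret W: control "\<lambda>s. V (S + s)" "S + R - S" by (rule control_shift) (use V S in auto)
  have W: "control (\<lambda>s. V (S + s)) R" using W.control_axioms by simp
  have cov\<gamma>: "cov f (\<eta> (S + s)) = real m * cov f v + cov f (\<gamma> s)" if "0 \<le> s" "s \<le> R" for f s
    using \<gamma>[OF that] by (simp add: cov_simps)
  have tame\<gamma>: "W.tame \<gamma>"
    unfolding W.tame_def
  proof
    fix f
    have "vlip (\<lambda>t. cov f (\<eta> t))" using V(2) by (simp add: tame_def)
    then have "W.vlip (\<lambda>s. cov f (\<eta> (S + s)))" by (rule vlip_shift[OF V(1) S(1), rotated]) (use S in simp)
    then show "W.vlip (\<lambda>t. cov f (\<gamma> t))"
      by (rule W.vlip_cong[where k = "- real m * cov f v"]) (use cov\<gamma> in simp)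
  qed
  have E: "E \<eta> \<omega> b (S + s) - E \<eta> \<omega> b S = cis (real m * \<omega>) * E \<gamma> \<omega> b s" for \<omega> b
  proof -
    have 1: "W.dint (\<lambda>s. E \<eta> \<omega> b (S + s) - E \<eta> \<omega> b S) (\<lambda>s. cis (\<omega> * cov lf (\<eta> (S + s)))) (\<lambda>s. of_real (cov (pr b) (\<eta> (S + s))))"
      unfolding W.dint_def
      using negl_shift[OF V(1) S(1) _ E_dint(1)[OF V, of \<omega> b, unfolded dint_def]] S by simp
    have "W.dint (\<lambda>s. cis (real m * \<omega>) * E \<gamma> \<omega> b s) (\<lambda>s. cis (real m * \<omega>) * cis (\<omega> * cov lf (\<gamma> s))) (\<lambda>s. of_real (cov (pr b) (\<gamma> s)))"
      by (intro W.dint_cmult_left E_dint(1)[OF W.control_axioms tame\<gamma>])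
    then have 2: "W.dint (\<lambda>s. cis (real m * \<omega>) * E \<gamma> \<omega> b s) (\<lambda>s. cis (\<omega> * cov lf (\<eta> (S + s)))) (\<lambda>s. of_real (cov (pr b) (\<eta> (S + s))))"
      by (rule W.dint_cong[where k = 0])
         (use cov\<gamma> lf_v in \<open>auto simp: cov_pr_v cis_mult algebra_simps\<close>)
    show ?thesis
      by (rule W.dint_unique[OF 1 2]) (use s E_dint(2)[OF W.control_axioms tame\<gamma>] in auto)
  qed
  show ?thesis
  proof
    fix \<omega>
    show "(deco \<eta> (S + s) - deco \<eta> S) \<omega> = (deco_rot \<Lambda> ^^ m) (deco \<gamma> s) \<omega>"
    proof (cases "\<omega> \<in> \<Lambda>")
      case True
      have "(deco \<eta> (S + s) - deco \<eta> S) \<omega> = (\<Sum>b\<in>B. cscale (E \<eta> \<omega> b (S + s)) (b, 0) - cscale (E \<eta> \<omega> b S) (b, 0))"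
        using S s True by (simp add: deco_eq[OF V] sum_subtractf)
      also have "\<dots> = (\<Sum>b\<in>B. cscale (cis (real m * \<omega>)) (cscale (E \<gamma> \<omega> b s) (b, 0)))"
        unfolding cscale_cscale E[symmetric] by (intro sum.cong refl) (simp add: cscale_real algebra_simps)
      also have "\<dots> = cscale (cis (real m * \<omega>)) (deco \<gamma> s \<omega>)"
        using s True by (simp add: deco_eq[OF W.control_axioms tame\<gamma>] cscale_sum)
      finally show ?thesis using True by (simp add: deco_rot_power deco_path_outside)
    next
      case False
      then show ?thesis by (simp add: deco_rot_power deco_path_outside)
    qed
  qed
qed

text \<open>Chen's identity splits off the last copy, whose decorated increments are the rotated
  ones by \<open>deco_shift\<close>.\<close>

lemma path_sig_deco_path_pow:
  assumes T: "0 < T" and \<gamma>: "tame_on T \<gamma>" and start: "\<gamma> 0 = 0" and endpoint: "\<gamma> T = v"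
  shows "path_sig (real m * T) (deco (path_pow T \<gamma> m))
    = tprod_list (map (\<lambda>k. (tmap (deco_rot \<Lambda>) ^^ k) (path_sig T (deco \<gamma>))) [0..<m])"
proof (induction m)
  case 0
  then show ?case by (simp add: path_sig_0_length tprod_list_def)
next
  case (Suc m)
  let ?S = "real m * T" and ?\<eta> = "path_pow T \<gamma> (Suc m)"
  obtain V where V: "control V (?S + T)" "control.tame V (?S + T) ?\<eta>"
    using tame_on_path_pow[OF \<gamma>, of "Suc m"] unfolding tame_on_def by (auto simp: algebra_simps)
  have S: "0 \<le> ?S" using T by simp
  have end_m: "path_pow T \<gamma> k (real k * T) = real k *\<^sub>R v" for k
  proof (induction k)
    case (Suc k)
    have "\<not> real (Suc k) * T \<le> real k * T" using T by (simp add: algebra_simps)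
    moreover have "real (Suc k) * T - real k * T = T" by (simp add: algebra_simps)
    ultimately show ?case using Suc by (simp add: path_concat_def start endpoint algebra_simps)
  qed simp
  have \<eta>: "?\<eta> (?S + s) = real m *\<^sub>R v + \<gamma> s" if "0 \<le> s" "s \<le> T" for s
    using that end_m[of m] by (auto simp: path_concat_def start)
  have "path_sig (?S + T) (deco ?\<eta>) = tmul (path_sig ?S (deco ?\<eta>)) (path_sig T (\<lambda>t. (deco_rot \<Lambda> ^^ m) (deco \<gamma> t)))"
  proof (rule path_sig_chen[OF V(1) S _ tame_deco[OF V]])
    fix f s assume s: "0 \<le> s" "s \<le> T"
    show "cov f ((deco_rot \<Lambda> ^^ m) (deco \<gamma> s)) = cov f (deco ?\<eta> (?S + s)) + - cov f (deco ?\<eta> ?S)"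
      using deco_shift[OF V S less_imp_le[OF T] \<eta> s] by (simp add: cov_simps(2)[symmetric] del: path_pow.simps)
  qed (use T in simp)
  also have "path_sig ?S (deco ?\<eta>) = path_sig ?S (deco (path_pow T \<gamma> m))"
  proof
    fix fs
    obtain V1 where V1: "control V1 ?S" "control.tame V1 ?S (path_pow T \<gamma> m)"
      using tame_on_path_pow[OF \<gamma>, of m] unfolding tame_on_def by auto
    interpret control V1 ?S by (rule V1)
    have "deco ?\<eta> t = deco (path_pow T \<gamma> m) t" if "t \<le> ?S" for t
      by (rule deco_path_cong) (use that in \<open>simp add: path_concat_def\<close>)
    then show "path_sig ?S (deco ?\<eta>) fs = path_sig ?S (deco (path_pow T \<gamma> m)) fs"
      unfolding path_sig_def
      by (intro iter_int_cong[OF tame_deco[OF V1], where k = "\<lambda>_. 0"]) (use S in auto)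
  qed
  finally show ?case
    using Suc by (simp add: tprod_list_snoc path_sig_linear_image_power[OF linear_deco_rot] algebra_simps del: path_pow.simps)
qed

end

section \<open>Triviality of the decorated signature\<close>

locale resonant_decoration = resonant_path B cb \<gamma> T v lf m + decoration B cb lf v \<Lambda>
  for B :: "'v::real_normed_vector set" and cb \<gamma> T v lf m \<Lambda> +
  assumes resonant: "\<And>\<omega>. \<omega> \<in> \<Lambda> \<Longrightarrow> real m * \<omega> \<in> (\<lambda>k. 2 * pi * k) ` \<int>"
begin

text \<open>All letters are resonant, conjugated ones included, and their integrators vanish on
  \<open>v\<close>, so the ladder argument applies to the word.\<close>

lemma iter_rs_letter_zero:
  assumes V: "control V T'" "control.tame V T' \<beta>" and w: "w \<noteq> []" "set w \<subseteq> letter_set"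
  shows "iter_rs (letter_int \<beta>) w T' = 0"
proof -
  interpret control V T' by (rule V)
  define n where "n = length w"
  \<comment> \<open>The head of a word is the outermost letter, so the partial integrals run over
    suffixes of growing length and \<open>q\<close> reads the word from its end.\<close>
  define u where "u k = iter_rs (letter_int \<beta>) (drop (n - k) w)" for k
  define q where "q j = w ! (n - Suc j)" for j
  have G: "vlip (letter_int \<beta> q)" for q by (rule letter_int_dint(2)[OF V])
  note ir = iter_rs_vlip_dint[of "letter_int \<beta>", OF G]
  have uS: "u (Suc j) = iter_rs (letter_int \<beta>) (q j # drop (n - j) w)" if "j < n" for j
  proof -
    have "drop (n - Suc j) w = w ! (n - Suc j) # drop (Suc (n - Suc j)) w"
      using that by (intro Cons_nth_drop_Suc[symmetric]) (simp add: n_def)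
    moreover have "Suc (n - Suc j) = n - j" using that by simp
    ultimately show ?thesis by (simp add: u_def q_def)
  qed
  have "u n T' = 0"
  proof (rule word_integral_zero[OF V, where \<omega> = "\<lambda>j. freq (q j)" and \<alpha> = "\<lambda>j. pr (fst (snd (q j)))"])
    show "n > 0" using w by (simp add: n_def)
    show "cov (pr (fst (snd (q j)))) v = 0" for j by (rule cov_pr_v)
    show "real m * freq (q j) \<in> (\<lambda>k. 2 * pi * k) ` \<int>" if "j < n" for j
    proof -
      have "q j \<in> letter_set" using w(2) that by (auto simp: q_def n_def)
      then obtain \<omega> b s where q: "q j = (\<omega>, b, s)" "\<omega> \<in> \<Lambda>" by (auto simp: letter_set_def)
      obtain k where k: "real m * \<omega> = 2 * pi * k" "k \<in> \<int>" using resonant[OF q(2)] by auto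
      show ?thesis
      proof (cases s)
        case True
        then show ?thesis using k q(1) by (auto simp: freq_def)
      next
        case False
        then show ?thesis using k q(1) by (intro image_eqI[of _ _ "- k"]) (auto simp: freq_def)
      qed
    qed
    show "u 0 t = 1" for t by (simp add: u_def n_def)
    show "u (Suc j) 0 = 0" if "j < n" for j unfolding uS[OF that] by (rule ir(3))
    show "negl (\<lambda>c c'. u (Suc j) c' - u (Suc j) c - u j c * cis (freq (q j) * cov lf (\<beta> c)) *
          of_real (cov (pr (fst (snd (q j)))) (\<beta> c') - cov (pr (fst (snd (q j)))) (\<beta> c)))" if j: "j < n" for j
    proof -
      have "negl (\<lambda>c c'. (u (Suc j) c' - u (Suc j) c - u j c * (letter_int \<beta> (q j) c' - letter_int \<beta> (q j) c))
         + u j c * (letter_int \<beta> (q j) c' - letter_int \<beta> (q j) c - cis (freq (q j) * cov lf (\<beta> c)) *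
          (of_real (cov (pr (fst (snd (q j)))) (\<beta> c')) - of_real (cov (pr (fst (snd (q j)))) (\<beta> c)))))"
        unfolding uS[OF j] unfolding u_def
        by (intro negl_add negl_mult_continuous vlip_continuous ir ir(2)[unfolded dint_def] letter_int_dint(1)[OF V, unfolded dint_def])
      then show ?thesis by (rule negl_cong) (simp add: algebra_simps)
    qed
  qed
  then show ?thesis by (simp add: u_def n_def)
qed

lemma path_sig_deco_power_trivial: "path_sig T' (deco \<beta>) = tone"
proof
  fix fs
  obtain V where V: "control V T'" "control.tame V T' \<beta>"
    using tame_on_path_pow[OF tame_\<gamma>, of m] unfolding tame_on_def by auto
  obtain W C where W: "finite W" "\<And>w. w \<in> W \<Longrightarrow> length w = length (rev fs) \<and> set w \<subseteq> letter_set"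
    "\<And>t. 0 \<le> t \<Longrightarrow> t \<le> T' \<Longrightarrow> complex_of_real (iter_int (deco \<beta>) (rev fs) t) = (\<Sum>w\<in>W. C w * iter_rs (letter_int \<beta>) w t)"
    using iter_int_deco_expansion[OF V, of "rev fs"] by auto
  show "path_sig T' (deco \<beta>) fs = tone fs"
  proof (cases "fs = []")
    case True
    then show ?thesis by (simp add: path_sig_def tone_def)
  next
    case False
    have "complex_of_real (path_sig T' (deco \<beta>) fs) = (\<Sum>w\<in>W. C w * iter_rs (letter_int \<beta>) w T')"
      unfolding path_sig_def by (rule W(3)[OF T'_nonneg order_refl])
    also have "\<dots> = 0"
    proof (rule sum.neutral, rule ballI)
      fix w assume w: "w \<in> W"
      have "w \<noteq> []" using W(2)[OF w] False by auto
      then show "C w * iter_rs (letter_int \<beta>) w T' = 0"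
        using iter_rs_letter_zero[OF V] W(2)[OF w] by simp
    qed
    finally show ?thesis using False by (simp add: tone_def)
  qed
qed

end

section \<open>Paths of bounded variation and conclusion\<close>

text \<open>The control is the variation function. Its increments dominate those of the path because
  a division of \<open>[0, t]\<close> extends to \<open>[0, t']\<close> by one more cell.\<close>

lemma tame_on_of_bounded_variation:
  fixes \<gamma> :: "real \<Rightarrow> 'v::real_normed_vector"
  assumes "dual_basis B (cb :: 'v \<Rightarrow> 'v covector)" and T: "0 \<le> T"
    and cont: "continuous_on {0..T} \<gamma>" and bv: "bounded_variation_on 0 T \<gamma>"
  shows "tame_on T \<gamma>"
proof -
  interpret dual_basis B cb by fact
  obtain K where K: "\<And>D. D division_of {0..T} \<Longrightarrow> (\<Sum>K\<in>D. norm (\<gamma> (Sup K) - \<gamma> (Inf K))) \<le> K"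
    using bv unfolding bounded_variation_on_def by auto
  define var where "var D = (\<Sum>K\<in>D. norm (\<gamma> (Sup K) - \<gamma> (Inf K)))" for D :: "real set set"
  have ext: "insert {t..t'} D division_of {0..t'} \<and> var (insert {t..t'} D) = norm (\<gamma> t' - \<gamma> t) + var D"
    if D: "D division_of {0..t}" and t: "0 \<le> t" "t < t'" for D t t'
  proof -
    have sub: "L \<subseteq> {0..t}" if "L \<in> D" for L using division_ofD(2)[OF D that] .
    have "{{t..t'}} division_of {t..t'}" using t division_of_self[of t t'] by simp
    moreover have "interior {0..t} \<inter> interior {t..t'} = {}" by simp
    ultimately have "D \<union> {{t..t'}} division_of {0..t} \<union> {t..t'}"
      using division_disjoint_union[OF D, of "{{t..t'}}" "{t..t'}"] by auto
    moreover have "{0..t} \<union> {t..t'} = {0..t'}" using t by auto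
    ultimately have 1: "insert {t..t'} D division_of {0..t'}" by simp
    have "{t..t'} \<notin> D"
    proof
      assume "{t..t'} \<in> D"
      then have "{t..t'} \<subseteq> {0..t}" by (rule sub)
      then show False using t by auto
    qed
    then show ?thesis using 1 t division_of_finite[OF D] by (simp add: var_def)
  qed
  define V where "V t = (SUP D\<in>{D. D division_of {0..t}}. var D)" for t
  \<comment> \<open>Only divisions of \<open>[0, T]\<close> are bounded by assumption; a division of
    \<open>[0, t]\<close> is completed by the cell \<open>[t, T]\<close>.\<close>
  have varK: "var D \<le> K" if D: "D division_of {0..t}" and t: "0 \<le> t" "t \<le> T" for D t
  proof (cases "t = T")
    case True
    then show ?thesis using K D by (simp add: var_def)
  next
    case False
    then have "t < T" using t by simp
    note e = ext[OF D t(1) this]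
    have "var (insert {t..T} D) \<le> K" unfolding var_def by (rule K[OF e[THEN conjunct1]])
    then show ?thesis using e[THEN conjunct2] norm_ge_zero[of "\<gamma> T - \<gamma> t"] by linarith
  qed
  have bdd: "bdd_above (var ` {D. D division_of {0..t}})" if "0 \<le> t" "t \<le> T" for t
    by (rule bdd_aboveI2[where M = K]) (use varK that in auto)
  have ne: "{D. D division_of {0..t}} \<noteq> {}" if "0 \<le> t" for t :: real
    using that division_of_self[of 0 t] by (auto intro!: exI[of _ "{{0..t}}"])
  have step: "norm (\<gamma> t' - \<gamma> t) \<le> V t' - V t" if t: "0 \<le> t" "t \<le> t'" "t' \<le> T" for t t'
  proof (cases "t = t'")
    case False
    then have tt: "t < t'" using t by simp
    have "V t \<le> V t' - norm (\<gamma> t' - \<gamma> t)"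
      unfolding V_def[of t]
    proof (rule cSUP_least[OF ne[OF t(1)]])
      fix D assume "D \<in> {D. D division_of {0..t}}"
      then have e: "insert {t..t'} D division_of {0..t'}" "var (insert {t..t'} D) = norm (\<gamma> t' - \<gamma> t) + var D"
        using ext[of D t t'] t(1) tt by auto
      have "var (insert {t..t'} D) \<le> V t'"
        unfolding V_def by (rule cSUP_upper[OF _ bdd]) (use e t in auto)
      then show "var D \<le> V t' - norm (\<gamma> t' - \<gamma> t)" using e(2) by linarith
    qed
    then show ?thesis by linarith
  qed simp
  interpret control V T
  proof
    show "mono_on {0..T} V"
    proof (rule mono_onI)
      fix r s assume "r \<in> {0..T}" "s \<in> {0..T}" "r \<le> s"
      then have "norm (\<gamma> s - \<gamma> r) \<le> V s - V r" by (intro step) auto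
      from order_trans[OF norm_ge_zero this] show "V r \<le> V s" by simp
    qed
  qed (rule T)
  have "tame \<gamma>"
    unfolding tame_def
  proof
    fix f :: "'v covector"
    obtain k where k: "k \<ge> 0" "\<And>x. \<bar>cov f x\<bar> \<le> k * norm x" using functional_bounded[of f] by auto
    have bl: "bounded_linear (cov f)"
      by (rule bounded_linear_intro[where K = k]) (use k in \<open>auto simp: cov_simps mult.commute\<close>)
    show "vlip (\<lambda>t. cov f (\<gamma> t))"
    proof (rule vlipI[where k = k])
      show "continuous_on {0..T} (\<lambda>t. cov f (\<gamma> t))" by (rule bounded_linear.continuous_on[OF bl cont])
      fix c c' assume c: "0 \<le> c" "c \<le> c'" "c' \<le> T"
      have "norm (cov f (\<gamma> c') - cov f (\<gamma> c)) \<le> k * norm (\<gamma> c' - \<gamma> c)"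
        using k(2)[of "\<gamma> c' - \<gamma> c"] by (simp add: cov_simps)
      also have "\<dots> \<le> k * (V c' - V c)" using step[OF c] k(1) by (rule mult_left_mono)
      finally show "norm (cov f (\<gamma> c') - cov f (\<gamma> c)) \<le> k * (V c' - V c)" .
    qed
  qed
  then show ?thesis unfolding tame_on_def using control_axioms by blast
qed

text \<open>The two conclusions are one statement by \<open>path_sig_deco_path_pow\<close>; the
  vanishing integrals give the one about the path directly.\<close>

theorem proposition5p6:
  fixes \<gamma> :: "real \<Rightarrow> 'v::real_normed_vector" and T :: real and v :: 'v
    and l :: "'v \<Rightarrow> real" and \<Lambda> :: "real set" and m :: nat
    and h :: "(real \<Rightarrow> 'v cplx, real) tseries"
  assumes finite_dim: "\<exists>B :: 'v set. finite B \<and> span B = UNIV"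
    and dim_ge_2: "dim (UNIV :: 'v set) \<ge> 2"
    and T_pos: "T > 0"
    and cont: "continuous_on {0..T} \<gamma>"
    and bv: "bounded_variation_on 0 T \<gamma>"
    and start: "\<gamma> 0 = 0"
    and endpoint: "v = \<gamma> T" "v \<noteq> 0"
    and radius: "tradius (tlog (path_sig T \<gamma>)) = \<infinity>"
    and l: "linear l" "l v = 1"
    and Lambda_fin: "finite \<Lambda>"
    and Lambda_sym: "uminus ` \<Lambda> = \<Lambda>"
    and Lambda_rat: "\<Lambda> \<subseteq> (\<lambda>q. 2 * pi * q) ` \<rat>"
    and h: "h = path_sig T (deco_path \<Lambda> l v \<gamma>)"
    and m_ge_1: "m \<ge> 1"
    and m_Lambda: "\<forall>\<omega>\<in>\<Lambda>. real m * \<omega> \<in> (\<lambda>k. 2 * pi * k) ` \<int>"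
  shows "tprod_list (map (\<lambda>k. (tmap (deco_rot \<Lambda>) ^^ k) h) [0..<m]) = tone \<and>
         path_sig (real m * T) (deco_path \<Lambda> l v (path_pow T \<gamma> m)) = tone"
proof -
  obtain B cb where "dual_basis (B :: 'v set) cb" by (rule dual_basis_exists[OF finite_dim]) (rule that)
  interpret dual_basis B cb by fact
  define lf where "lf = Abs_covector l"
  have cov_lf: "cov lf = l" unfolding lf_def by (rule cov_Abs_covector[OF l(1)])
  have tame: "tame_on T \<gamma>"
    by (rule tame_on_of_bounded_variation[OF dual_basis_axioms _ cont bv]) (use T_pos in simp)
  note path_facts = T_pos tame start endpoint(1)[symmetric]
  interpret resonant_decoration B cb \<gamma> T v lf m \<Lambda>
    by unfold_locales (use T_pos tame start endpoint cov_lf l radius m_ge_1 Lambda_fin m_Lambda in auto)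
  have 2: "path_sig (real m * T) (deco_path \<Lambda> l v (path_pow T \<gamma> m)) = tone"
    using path_sig_deco_power_trivial by (simp only: cov_lf)
  have "path_sig (real m * T) (deco_path \<Lambda> l v (path_pow T \<gamma> m))
      = tprod_list (map (\<lambda>k. (tmap (deco_rot \<Lambda>) ^^ k) h) [0..<m])"
    using path_sig_deco_path_pow[OF path_facts, of m] by (simp only: cov_lf h)
  then show ?thesis using 2 by simp
qed

end
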